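(* Let $\mathcal I$ be either of the spaces $\mathcal B$ or $\mathcal P_\infty$. Then: (1) The infinite-dimensional separable Hilbert space $\ell_2$ is the unique (up to linear isometry) separable infinite-dimensional Banach space whose isometry class is closed; that is, for a separable infinite-dimensional Banach space $X$, the set $\{\mu\in\mathcal I : X_\mu \text{ is linearly isometric to } X\}$ is closed in $\mathcal I$ if and only if $X$ is linearly isometric to $\ell_2$. (2) $\ell_2$ is the unique, up to isomorphism, separable infinite-dimensional Banach space whose isomorphism class is $F_\sigma$; that is, for a separable infinite-dimensional Banach space $X$, the set $\{\mu\in\mathcal I : X_\mu \text{ is linearly isomorphic to } X\}$ is an $F_\sigma$-set in $\mathcal I$ if and only if $X$ is linearly isomorphic to $\ell_2$.
   Context: All Banach spaces are real. Let $V$ be the vector space over $\mathbb Q$ of all finitely supported sequences of rational numbers, with canonical basis $(e_n)_{n\in\mathbb N}$. $\mathcal P$ denotes the space of all pseudonorms on $V$, a closed subset of $\mathbb R^V$ with the inherited (Polish) topology of pointwise convergence. Each $\mu\in\mathcal P$ is identified with its unique extension to a pseudonorm on the real vector space $c_{00}$ of finitely supported real sequences, and $X_\mu$ denotes the Banach space obtained as the completion of the quotient of $(c_{00},\mu)$ by $\{x\in c_{00}:\mu(x)=0\}$. $\mathcal P_\infty$ is the set of $\mu\in\mathcal P$ for which $X_\mu$ is infinite-dimensional, and $\mathcal B$ is the set of $\mu\in\mathcal P_\infty$ whose extension to $c_{00}$ is a norm. Both carry the subspace topology (which is Polish). *)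

theory Defs
  imports "HOL-Analysis.Analysis" "HOL-Library.Poly_Mapping"
begin

section \<open>The Hilbert space of square-summable real sequences\<close>

typedef l2 = "{x :: nat \<Rightarrow> real. summable (\<lambda>n. (x n)\<^sup>2)}"
  morphisms l2_nth Abs_l2
  by (rule exI[of _ "\<lambda>_. 0"]) simp

setup_lifting type_definition_l2

lemma l2_summable_mult:
  fixes x y :: "nat \<Rightarrow> real"
  assumes "summable (\<lambda>n. (x n)\<^sup>2)" "summable (\<lambda>n. (y n)\<^sup>2)"
  shows "summable (\<lambda>n. x n * y n)"
proof (rule summable_comparison_test')
  show "summable (\<lambda>n. (x n)\<^sup>2 + (y n)\<^sup>2)"
    using assms by (rule summable_add)
  fix n :: nat
  have "0 \<le> (\<bar>x n\<bar> - \<bar>y n\<bar>)\<^sup>2" "0 \<le> \<bar>x n\<bar> * \<bar>y n\<bar>"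
    by simp_all
  then have "\<bar>x n\<bar> * \<bar>y n\<bar> \<le> (x n)\<^sup>2 + (y n)\<^sup>2"
    unfolding power2_diff power2_abs by linarith
  then show "norm (x n * y n) \<le> (x n)\<^sup>2 + (y n)\<^sup>2"
    by (simp add: abs_mult)
qed

lemma l2_summable_add:
  fixes x y :: "nat \<Rightarrow> real"
  assumes "summable (\<lambda>n. (x n)\<^sup>2)" "summable (\<lambda>n. (y n)\<^sup>2)"
  shows "summable (\<lambda>n. (x n + y n)\<^sup>2)"
  using summable_add[OF summable_add[OF assms] summable_mult[OF l2_summable_mult[OF assms], of 2]]
  by (simp add: power2_sum mult.assoc)

lemma l2_summable_scale:
  fixes x :: "nat \<Rightarrow> real"
  assumes "summable (\<lambda>n. (x n)\<^sup>2)"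
  shows "summable (\<lambda>n. (r * x n)\<^sup>2)"
  using summable_mult[OF assms, of "r\<^sup>2"] by (simp add: power_mult_distrib)

instantiation l2 :: real_vector
begin

lift_definition zero_l2 :: l2 is "\<lambda>_. 0" by simp
lift_definition plus_l2 :: "l2 \<Rightarrow> l2 \<Rightarrow> l2" is "\<lambda>x y n. x n + y n"
  by (rule l2_summable_add)
lift_definition scaleR_l2 :: "real \<Rightarrow> l2 \<Rightarrow> l2" is "\<lambda>r x n. r * x n"
  by (rule l2_summable_scale)
lift_definition uminus_l2 :: "l2 \<Rightarrow> l2" is "\<lambda>x n. - x n"
  by simp
lift_definition minus_l2 :: "l2 \<Rightarrow> l2 \<Rightarrow> l2" is "\<lambda>x y n. x n - y n"
  using l2_summable_add[of _ "\<lambda>n. - _ n"] by simp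

instance
  by standard (transfer; simp add: fun_eq_iff algebra_simps)+

end

instantiation l2 :: real_inner
begin

lift_definition inner_l2 :: "l2 \<Rightarrow> l2 \<Rightarrow> real" is "\<lambda>x y. suminf (\<lambda>n. x n * y n)" .

definition norm_l2 :: "l2 \<Rightarrow> real" where "norm_l2 x = sqrt (inner x x)"
definition sgn_l2 :: "l2 \<Rightarrow> l2" where "sgn_l2 x = x /\<^sub>R norm x"
definition dist_l2 :: "l2 \<Rightarrow> l2 \<Rightarrow> real" where "dist_l2 x y = norm (x - y)"
definition uniformity_l2 :: "(l2 \<times> l2) filter"
  where "uniformity_l2 = (INF e\<in>{0<..}. principal {(x, y). dist x y < e})"
definition open_l2 :: "l2 set \<Rightarrow> bool"
  where "open_l2 U \<longleftrightarrow> (\<forall>x\<in>U. \<forall>\<^sub>F (x', y) in uniformity. x' = x \<longrightarrow> y \<in> U)"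

instance
proof
  fix x y z :: l2 and r :: real and U :: "l2 set"
  show "sgn x = x /\<^sub>R norm x" by (rule sgn_l2_def)
  show "dist x y = norm (x - y)" by (rule dist_l2_def)
  show "(uniformity :: (l2 \<times> l2) filter) = (INF e\<in>{0<..}. principal {(x, y). dist x y < e})"
    by (rule uniformity_l2_def)
  show "open U = (\<forall>x\<in>U. \<forall>\<^sub>F (x', y) in uniformity. x' = x \<longrightarrow> y \<in> U)"
    by (rule open_l2_def)
  show "inner x y = inner y x"
    by transfer (simp add: mult.commute)
  show "inner (x + y) z = inner x z + inner y z"
    by transfer (simp add: distrib_right suminf_add l2_summable_mult)
  show "inner (r *\<^sub>R x) y = r * inner x y"
    by transfer (simp add: mult.assoc suminf_mult l2_summable_mult)
  show "0 \<le> inner x x"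
    by transfer (simp add: suminf_nonneg flip: power2_eq_square)
  show "inner x x = 0 \<longleftrightarrow> x = 0"
    by transfer (simp add: suminf_eq_zero_iff fun_eq_iff flip: power2_eq_square)
  show "norm x = sqrt (inner x x)"
    by (rule norm_l2_def)
qed

end

lemma l2_norm_sq: "(norm x)\<^sup>2 = suminf (\<lambda>n. (l2_nth x n)\<^sup>2)" for x :: l2
  unfolding power2_norm_eq_inner by transfer (simp add: power2_eq_square)

lemma l2_sum_le_norm: "(\<Sum>n<N. (l2_nth x n)\<^sup>2) \<le> (norm x)\<^sup>2"
  unfolding l2_norm_sq using l2_nth[of x] by (intro sum_le_suminf) auto

lemma l2_nth_le_norm: "\<bar>l2_nth x n\<bar> \<le> norm x"
proof -
  have "(l2_nth x n)\<^sup>2 \<le> (\<Sum>k<Suc n. (l2_nth x k)\<^sup>2)"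
    by (rule member_le_sum) auto
  also have "\<dots> \<le> (norm x)\<^sup>2" by (rule l2_sum_le_norm)
  finally have "\<bar>l2_nth x n\<bar> \<le> \<bar>norm x\<bar>" by (simp only: abs_le_square_iff)
  then show ?thesis by simp
qed

instance l2 :: banach
proof
  fix X :: "nat \<Rightarrow> l2"
  assume X: "Cauchy X"
  have nth_diff: "l2_nth (x - y) n = l2_nth x n - l2_nth y n" for x y n
    by transfer simp
  have "Cauchy (\<lambda>m. l2_nth (X m) n)" for n
  proof (rule metric_CauchyI)
    fix e :: real assume "0 < e"
    then obtain M where M: "\<And>m k. m \<ge> M \<Longrightarrow> k \<ge> M \<Longrightarrow> norm (X m - X k) < e"
      using CauchyD[OF X] by metis
    have "dist (l2_nth (X m) n) (l2_nth (X k) n) < e" if "m \<ge> M" "k \<ge> M" for m k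
      using M[OF that] l2_nth_le_norm[of "X m - X k" n] by (simp add: dist_norm nth_diff)
    then show "\<exists>M. \<forall>m\<ge>M. \<forall>k\<ge>M. dist (l2_nth (X m) n) (l2_nth (X k) n) < e" by blast
  qed
  then have conv: "convergent (\<lambda>m. l2_nth (X m) n)" for n
    by (simp only: Cauchy_convergent_iff)
  define z where "z n = lim (\<lambda>m. l2_nth (X m) n)" for n
  have z: "(\<lambda>m. l2_nth (X m) n) \<longlonglongrightarrow> z n" for n
    unfolding z_def using conv[of n] by (simp only: convergent_LIMSEQ_iff)
  have part: "(\<Sum>n<N. (l2_nth (X m) n - z n)\<^sup>2) \<le> e\<^sup>2"
    if M: "\<forall>m\<ge>M. \<forall>k\<ge>M. norm (X m - X k) < e" and m: "m \<ge> M" for M m N e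
  proof (rule tendsto_upperbound)
    show "(\<lambda>k. \<Sum>n<N. (l2_nth (X m) n - l2_nth (X k) n)\<^sup>2)
        \<longlonglongrightarrow> (\<Sum>n<N. (l2_nth (X m) n - z n)\<^sup>2)"
      by (intro tendsto_sum tendsto_power tendsto_diff tendsto_const z)
    show "\<forall>\<^sub>F k in sequentially. (\<Sum>n<N. (l2_nth (X m) n - l2_nth (X k) n)\<^sup>2) \<le> e\<^sup>2"
      unfolding eventually_sequentially
    proof (intro exI[of _ M] allI impI)
      fix k assume "M \<le> k"
      with M m have "norm (X m - X k) \<le> e" using less_imp_le by blast
      then have "(norm (X m - X k))\<^sup>2 \<le> e\<^sup>2" by (intro power_mono) auto
      with l2_sum_le_norm[where N = N and x = "X m - X k"]
      show "(\<Sum>n<N. (l2_nth (X m) n - l2_nth (X k) n)\<^sup>2) \<le> e\<^sup>2"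
        by (simp add: nth_diff)
    qed
  qed simp
  have cau: "\<exists>M. \<forall>m\<ge>M. \<forall>k\<ge>M. norm (X m - X k) < e" if "e > 0" for e
    using X that by (rule CauchyD)
  have sum_diff: "summable (\<lambda>n. (l2_nth (X m) n - z n)\<^sup>2)"
    and norm_diff: "suminf (\<lambda>n. (l2_nth (X m) n - z n)\<^sup>2) \<le> e\<^sup>2"
    if "\<forall>m\<ge>M. \<forall>k\<ge>M. norm (X m - X k) < e" "m \<ge> M" for M m e
  proof -
    show "summable (\<lambda>n. (l2_nth (X m) n - z n)\<^sup>2)"
    proof (rule bounded_imp_summable)
      fix n
      show "(\<Sum>k\<le>n. (l2_nth (X m) k - z k)\<^sup>2) \<le> e\<^sup>2"
        using part[OF that, where N = "Suc n"] by (simp add: lessThan_Suc_atMost)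
    qed simp
    then show "suminf (\<lambda>n. (l2_nth (X m) n - z n)\<^sup>2) \<le> e\<^sup>2"
      by (rule suminf_le_const) (rule part[OF that])
  qed
  obtain M1 where M1: "\<forall>m\<ge>M1. \<forall>k\<ge>M1. norm (X m - X k) < 1"
    using cau[of 1] by auto
  have "summable (\<lambda>n. (l2_nth (X M1) n + (-1) * (l2_nth (X M1) n - z n))\<^sup>2)"
  proof (rule l2_summable_add)
    show "summable (\<lambda>n. (l2_nth (X M1) n)\<^sup>2)" using l2_nth[of "X M1"] by simp
    show "summable (\<lambda>n. ((-1) * (l2_nth (X M1) n - z n))\<^sup>2)"
      by (rule l2_summable_scale, rule sum_diff[OF M1 order_refl])
  qed
  then have zsum: "summable (\<lambda>n. (z n)\<^sup>2)" by simp
  define Z where "Z = Abs_l2 z"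
  have Z: "l2_nth Z n = z n" for n
    unfolding Z_def using zsum by (simp add: Abs_l2_inverse)
  have "X \<longlonglongrightarrow> Z"
  proof (rule LIMSEQ_I)
    fix r :: real assume r: "r > 0"
    obtain M where M: "\<forall>m\<ge>M. \<forall>k\<ge>M. norm (X m - X k) < r / 2"
      using cau[of "r / 2"] r by auto
    have "norm (X m - Z) < r" if "m \<ge> M" for m
    proof -
      have "(norm (X m - Z))\<^sup>2 \<le> (r / 2)\<^sup>2"
        unfolding l2_norm_sq nth_diff Z by (rule norm_diff[OF M that])
      then have "norm (X m - Z) \<le> r / 2"
        by (rule power2_le_imp_le) (use r in simp)
      with r show ?thesis by simp
    qed
    then show "\<exists>no. \<forall>n\<ge>no. norm (X n - Z) < r" by blast
  qed
  then show "convergent X" by (rule convergentI)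
qed


section \<open>Pseudonormed real vector spaces on a carrier\<close>

text \<open>
  The spaces \<open>X\<^sub>\<mu>\<close> depend on a term \<open>\<mu>\<close> and so cannot be types of class \<^class>\<open>banach\<close>; they are
  represented by their carrier, operations and (pseudo)norm.  The constructions below are applied
  only to records that satisfy the axioms of a pseudonormed space.
\<close>

record 'a nspace =
  points :: "'a set"
  nadd :: "'a \<Rightarrow> 'a \<Rightarrow> 'a"
  nscale :: "real \<Rightarrow> 'a \<Rightarrow> 'a"
  nnorm :: "'a \<Rightarrow> real"

definition space_of_type :: "'a::real_normed_vector itself \<Rightarrow> 'a nspace" where
  "space_of_type _ = \<lparr>points = UNIV, nadd = (+), nscale = scaleR, nnorm = norm\<rparr>"

definition ndist :: "'a nspace \<Rightarrow> 'a \<Rightarrow> 'a \<Rightarrow> real" where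
  "ndist S x y = nnorm S (nadd S x (nscale S (-1) y))"

definition kernel_rel :: "'a nspace \<Rightarrow> ('a \<times> 'a) set" where
  "kernel_rel S = {(x, y). x \<in> points S \<and> y \<in> points S \<and> ndist S x y = 0}"

definition kernel_quotient :: "'a nspace \<Rightarrow> 'a set nspace" where
  "kernel_quotient S =
    \<lparr>points = points S // kernel_rel S,
     nadd = (\<lambda>A B. kernel_rel S `` {nadd S a b | a b. a \<in> A \<and> b \<in> B}),
     nscale = (\<lambda>r A. kernel_rel S `` (nscale S r ` A)),
     nnorm = (\<lambda>A. the_elem (nnorm S ` A))\<rparr>"

definition cauchy_space :: "'a nspace \<Rightarrow> (nat \<Rightarrow> 'a) nspace" where
  "cauchy_space S =
    \<lparr>points = {s. (\<forall>n. s n \<in> points S) \<and>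
        (\<forall>e>0. \<exists>N. \<forall>m\<ge>N. \<forall>n\<ge>N. ndist S (s m) (s n) < e)},
     nadd = (\<lambda>s t n. nadd S (s n) (t n)),
     nscale = (\<lambda>r s n. nscale S r (s n)),
     nnorm = (\<lambda>s. lim (\<lambda>n. nnorm S (s n)))\<rparr>"

text \<open>Two Cauchy sequences are \<^const>\<open>kernel_rel\<close>-related iff their difference tends to \<open>0\<close> in norm.\<close>

definition completion :: "'a nspace \<Rightarrow> (nat \<Rightarrow> 'a) set nspace" where
  "completion S = kernel_quotient (cauchy_space S)"

definition nlinear_bij :: "'a nspace \<Rightarrow> 'b nspace \<Rightarrow> ('a \<Rightarrow> 'b) \<Rightarrow> bool" where
  "nlinear_bij S T f \<longleftrightarrow> bij_betw f (points S) (points T) \<and>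
    (\<forall>x\<in>points S. \<forall>y\<in>points S. f (nadd S x y) = nadd T (f x) (f y)) \<and>
    (\<forall>r. \<forall>x\<in>points S. f (nscale S r x) = nscale T r (f x))"

definition linearly_isometric :: "'a nspace \<Rightarrow> 'b nspace \<Rightarrow> bool" where
  "linearly_isometric S T \<longleftrightarrow>
    (\<exists>f. nlinear_bij S T f \<and> (\<forall>x\<in>points S. nnorm T (f x) = nnorm S x))"

definition linearly_isomorphic :: "'a nspace \<Rightarrow> 'b nspace \<Rightarrow> bool" where
  "linearly_isomorphic S T \<longleftrightarrow>
    (\<exists>f K. nlinear_bij S T f \<and>
      (\<forall>x\<in>points S. nnorm T (f x) \<le> K * nnorm S x \<and> nnorm S x \<le> K * nnorm T (f x)))"

text \<open>
  There is no distinguished zero, so the span of the empty set is empty here; the zero space is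
  spanned by \<open>{0}\<close> and hence still finite-dimensional.
\<close>

inductive_set nspan :: "'a nspace \<Rightarrow> 'a set \<Rightarrow> 'a set" for S B where
  base: "x \<in> B \<Longrightarrow> x \<in> nspan S B"
| add: "x \<in> nspan S B \<Longrightarrow> y \<in> nspan S B \<Longrightarrow> nadd S x y \<in> nspan S B"
| scale: "x \<in> nspan S B \<Longrightarrow> nscale S r x \<in> nspan S B"

definition infinite_dimensional :: "'a nspace \<Rightarrow> bool" where
  "infinite_dimensional S \<longleftrightarrow>
    \<not> (\<exists>B. finite B \<and> B \<subseteq> points S \<and> nspan S B = points S)"

lemma infinite_dimensional_space_of_type:
  "infinite_dimensional (space_of_type TYPE('a)) \<longleftrightarrow>
    \<not> (\<exists>B :: 'a::real_normed_vector set. finite B \<and> span B = UNIV)"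
proof -
  let ?S = "space_of_type TYPE('a)"
  have le: "nspan ?S B \<subseteq> span B" for B
  proof
    fix x assume "x \<in> nspan ?S B"
    then show "x \<in> span B"
      by induction (auto simp: space_of_type_def intro: span_base span_add span_scale)
  qed
  have ge: "span B \<subseteq> nspan ?S (insert 0 B)" for B
  proof (rule span_minimal)
    show "B \<subseteq> nspan ?S (insert 0 B)" by (auto intro: nspan.base)
    show "subspace (nspan ?S (insert 0 B))"
      unfolding subspace_def
      using nspan.base[of 0 "insert 0 B" ?S] nspan.add[of _ ?S "insert 0 B"]
        nspan.scale[of _ ?S "insert 0 B"]
      by (auto simp: space_of_type_def)
  qed
  have pts: "points ?S = UNIV" by (simp add: space_of_type_def)
  have "(\<exists>B. finite B \<and> nspan ?S B = UNIV) \<longleftrightarrow> (\<exists>B :: 'a set. finite B \<and> span B = UNIV)"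
  proof
    assume "\<exists>B. finite B \<and> nspan ?S B = UNIV"
    then show "\<exists>B :: 'a set. finite B \<and> span B = UNIV"
    proof (elim exE conjE)
      fix B assume "finite B" and B: "nspan ?S B = UNIV"
      have "span B = UNIV" using le[of B] unfolding B by (rule top.extremum_uniqueI)
      with \<open>finite B\<close> show ?thesis by (intro exI conjI)
    qed
  next
    assume "\<exists>B :: 'a set. finite B \<and> span B = UNIV"
    then obtain B :: "'a set" where "finite B" "span B = UNIV" by blast
    with ge[of B] show "\<exists>B. finite B \<and> nspan ?S B = UNIV"
      by (intro exI[of _ "insert 0 B"] conjI finite.insertI top.extremum_uniqueI) simp_all
  qed
  then show ?thesis
    unfolding infinite_dimensional_def pts by simp
qed


section \<open>The spaces of pseudonorms\<close>

type_synonym V = "nat \<Rightarrow>\<^sub>0 rat"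
type_synonym c00 = "nat \<Rightarrow>\<^sub>0 real"

text \<open>Nonnegativity and \<open>\<mu> 0 = 0\<close> follow from the two axioms.\<close>

definition pseudonorms :: "(V \<Rightarrow> real) set" where
  "pseudonorms = {\<mu>. (\<forall>x y. \<mu> (x + y) \<le> \<mu> x + \<mu> y) \<and>
    (\<forall>q x. \<mu> (Poly_Mapping.map ((*) q) x) = \<bar>of_rat q\<bar> * \<mu> x)}"

definition pseudonorm_c00 :: "(c00 \<Rightarrow> real) \<Rightarrow> bool" where
  "pseudonorm_c00 \<nu> \<longleftrightarrow> (\<forall>x y. \<nu> (x + y) \<le> \<nu> x + \<nu> y) \<and>
    (\<forall>r x. \<nu> (Poly_Mapping.map ((*) r) x) = \<bar>r\<bar> * \<nu> x)"

definition ext :: "(V \<Rightarrow> real) \<Rightarrow> c00 \<Rightarrow> real" where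
  "ext \<mu> = (THE \<nu>. pseudonorm_c00 \<nu> \<and> (\<forall>v. \<nu> (Poly_Mapping.map of_rat v) = \<mu> v))"

definition c00_space :: "(c00 \<Rightarrow> real) \<Rightarrow> c00 nspace" where
  "c00_space \<nu> =
    \<lparr>points = UNIV, nadd = (+), nscale = (\<lambda>r. Poly_Mapping.map ((*) r)), nnorm = \<nu>\<rparr>"

definition X_space :: "(V \<Rightarrow> real) \<Rightarrow> (nat \<Rightarrow> c00 set) set nspace" where
  "X_space \<mu> = completion (kernel_quotient (c00_space (ext \<mu>)))"

definition P_infty :: "(V \<Rightarrow> real) set" where
  "P_infty = {\<mu> \<in> pseudonorms. infinite_dimensional (X_space \<mu>)}"

definition B_norms :: "(V \<Rightarrow> real) set" where
  "B_norms = {\<mu> \<in> P_infty. \<forall>x. ext \<mu> x = 0 \<longrightarrow> x = 0}"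

end

theory Submission
  imports Defs "HOL-Library.Ramsey"
begin

text \<open>
  Being isometric to the Hilbert space is a closed condition on \<open>\<mu>\<close>, since \<open>\<mu>\<^sup>2\<close> has to be a
  quadratic form; being \<open>K\<close>-isomorphic to it means that \<open>\<mu>\<close> is \<open>K\<close>-equivalent to such a \<open>\<nu>\<close>, which
  is closed by compactness, and \<open>K\<close> ranges over the natural numbers.

  Conversely, Dvoretzky's theorem puts the Hilbert space in the closure of every isometry class.
  If the isomorphism class of \<open>X\<close> is a countable union of closed sets, Baire's theorem in the space of
  sequences in \<open>X\<close> yields vectors \<open>x\<^sub>0, \<dots>, x\<^bsub>k-1\<^esub>\<close> and one of these closed sets that contains the
  pseudonorms of all sequences starting with them. Continuing them with almost Euclidean systems and
  passing to a limit produces a space isomorphic to \<open>X\<close> in which a copy of the Hilbert space has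
  finite codimension.

  Dvoretzky's theorem is obtained as follows. Ramsey's theorem and differences (Brunel and Sucheston)
  give long unconditional systems \<open>e\<^sub>j\<close>. For independent random points \<open>w\<^sub>j\<close> of a net of minimal
  cardinality on the sphere, the mean of \<open>norm (\<Sum>j. (a \<bullet> w\<^sub>j) e\<^sub>j)\<close> is almost independent of the unit
  vector \<open>a\<close>, and by the Efron--Stein inequality its variance is at most of the order of the mean,
  which suffices if \<open>norm (\<Sum>j. e\<^sub>j)\<close> is unbounded. If it is bounded, the systems are uniformly
  equivalent to unit bases of \<open>\<ell>\<^sub>\<infinity>\<close>, which contain Euclidean systems up to a constant,
  and the first case applies to those.
\<close>

section \<open>Averages over words\<close>

text \<open>The variance bound suffices by Chebyshev's inequality: mean and variance are both of
  order \<open>\<phi>\<close>, so the relative deviation is small once \<open>\<phi>\<close> exceeds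
  a threshold that depends on \<open>n\<close>, \<open>\<epsilon>\<close> and the unconditionality
  constant, but not on the length of the system. In the bounded case the Euclidean systems found up
  to a constant are themselves unconditional, and their sums of \<open>k\<close> vectors grow like
  the square root of \<open>k\<close>, which brings back the first case with a new constant.

  Category is applied to sequences in the Banach space rather than to pseudonorms because a basic
  open set of sequences restricts finitely many vectors and leaves the tail free. A pointwise limit
  of pseudonorms stays in a closed set, but it may acquire a kernel and so leave
  \<open>B_norms\<close>. Hence finitely many coordinates are discarded until the limit is a norm;
  it then lies in \<open>I\<close> and in the closed set, so in the isomorphism class, and it is
  Euclidean beyond the first \<open>k\<close> coordinates.\<close>

definition avg :: "'s set \<Rightarrow> ('s \<Rightarrow> 'b::real_vector) \<Rightarrow> 'b" where
  "avg N f = (\<Sum>s\<in>N. f s) /\<^sub>R real (card N)"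

text \<open>The expectation over words of \<open>L\<close> independent uniform letters. Peeling off
  the last letter replaces a product measure and turns the facts below into inductions on
  \<open>L\<close>; positions from \<open>L\<close> on hold \<open>undefined\<close>.\<close>

primrec word_avg :: "'s set \<Rightarrow> nat \<Rightarrow> ((nat \<Rightarrow> 's) \<Rightarrow> 'b::real_vector) \<Rightarrow> 'b" where
  "word_avg N 0 F = F (\<lambda>_. undefined)"
| "word_avg N (Suc L) F = avg N (\<lambda>s. word_avg N L (\<lambda>w. F (w(L := s))))"

context
  fixes N :: "'s set"
  assumes finN: "finite N" and neN: "N \<noteq> {}"
begin

lemma cardN: "real (card N) > 0"
  using finN neN by (simp add: card_gt_0_iff)

lemma avg_const: "avg N (\<lambda>_. c) = c"
  using cardN by (simp add: avg_def scaleR_conv_of_real sum_constant_scaleR)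

lemma avg_add: "avg N (\<lambda>s. f s + g s) = avg N f + avg N g"
  by (simp add: avg_def sum.distrib scaleR_add_right)

lemma avg_diff: "avg N (\<lambda>s. f s - g s) = avg N f - avg N g"
  by (simp add: avg_def sum_subtractf scaleR_diff_right)

lemma avg_scaleR: "avg N (\<lambda>s. c *\<^sub>R f s) = c *\<^sub>R avg N f"
  by (simp add: avg_def scaleR_sum_right mult.commute)

lemma avg_scaleR_left: "avg N (\<lambda>s. f s *\<^sub>R v) = avg N f *\<^sub>R v"
  by (simp add: avg_def flip: scaleR_sum_left)

lemma avg_sum: "avg N (\<lambda>s. \<Sum>i\<in>A. f i s) = (\<Sum>i\<in>A. avg N (f i))"
  unfolding avg_def by (subst sum.swap) (simp add: scaleR_sum_right)

lemma avg_mono: "(\<And>s. s \<in> N \<Longrightarrow> f s \<le> (g s :: real)) \<Longrightarrow> avg N f \<le> avg N g"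
  unfolding avg_def using cardN by (auto intro!: mult_left_mono sum_mono)

lemma avg_cong: "(\<And>s. s \<in> N \<Longrightarrow> f s = g s) \<Longrightarrow> avg N f = avg N g"
  unfolding avg_def by (simp cong: sum.cong)

lemma avg_bij: "bij_betw \<pi> N N \<Longrightarrow> avg N (\<lambda>s. f (\<pi> s)) = avg N f"
  unfolding avg_def by (simp add: sum.reindex_bij_betw)

lemma norm_avg_le: "norm (avg N f) \<le> avg N (\<lambda>s. norm (f s :: 'b::real_normed_vector))"
  unfolding avg_def using cardN by (simp add: norm_sum mult_left_mono)

lemma avg_swap: "avg N (\<lambda>s. avg N (\<lambda>t. f s t)) = avg N (\<lambda>t. avg N (\<lambda>s. f s t))"
proof -
  have "(\<Sum>s\<in>N. \<Sum>t\<in>N. f s t) = (\<Sum>t\<in>N. \<Sum>s\<in>N. f s t)" by (rule sum.swap)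
  then show ?thesis by (simp add: avg_def flip: scaleR_sum_right)
qed

lemma avg_exists: "\<exists>s\<in>N. f s \<le> (avg N f :: real)"
proof (rule ccontr)
  assume "\<not> ?thesis"
  then have "\<And>s. s \<in> N \<Longrightarrow> avg N f < f s" by force
  then have "(\<Sum>s\<in>N. avg N f) < (\<Sum>s\<in>N. f s)"
    using finN neN by (intro sum_strict_mono) auto
  moreover have "(\<Sum>s\<in>N. avg N f) = (\<Sum>s\<in>N. f s)"
    using cardN finN neN by (simp add: avg_def field_simps)
  ultimately show False by simp
qed

lemma word_avg_const: "word_avg N L (\<lambda>_. c) = c"
  by (induction L) (simp_all add: avg_const)

lemma word_avg_add: "word_avg N L (\<lambda>w. F w + G w) = word_avg N L F + word_avg N L G"
  by (induction L arbitrary: F G) (simp_all add: avg_add)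

lemma word_avg_diff: "word_avg N L (\<lambda>w. F w - G w) = word_avg N L F - word_avg N L G"
  by (induction L arbitrary: F G) (simp_all add: avg_diff)

lemma word_avg_scaleR: "word_avg N L (\<lambda>w. c *\<^sub>R F w) = c *\<^sub>R word_avg N L F"
  by (induction L arbitrary: F) (simp_all add: avg_scaleR)

lemma word_avg_scaleR_left: "word_avg N L (\<lambda>w. F w *\<^sub>R v) = word_avg N L F *\<^sub>R v"
  by (induction L arbitrary: F) (simp_all add: avg_scaleR_left)

lemma word_avg_sum: "word_avg N L (\<lambda>w. \<Sum>i\<in>A. F i w) = (\<Sum>i\<in>A. word_avg N L (F i))"
  by (induction L arbitrary: F) (simp_all add: avg_sum)

lemma word_avg_avg: "word_avg N L (\<lambda>w. avg N (\<lambda>s. G s w)) = avg N (\<lambda>s. word_avg N L (G s))"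
proof (induction L arbitrary: G)
  case (Suc L)
  show ?case by (simp add: Suc avg_swap[of "\<lambda>s t. word_avg N L (\<lambda>w. G t (w(L := s)))"])
qed simp

lemma word_avg_mono:
  assumes "\<And>w. (\<forall>j<L. w j \<in> N) \<Longrightarrow> F w \<le> (G w :: real)"
  shows "word_avg N L F \<le> word_avg N L G"
  using assms
proof (induction L arbitrary: F G)
  case (Suc L)
  show ?case
    unfolding word_avg.simps by (intro avg_mono Suc.IH Suc.prems) (auto simp: less_Suc_eq)
qed simp

lemma norm_EE_le: "norm (word_avg N L F) \<le> word_avg N L (\<lambda>w. norm (F w :: 'b::real_normed_vector))"
proof (induction L arbitrary: F)
  case (Suc L)
  have "norm (word_avg N (Suc L) F) \<le> avg N (\<lambda>s. norm (word_avg N L (\<lambda>w. F (w(L := s)))))"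
    by (simp add: norm_avg_le)
  also have "\<dots> \<le> word_avg N (Suc L) (\<lambda>w. norm (F w))"
    by (simp add: avg_mono Suc)
  finally show ?case .
qed simp

lemma word_avg_exists: "\<exists>w. (\<forall>j<L. w j \<in> N) \<and> F w \<le> (word_avg N L F :: real)"
proof (induction L arbitrary: F)
  case (Suc L)
  obtain s where s: "s \<in> N" "word_avg N L (\<lambda>w. F (w(L := s))) \<le> word_avg N (Suc L) F"
    using avg_exists[of "\<lambda>s. word_avg N L (\<lambda>w. F (w(L := s)))"] by auto
  obtain w where w: "\<forall>j<L. w j \<in> N" "F (w(L := s)) \<le> word_avg N L (\<lambda>w. F (w(L := s)))"
    using Suc[of "\<lambda>w. F (w(L := s))"] by auto
  have "F (w(L := s)) \<le> word_avg N (Suc L) F" using s(2) w(2) by linarith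
  moreover have "\<forall>j<Suc L. (w(L := s)) j \<in> N" using s w by (simp add: less_Suc_eq)
  ultimately show ?case by blast
qed auto

lemma word_avg_marginal: "j < L \<Longrightarrow> word_avg N L (\<lambda>w. g (w j)) = avg N g"
proof (induction L)
  case (Suc L)
  show ?case
  proof (cases "j = L")
    case False
    with Suc show ?thesis by (simp add: avg_const)
  qed (simp add: word_avg_const)
qed simp

text \<open>The second assumption confines \<open>F\<close> to the first \<open>L\<close> letters:
  \<open>\<pi>\<close> also acts on the \<open>undefined\<close> letters beyond them, and
  \<open>F\<close> must not notice that.\<close>

lemma word_avg_bij:
  assumes "bij_betw \<pi> N N" and "\<And>v w. (\<forall>j<L. v j = w j) \<Longrightarrow> F v = F w"
  shows "word_avg N L (\<lambda>w. F (\<lambda>j. \<pi> (w j))) = word_avg N L F"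
  using assms(2)
proof (induction L arbitrary: F)
  case 0
  show ?case unfolding word_avg.simps by (rule 0) simp
next
  case (Suc L)
  have "word_avg N L (\<lambda>w. F (\<lambda>j. \<pi> ((w(L := s)) j))) = word_avg N L (\<lambda>w. F (w(L := \<pi> s)))" for s
  proof -
    have "(\<lambda>j. \<pi> ((w(L := s)) j)) = (\<lambda>j. \<pi> (w j))(L := \<pi> s)" for w by auto
    moreover have "word_avg N L (\<lambda>w. F ((\<lambda>j. \<pi> (w j))(L := \<pi> s))) = word_avg N L (\<lambda>w. F (w(L := \<pi> s)))"
      by (rule Suc.IH) (rule Suc.prems, auto simp: less_Suc_eq)
    ultimately show ?thesis by (simp only:)
  qed
  then show ?case
    unfolding word_avg.simps by (simp only: avg_bij[OF assms(1), of "\<lambda>s. word_avg N L (\<lambda>w. F (w(L := s)))"])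
qed

text \<open>Expanding the nonnegative variance gives Jensen's inequality for the square.\<close>

lemma word_avg_square_le: "(word_avg N L F)\<^sup>2 \<le> word_avg N L (\<lambda>w. (F w :: real)\<^sup>2)"
proof -
  let ?c = "word_avg N L F"
  have "0 \<le> word_avg N L (\<lambda>w. (F w - ?c)\<^sup>2)"
    using word_avg_mono[of L "\<lambda>_. 0" "\<lambda>w. (F w - ?c)\<^sup>2"] by (simp add: word_avg_const)
  also have "(\<lambda>w. (F w - ?c)\<^sup>2) = (\<lambda>w. ((F w)\<^sup>2 - (2 * ?c) *\<^sub>R F w) + ?c\<^sup>2)"
    by (simp add: fun_eq_iff power2_eq_square algebra_simps)
  also have "word_avg N L \<dots> = word_avg N L (\<lambda>w. (F w)\<^sup>2) - ?c\<^sup>2"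
    unfolding word_avg_add word_avg_diff word_avg_scaleR word_avg_const by (simp add: power2_eq_square)
  finally show ?thesis by simp
qed

text \<open>The variance is half the mean of \<open>(m s - m t)\<^sup>2\<close> over independent
  pairs. The positive part keeps one of the two orders of each pair, which absorbs the factor
  1/2.\<close>

lemma variance_pairs:
  fixes m :: "'s \<Rightarrow> real"
  shows "avg N (\<lambda>s. (m s)\<^sup>2) - (avg N m)\<^sup>2 = avg N (\<lambda>s. avg N (\<lambda>t. (max 0 (m s - m t))\<^sup>2))"
proof -
  let ?p = "\<lambda>x::real. (max 0 x)\<^sup>2"
  have "2 * avg N (\<lambda>s. avg N (\<lambda>t. ?p (m s - m t)))
      = avg N (\<lambda>s. avg N (\<lambda>t. ?p (m s - m t))) + avg N (\<lambda>s. avg N (\<lambda>t. ?p (m t - m s)))"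
    using avg_swap[of "\<lambda>s t. ?p (m s - m t)"] by simp
  also have "\<dots> = avg N (\<lambda>s. avg N (\<lambda>t. ?p (m s - m t) + ?p (m t - m s)))"
    by (simp add: avg_add)
  also have "\<dots> = avg N (\<lambda>s. avg N (\<lambda>t. ((m s)\<^sup>2 - (2 * m s) *\<^sub>R m t) + (m t)\<^sup>2))"
    by (intro avg_cong) (auto simp: max_def power2_eq_square algebra_simps)
  also have "\<dots> = avg N (\<lambda>s. ((m s)\<^sup>2 - (2 * avg N m) *\<^sub>R m s) + avg N (\<lambda>t. (m t)\<^sup>2))"
  proof (rule avg_cong)
    show "avg N (\<lambda>t. ((m s)\<^sup>2 - (2 * m s) *\<^sub>R m t) + (m t)\<^sup>2)
        = ((m s)\<^sup>2 - (2 * avg N m) *\<^sub>R m s) + avg N (\<lambda>t. (m t)\<^sup>2)" for s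
      unfolding avg_add avg_diff avg_scaleR avg_const by (simp add: mult_ac)
  qed
  also have "\<dots> = 2 * (avg N (\<lambda>s. (m s)\<^sup>2) - (avg N m)\<^sup>2)"
    unfolding avg_add avg_diff avg_scaleR avg_const by (simp add: power2_eq_square)
  finally show ?thesis by simp
qed

text \<open>Conditioning on the last letter splits the variance into the mean of the conditional
  variances, bounded by induction, and the variance of the conditional means \<open>m s\<close>,
  bounded by \<open>variance_pairs\<close> and Jensen. The one-sided form is what
  \<open>sum_norm_decrease_le\<close> can control.\<close>

lemma Efron_Stein:
  fixes F :: "(nat \<Rightarrow> 's) \<Rightarrow> real"
  shows "word_avg N L (\<lambda>w. (F w)\<^sup>2) - (word_avg N L F)\<^sup>2
    \<le> (\<Sum>j<L. word_avg N L (\<lambda>w. avg N (\<lambda>t. (max 0 (F w - F (w(j := t))))\<^sup>2)))"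
proof (induction L arbitrary: F)
  case (Suc L)
  define G where "G s w = F (w(L := s))" for s w
  define m where "m s = word_avg N L (G s)" for s
  have conv: "(max 0 (m s - m t))\<^sup>2 \<le> word_avg N L (\<lambda>w. (max 0 (G s w - G t w))\<^sup>2)" for s t
  proof -
    have "m s - m t = word_avg N L (\<lambda>w. G s w - G t w)" by (simp add: m_def word_avg_diff)
    also have "\<dots> \<le> word_avg N L (\<lambda>w. max 0 (G s w - G t w))" by (rule word_avg_mono) auto
    finally have "max 0 (m s - m t) \<le> word_avg N L (\<lambda>w. max 0 (G s w - G t w))"
      using word_avg_mono[of L "\<lambda>_. 0" "\<lambda>w. max 0 (G s w - G t w)"] by (simp add: word_avg_const)
    then have "(max 0 (m s - m t))\<^sup>2 \<le> (word_avg N L (\<lambda>w. max 0 (G s w - G t w)))\<^sup>2"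
      by (intro power_mono) auto
    also have "\<dots> \<le> word_avg N L (\<lambda>w. (max 0 (G s w - G t w))\<^sup>2)" by (rule word_avg_square_le)
    finally show ?thesis .
  qed
  have "word_avg N (Suc L) (\<lambda>w. (F w)\<^sup>2) = avg N (\<lambda>s. word_avg N L (\<lambda>w. (G s w)\<^sup>2))"
    by (simp add: G_def)
  also have "\<dots> \<le> avg N (\<lambda>s. (m s)\<^sup>2
      + (\<Sum>j<L. word_avg N L (\<lambda>w. avg N (\<lambda>t. (max 0 (G s w - G s (w(j := t))))\<^sup>2))))"
  proof (rule avg_mono)
    show "word_avg N L (\<lambda>w. (G s w)\<^sup>2) \<le> (m s)\<^sup>2
      + (\<Sum>j<L. word_avg N L (\<lambda>w. avg N (\<lambda>t. (max 0 (G s w - G s (w(j := t))))\<^sup>2)))" for s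
      using Suc[of "G s"] unfolding m_def by linarith
  qed
  also have "\<dots> = avg N (\<lambda>s. (m s)\<^sup>2)
      + (\<Sum>j<L. word_avg N (Suc L) (\<lambda>w. avg N (\<lambda>t. (max 0 (F w - F (w(j := t))))\<^sup>2)))"
  proof -
    have "G s (w(j := t)) = F (w(L := s, j := t))" if "j < L" for s w j t
      using that by (simp add: G_def fun_upd_twist)
    then show ?thesis
      by (simp add: avg_add avg_sum) (simp add: G_def)
  qed
  also have "avg N (\<lambda>s. (m s)\<^sup>2) \<le> (avg N m)\<^sup>2
      + avg N (\<lambda>s. avg N (\<lambda>t. word_avg N L (\<lambda>w. (max 0 (G s w - G t w))\<^sup>2)))"
    using variance_pairs[of m]
      avg_mono[of "\<lambda>s. avg N (\<lambda>t. (max 0 (m s - m t))\<^sup>2)"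
        "\<lambda>s. avg N (\<lambda>t. word_avg N L (\<lambda>w. (max 0 (G s w - G t w))\<^sup>2))", OF avg_mono[OF conv]]
    by simp
  also have "avg N (\<lambda>s. avg N (\<lambda>t. word_avg N L (\<lambda>w. (max 0 (G s w - G t w))\<^sup>2)))
      = word_avg N (Suc L) (\<lambda>w. avg N (\<lambda>t. (max 0 (F w - F (w(L := t))))\<^sup>2))"
    by (simp add: word_avg_avg G_def)
  finally have "word_avg N (Suc L) (\<lambda>w. (F w)\<^sup>2) - (avg N m)\<^sup>2
    \<le> (\<Sum>j<Suc L. word_avg N (Suc L) (\<lambda>w. avg N (\<lambda>t. (max 0 (F w - F (w(j := t))))\<^sup>2)))"
    unfolding sum.lessThan_Suc by linarith
  moreover have "avg N m = word_avg N (Suc L) F" by (simp add: m_def[abs_def] G_def[abs_def])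
  ultimately show ?case by (simp only:)
qed simp

end

section \<open>Nets on finite-dimensional Euclidean spheres\<close>

lemma l2_nth_simps [simp]:
  "l2_nth 0 n = 0" "l2_nth (x + y) n = l2_nth x n + l2_nth y n" "l2_nth (r *\<^sub>R x) n = r * l2_nth x n"
  "l2_nth (x - y) n = l2_nth x n - l2_nth y n"
  by (transfer; simp)+

lemma l2_nth_sum [simp]: "l2_nth (\<Sum>i\<in>A. f i) n = (\<Sum>i\<in>A. l2_nth (f i) n)"
  by (induction A rule: infinite_finite_induct) auto

definition unit_l2 :: "nat \<Rightarrow> l2" where "unit_l2 i = Abs_l2 (\<lambda>n. if n = i then 1 else 0)"

lemma nth_unit_l2 [simp]: "l2_nth (unit_l2 i) n = (if n = i then 1 else 0)"
proof -
  have "summable (\<lambda>n. (if n = i then 1 else 0 :: real)\<^sup>2)"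
    by (rule summable_finite[of "{i}"]) auto
  then show ?thesis by (simp add: unit_l2_def Abs_l2_inverse)
qed

lemma inner_unit_l2 [simp]: "inner x (unit_l2 i) = l2_nth x i"
proof -
  have "inner x (unit_l2 i) = suminf (\<lambda>n. l2_nth x n * l2_nth (unit_l2 i) n)"
    by (simp add: inner_l2.rep_eq)
  also have "\<dots> = (\<Sum>n\<in>{i}. l2_nth x n * l2_nth (unit_l2 i) n)"
    by (rule suminf_finite) auto
  finally show ?thesis by simp
qed

lemma l2_eqI: "(\<And>n. l2_nth x n = l2_nth y n) \<Longrightarrow> x = y"
  by (metis l2_nth_inject ext)

text \<open>Euclidean spaces and their spheres are realised inside \<open>l2\<close> because their
  dimension is a term and not a type.\<close>

definition Efin :: "nat \<Rightarrow> l2 set" where "Efin n = {x. \<forall>k\<ge>n. l2_nth x k = 0}"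

definition Sph :: "nat \<Rightarrow> l2 set" where "Sph n = {x \<in> Efin n. norm x = 1}"

lemma Efin_expand:
  assumes "x \<in> Efin n" shows "x = (\<Sum>i<n. l2_nth x i *\<^sub>R unit_l2 i)"
proof (rule l2_eqI)
  fix k
  have "(\<Sum>i<n. l2_nth x i * (if k = i then 1 else 0)) = (\<Sum>i<n. if i = k then l2_nth x k else 0)"
    by (rule sum.cong) auto
  then show "l2_nth x k = l2_nth (\<Sum>i<n. l2_nth x i *\<^sub>R unit_l2 i) k"
    using assms by (auto simp: Efin_def)
qed

lemma inner_unit_combination:
  "inner x (\<Sum>i<n. a i *\<^sub>R unit_l2 i) = (\<Sum>i<n. a i * l2_nth x i)"
  by (simp add: inner_sum_right)

lemma norm_unit_l2 [simp]: "norm (unit_l2 i) = 1"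
  by (simp add: norm_eq_sqrt_inner)

lemma unit_combination_Efin: "(\<Sum>i<n. a i *\<^sub>R unit_l2 i) \<in> Efin n"
  by (auto simp: Efin_def intro!: sum.neutral)

lemma nth_unit_combination: "k < n \<Longrightarrow> l2_nth (\<Sum>i<n. a i *\<^sub>R unit_l2 i) k = a k"
proof -
  assume "k < n"
  have "(\<Sum>i<n. a i * (if k = i then 1 else 0)) = (\<Sum>i<n. if i = k then a k else 0)"
    by (rule sum.cong) auto
  then show ?thesis using \<open>k < n\<close> by simp
qed

lemma norm_unit_combination: "norm (\<Sum>i<n. a i *\<^sub>R unit_l2 i) = sqrt (\<Sum>i<n. (a i)\<^sup>2)"
proof -
  have "inner (\<Sum>i<n. a i *\<^sub>R unit_l2 i) (\<Sum>i<n. a i *\<^sub>R unit_l2 i) = (\<Sum>i<n. (a i)\<^sup>2)"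
    unfolding inner_unit_combination
    by (rule sum.cong) (auto simp: nth_unit_combination power2_eq_square simp del: l2_nth_sum)
  then show ?thesis by (simp only: norm_eq_sqrt_inner)
qed

lemma Efin_norm: "x \<in> Efin n \<Longrightarrow> (norm x)\<^sup>2 = (\<Sum>i<n. (l2_nth x i)\<^sup>2)"
  using arg_cong[OF Efin_expand[of x n], of norm] unfolding norm_unit_combination by (simp add: sum_nonneg)

lemma Efin_subspace: "subspace (Efin n)"
  by (auto simp: subspace_def Efin_def)

text \<open>One representative is taken from each nonempty cell of the grid of mesh
  \<open>h\<close>, so that the net lies in \<open>S\<close> itself; boundedness leaves finitely
  many cells.\<close>

lemma cube_net:
  fixes S :: "(nat \<Rightarrow> real) set"
  assumes "h > 0" and S: "\<forall>a\<in>S. \<forall>i<r. \<bar>a i\<bar> \<le> B"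
  shows "\<exists>G. finite G \<and> G \<subseteq> S \<and> (\<forall>a\<in>S. \<exists>g\<in>G. \<forall>i<r. \<bar>a i - g i\<bar> \<le> h)"
proof -
  define k where "k a = (\<lambda>i\<in>{..<r}. \<lfloor>a i / h\<rfloor>)" for a :: "nat \<Rightarrow> real"
  have "k ` S \<subseteq> PiE {..<r} (\<lambda>_. {\<lfloor>- B / h\<rfloor>..\<lfloor>B / h\<rfloor>})"
  proof (clarsimp simp: k_def)
    fix a i assume "a \<in> S" "i < r"
    with S have "\<bar>a i\<bar> \<le> B" by blast
    then have "- B \<le> a i" "a i \<le> B" by linarith+
    then have "- B / h \<le> a i / h" "a i / h \<le> B / h"
      using \<open>h > 0\<close> by (simp_all only: divide_right_mono less_imp_le)
    then show "\<lfloor>- (B / h)\<rfloor> \<le> \<lfloor>a i / h\<rfloor> \<and> \<lfloor>a i / h\<rfloor> \<le> \<lfloor>B / h\<rfloor>"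
      by (simp add: floor_mono)
  qed
  then have fin: "finite (k ` S)"
    by (rule finite_subset) (intro finite_PiE, auto)
  define G where "G = (\<lambda>c. SOME a. a \<in> S \<and> k a = c) ` (k ` S)"
  have sel: "(SOME b. b \<in> S \<and> k b = k a) \<in> S \<and> k (SOME b. b \<in> S \<and> k b = k a) = k a" if "a \<in> S" for a
    by (rule someI[of _ a]) (use that in auto)
  show ?thesis
  proof (intro exI conjI ballI)
    show "finite G" using fin by (simp add: G_def)
    show "G \<subseteq> S" using sel by (auto simp: G_def)
    fix a assume a: "a \<in> S"
    let ?g = "SOME b. b \<in> S \<and> k b = k a"
    have "?g \<in> G" using a by (auto simp: G_def)
    moreover have "\<forall>i<r. \<bar>a i - ?g i\<bar> \<le> h"
    proof (intro allI impI)
      fix i assume "i < r"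
      have "k ?g i = k a i" using sel[OF a] by simp
      then have "\<lfloor>?g i / h\<rfloor> = \<lfloor>a i / h\<rfloor>" using \<open>i < r\<close> by (simp add: k_def)
      then have "\<bar>a i / h - ?g i / h\<bar> \<le> 1"
        using floor_correct[of "?g i / h"] floor_correct[of "a i / h"] by linarith
      then show "\<bar>a i - ?g i\<bar> \<le> h"
        using \<open>h > 0\<close> by (simp add: field_simps abs_if split: if_splits)
    qed
    ultimately show "\<exists>g\<in>G. \<forall>i<r. \<bar>a i - g i\<bar> \<le> h" by blast
  qed
qed

lemma sphere_net:
  assumes "\<delta> > 0"
  obtains N where "finite N" "N \<subseteq> Sph n" "\<And>x. x \<in> Sph n \<Longrightarrow> \<exists>s\<in>N. norm (x - s) \<le> \<delta>"
proof -
  \<comment> \<open>With this mesh the \<open>n\<close> coordinate errors add up to at most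
    \<open>\<delta>\<close>; the summand 1 covers \<open>n = 0\<close>.\<close>
  have h1: "\<delta> / (real n + 1) > 0" using assms by simp
  have h2: "\<forall>a\<in>l2_nth ` Sph n. \<forall>i<n. \<bar>a i\<bar> \<le> 1"
  proof (intro ballI allI impI)
    fix a i assume "a \<in> l2_nth ` Sph n"
    obtain x where "a = l2_nth x" "norm x = 1" using \<open>a \<in> l2_nth ` Sph n\<close> by (auto simp: Sph_def)
    then show "\<bar>a i\<bar> \<le> 1" using l2_nth_le_norm[of x i] by simp
  qed
  obtain G where G: "finite G" "G \<subseteq> l2_nth ` Sph n"
    "\<forall>a\<in>l2_nth ` Sph n. \<exists>g\<in>G. \<forall>i<n. \<bar>a i - g i\<bar> \<le> \<delta> / (real n + 1)"
    using cube_net[OF h1 h2] by (elim exE conjE)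
  from finite_subset_image[OF G(1,2)] obtain N where N: "N \<subseteq> Sph n" "finite N" "G = l2_nth ` N"
    by blast
  show thesis
  proof
    fix x assume x: "x \<in> Sph n"
    then obtain s where s: "s \<in> N" "\<forall>i<n. \<bar>l2_nth x i - l2_nth s i\<bar> \<le> \<delta> / (real n + 1)"
      using bspec[OF G(3) imageI[OF x]] N(3) by blast
    have "x - s \<in> Efin n" using x s N by (auto simp: Sph_def intro!: subspace_diff Efin_subspace)
    then have "norm (x - s) = norm (\<Sum>i<n. l2_nth (x - s) i *\<^sub>R unit_l2 i)"
      by (rule arg_cong[OF Efin_expand])
    also have "\<dots> \<le> (\<Sum>i<n. \<delta> / (real n + 1))"
      by (rule sum_norm_le) (use s in simp)
    also have "\<dots> \<le> \<delta>" using assms by (simp add: field_simps)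
    finally show "\<exists>s\<in>N. norm (x - s) \<le> \<delta>" using s by blast
  qed (use N in auto)
qed

text \<open>\<open>R\<close> is the reflection in the hyperplane orthogonal to \<open>x - y\<close>.
  For \<open>x = y\<close> division by zero makes it the identity.\<close>

lemma reflection:
  assumes "x \<in> Sph n" "y \<in> Sph n"
  obtains R where "\<And>u v. inner (R u) (R v) = inner u v" "\<And>u v. R (u - v) = R u - R v"
    "\<And>u. R (R u) = u" "R ` Sph n \<subseteq> Sph n" "R x = y"
proof -
  define v where "v = x - y"
  define R where "R u = u - (2 * inner u v / inner v v) *\<^sub>R v" for u
  have n1: "inner x x = 1" "inner y y = 1" using assms by (auto simp: Sph_def norm_eq_1)
  have inner: "inner (R u) (R w) = inner u w" for u w
  proof (cases "inner v v = 0")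
    case False
    then show ?thesis
      by (simp add: R_def inner_diff_left inner_diff_right field_simps inner_commute)
  qed (simp add: R_def)
  show thesis
  proof
    show "inner (R u) (R w) = inner u w" for u w by (rule inner)
    show "R (u - w) = R u - R w" for u w
      by (simp add: R_def inner_diff_left algebra_simps diff_divide_distrib)
    show "R (R u) = u" for u
    proof (cases "inner v v = 0")
      case False
      then have "2 * inner (R u) v / inner v v = - (2 * inner u v / inner v v)"
        by (simp add: R_def inner_diff_left field_simps)
      then show ?thesis by (simp only: R_def[of "R u"]) (simp add: R_def)
    qed (simp add: R_def)
    show "R ` Sph n \<subseteq> Sph n"
    proof clarify
      fix u assume u: "u \<in> Sph n"
      have "v \<in> Efin n" using assms by (auto simp: Sph_def v_def intro!: subspace_diff Efin_subspace)
      with u have "R u \<in> Efin n"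
        by (auto simp: Sph_def R_def intro!: subspace_diff subspace_scale Efin_subspace)
      moreover have "norm (R u) = 1" using u inner[of u u] by (simp add: Sph_def norm_eq_sqrt_inner)
      ultimately show "R u \<in> Sph n" by (simp add: Sph_def)
    qed
    show "R x = y"
    proof (cases "x = y")
      case False
      have "inner v v = 2 * inner x v"
        using n1 by (simp add: v_def inner_diff_left inner_diff_right inner_commute)
      moreover have "inner v v \<noteq> 0" using False by (simp add: v_def)
      ultimately show ?thesis by (simp add: R_def) (simp add: v_def)
    qed (simp add: R_def v_def)
  qed
qed

definition is_net :: "nat \<Rightarrow> real \<Rightarrow> l2 set \<Rightarrow> bool" where
  "is_net n \<delta> N \<longleftrightarrow> finite N \<and> N \<subseteq> Sph n \<and> (\<forall>x\<in>Sph n. \<exists>s\<in>N. norm (x - s) \<le> \<delta>)"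

text \<open>A net of minimal cardinality plays the role of the rotation-invariant measure: replacing the
  points below the threshold by the reflected points of the other side gives another net.\<close>
lemma minimal_net_count:
  assumes N: "is_net n \<delta> N" and min: "\<And>N'. is_net n \<delta> N' \<Longrightarrow> card N \<le> card N'"
    and a: "a \<in> Sph n" and b: "b \<in> Sph n"
  shows "card {x \<in> N. inner a x \<le> t} \<le> card {x \<in> N. inner b x \<le> t + 2 * \<delta>}"
proof -
  obtain R where R: "\<And>u v. inner (R u) (R v) = inner u v" "\<And>u v. R (u - v) = R u - R v"
    "\<And>u. R (R u) = u" "R ` Sph n \<subseteq> Sph n" "R b = a"
    using reflection[OF b a] by metis
  have normR: "norm (R u) = norm u" for u by (simp add: norm_eq_sqrt_inner R)
  define A where "A = {x \<in> N. inner a x \<le> t}"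
  define B where "B = {x \<in> N. inner b x \<le> t + 2 * \<delta>}"
  have fin: "finite N" and sub: "N \<subseteq> Sph n" and cov: "\<And>x. x \<in> Sph n \<Longrightarrow> \<exists>s\<in>N. norm (x - s) \<le> \<delta>"
    using N by (auto simp: is_net_def)
  have "is_net n \<delta> ((N - A) \<union> R ` B)"
    unfolding is_net_def
  proof (intro conjI ballI)
    show "finite (N - A \<union> R ` B)" using fin by (simp add: B_def)
    show "N - A \<union> R ` B \<subseteq> Sph n" using sub R(4) by (auto simp: B_def)
    fix p assume p: "p \<in> Sph n"
    obtain s where s: "s \<in> N" "norm (p - s) \<le> \<delta>" using cov[OF p] by blast
    show "\<exists>s\<in>N - A \<union> R ` B. norm (p - s) \<le> \<delta>"
    proof (cases "s \<in> A")
      \<comment> \<open>If the point \<open>s\<close> near \<open>p\<close> was removed, the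
        reflected \<open>p\<close> is covered by some \<open>s'\<close>. Then \<open>R s'\<close> is
        within \<open>2 * \<delta>\<close> of \<open>s\<close>, so the height of \<open>s'\<close>
        over \<open>b\<close> is at most \<open>t + 2 * \<delta>\<close> and \<open>s'\<close>
        belongs to \<open>B\<close>.\<close>
      case True
      have "R p \<in> Sph n" using R(4) p by auto
      then obtain s' where s': "s' \<in> N" "norm (R p - s') \<le> \<delta>" using cov by blast
      have p': "norm (p - R s') \<le> \<delta>"
        using s'(2) normR[of "R p - s'"] by (simp add: R)
      have "inner b s' = inner a (R s')" using R(1)[of b s'] R(5) by simp
      also have "\<dots> = inner a s + inner a (R s' - s)" by (simp add: inner_diff_right)
      also have "inner a (R s' - s) \<le> norm a * norm (R s' - s)" by (rule norm_cauchy_schwarz)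
      also have "\<dots> \<le> 2 * \<delta>"
        using norm_triangle_ineq[of "R s' - p" "p - s"] p' s(2) a by (simp add: Sph_def norm_minus_commute)
      finally have "s' \<in> B" using True s' by (simp add: A_def B_def)
      with p' show ?thesis by blast
    qed (use s in auto)
  qed
  then have "card N \<le> card ((N - A) \<union> R ` B)" by (rule min)
  also have "\<dots> \<le> card (N - A) + card (R ` B)" by (rule card_Un_le)
  also have "card (R ` B) \<le> card B" using fin by (intro card_image_le) (simp add: B_def)
  also have "card (N - A) = card N - card A" using fin by (intro card_Diff_subset) (auto simp: A_def)
  finally have "card N \<le> card N - card A + card B" by simp
  moreover have "card A \<le> card N" using fin by (intro card_mono) (auto simp: A_def)
  ultimately show ?thesis by (simp add: A_def B_def)
qed

text \<open>Comparing distribution functions compares order statistics: if the \<open>i\<close>-th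
  value of \<open>g\<close> were too large, at most \<open>i\<close> points would lie below the
  shifted threshold, whereas \<open>f\<close> guarantees \<open>i + 1\<close>.\<close>

lemma sorted_values_close:
  fixes f g :: "'x \<Rightarrow> real"
  assumes cnt: "\<And>t. card {x \<in> N. f x \<le> t} \<le> card {x \<in> N. g x \<le> t + c}"
    and xs: "set xs = N" "distinct xs" "sorted (map f xs)"
    and ys: "set ys = N" "distinct ys" "sorted (map g ys)"
    and i: "i < length xs"
  shows "g (ys ! i) \<le> f (xs ! i) + c"
proof (rule ccontr)
  assume less: "\<not> ?thesis"
  have len: "length ys = length xs" using xs ys by (metis distinct_card)
  have "(\<lambda>j. xs ! j) ` {..i} \<subseteq> {x \<in> N. f x \<le> f (xs ! i)}"
    using xs i sorted_nth_mono[OF xs(3)] by fastforce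
  moreover have "inj_on (\<lambda>j. xs ! j) {..i}"
    using xs(2) i by (auto simp: inj_on_def nth_eq_iff_index_eq)
  moreover have "finite N" using xs by auto
  ultimately have "Suc i \<le> card {x \<in> N. f x \<le> f (xs ! i)}"
    using card_inj_on_le[of "\<lambda>j. xs ! j" "{..i}" "{x \<in> N. f x \<le> f (xs ! i)}"] by simp
  also have "\<dots> \<le> card {x \<in> N. g x \<le> f (xs ! i) + c}" by (rule cnt)
  also have "{x \<in> N. g x \<le> f (xs ! i) + c} \<subseteq> (\<lambda>j. ys ! j) ` {..<i}"
  proof clarify
    fix x assume x: "x \<in> N" "g x \<le> f (xs ! i) + c"
    then obtain j where j: "j < length ys" "x = ys ! j" using ys by (auto simp: in_set_conv_nth)
    have "j < i"
    proof (rule ccontr)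
      assume "\<not> j < i"
      then have "g (ys ! i) \<le> g (ys ! j)"
        using sorted_nth_mono[OF ys(3), of i j] j len by simp
      with x j less show False by simp
    qed
    with j show "x \<in> (\<lambda>j. ys ! j) ` {..<i}" by auto
  qed
  then have "card {x \<in> N. g x \<le> f (xs ! i) + c} \<le> i"
    using surj_card_le[of "{..<i}"] by simp
  finally show False by simp
qed

text \<open>\<open>\<pi>\<close> is the monotone rearrangement: it matches the \<open>i\<close>-th
  smallest value of \<open>f\<close> with the \<open>i\<close>-th smallest value of
  \<open>g\<close>.\<close>

lemma matching_of_counts:
  fixes f g :: "'x \<Rightarrow> real"
  assumes fin: "finite N"
    and fg: "\<And>t. card {x \<in> N. f x \<le> t} \<le> card {x \<in> N. g x \<le> t + c}"
    and gf: "\<And>t. card {x \<in> N. g x \<le> t} \<le> card {x \<in> N. f x \<le> t + c}"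
  obtains \<pi> where "bij_betw \<pi> N N" "\<And>x. x \<in> N \<Longrightarrow> \<bar>f x - g (\<pi> x)\<bar> \<le> c"
proof -
  obtain zs where zs: "set zs = N" "distinct zs" using finite_distinct_list[OF fin] by blast
  define xs where "xs = sort_key f zs"
  define ys where "ys = sort_key g zs"
  have xs: "set xs = N" "distinct xs" "sorted (map f xs)"
    and ys: "set ys = N" "distinct ys" "sorted (map g ys)"
    using zs by (auto simp: xs_def ys_def)
  have len: "length ys = length xs" by (simp add: xs_def ys_def)
  have bx: "bij_betw (\<lambda>i. xs ! i) {..<length xs} N" and b_y: "bij_betw (\<lambda>i. ys ! i) {..<length xs} N"
    using bij_betw_nth[OF xs(2)] bij_betw_nth[OF ys(2)] xs ys len by auto
  define \<pi> where "\<pi> = (\<lambda>i. ys ! i) \<circ> inv_into {..<length xs} (\<lambda>i. xs ! i)"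
  show thesis
  proof
    show "bij_betw \<pi> N N"
      unfolding \<pi>_def by (rule bij_betw_trans[OF bij_betw_inv_into[OF bx] b_y])
    fix x assume "x \<in> N"
    then obtain i where i: "i < length xs" "x = xs ! i" using xs by (auto simp: in_set_conv_nth)
    then have "\<pi> x = ys ! i"
      using bij_betw_inv_into_left[OF bx] by (simp add: \<pi>_def)
    then show "\<bar>f x - g (\<pi> x)\<bar> \<le> c"
      using sorted_values_close[OF fg xs ys i(1)] sorted_values_close[OF gf ys xs] i len by fastforce
  qed
qed

text \<open>The counting inequality in both directions makes the heights over any two poles almost
  equidistributed, and a permutation is the form in which averages over words can use this.\<close>

lemma invariant_net:
  assumes "\<delta> > 0" "n > 0"
  obtains N where "finite N" "N \<noteq> {}" "N \<subseteq> Sph n"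
    "\<And>a b. a \<in> Sph n \<Longrightarrow> b \<in> Sph n \<Longrightarrow>
      \<exists>\<pi>. bij_betw \<pi> N N \<and> (\<forall>x\<in>N. \<bar>inner a x - inner b (\<pi> x)\<bar> \<le> 2 * \<delta>)"
proof -
  obtain N0 where "finite N0" "N0 \<subseteq> Sph n" "\<And>x. x \<in> Sph n \<Longrightarrow> \<exists>s\<in>N0. norm (x - s) \<le> \<delta>"
    using sphere_net[OF assms(1)] by metis
  then have "is_net n \<delta> N0" by (auto simp: is_net_def)
  then obtain N where N: "is_net n \<delta> N" and min: "\<And>N'. is_net n \<delta> N' \<Longrightarrow> card N \<le> card N'"
    using ex_has_least_nat[of "is_net n \<delta>" N0 card] by auto
  show thesis
  proof
    show "finite N" "N \<subseteq> Sph n" using N by (auto simp: is_net_def)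
    have "unit_l2 0 \<in> Sph n" using assms by (auto simp: Sph_def Efin_def)
    then show "N \<noteq> {}" using N by (force simp: is_net_def)
    show "\<exists>\<pi>. bij_betw \<pi> N N \<and> (\<forall>x\<in>N. \<bar>inner a x - inner b (\<pi> x)\<bar> \<le> 2 * \<delta>)"
      if "a \<in> Sph n" "b \<in> Sph n" for a b
      by (rule matching_of_counts[OF \<open>finite N\<close> minimal_net_count[OF N min that]
            minimal_net_count[OF N min that(2,1)]]) blast+
  qed
qed

text \<open>On the unit sphere the absolute coordinates sum to at least the sum of their squares,
  which is 1, so some coordinate has mean at least \<open>1 / n\<close>; invariance carries this to
  the direction \<open>a\<close>. As the dimension is fixed, the crude order \<open>1 / n\<close> is
  enough.\<close>

lemma avg_abs_inner_lower:
  assumes N: "finite N" "N \<noteq> {}" "N \<subseteq> Sph n"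
    and inv: "\<And>a b. a \<in> Sph n \<Longrightarrow> b \<in> Sph n \<Longrightarrow>
      \<exists>\<pi>. bij_betw \<pi> N N \<and> (\<forall>x\<in>N. \<bar>inner a x - inner b (\<pi> x)\<bar> \<le> c)"
    and a: "a \<in> Sph n" and n: "n > 0"
  shows "1 / real n - c \<le> avg N (\<lambda>x. \<bar>inner a x\<bar>)"
proof -
  note av = N(1,2)
  have "1 = avg N (\<lambda>x. 1::real)" by (simp add: avg_const av)
  also have "\<dots> \<le> avg N (\<lambda>x. \<Sum>i<n. \<bar>l2_nth x i\<bar>)"
  proof (rule avg_mono[OF av])
    fix x assume "x \<in> N"
    then have x: "x \<in> Efin n" "norm x = 1" using N by (auto simp: Sph_def)
    then have "1 = (\<Sum>i<n. (l2_nth x i)\<^sup>2)" using Efin_norm[of x n] by simp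
    also have "\<dots> \<le> (\<Sum>i<n. \<bar>l2_nth x i\<bar>)"
    proof (rule sum_mono)
      fix i
      have "\<bar>l2_nth x i\<bar> \<le> 1" using l2_nth_le_norm[of x i] x by simp
      then have "\<bar>l2_nth x i\<bar> * \<bar>l2_nth x i\<bar> \<le> \<bar>l2_nth x i\<bar>" by (intro mult_left_le) auto
      then show "(l2_nth x i)\<^sup>2 \<le> \<bar>l2_nth x i\<bar>" by (simp add: power2_eq_square)
    qed
    finally show "1 \<le> (\<Sum>i<n. \<bar>l2_nth x i\<bar>)" .
  qed
  also have "\<dots> = (\<Sum>i<n. avg N (\<lambda>x. \<bar>l2_nth x i\<bar>))" by (rule avg_sum[OF av])
  finally have sum: "1 \<le> (\<Sum>i<n. avg N (\<lambda>x. \<bar>l2_nth x i\<bar>))" .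
  have "\<exists>i<n. 1 / real n \<le> avg N (\<lambda>x. \<bar>l2_nth x i\<bar>)"
  proof (rule ccontr)
    assume "\<not> ?thesis"
    then have "(\<Sum>i<n. avg N (\<lambda>x. \<bar>l2_nth x i\<bar>)) < (\<Sum>i<n. 1 / real n)"
      using n by (intro sum_strict_mono) (auto simp: not_le)
    with sum n show False by simp
  qed
  then obtain i where i: "i < n" "1 / real n \<le> avg N (\<lambda>x. \<bar>l2_nth x i\<bar>)" by blast
  have "unit_l2 i \<in> Sph n" using i by (auto simp: Sph_def Efin_def)
  with inv a obtain \<pi> where \<pi>: "bij_betw \<pi> N N" "\<forall>x\<in>N. \<bar>inner (unit_l2 i) x - inner a (\<pi> x)\<bar> \<le> c"
    by blast
  have "avg N (\<lambda>x. \<bar>l2_nth x i\<bar>) \<le> avg N (\<lambda>x. \<bar>inner a (\<pi> x)\<bar> + c)"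
  proof (rule avg_mono[OF av])
    fix x assume "x \<in> N"
    with \<pi>(2) have "\<bar>l2_nth x i - inner a (\<pi> x)\<bar> \<le> c"
      by (metis inner_commute inner_unit_l2)
    then show "\<bar>l2_nth x i\<bar> \<le> \<bar>inner a (\<pi> x)\<bar> + c" by linarith
  qed
  also have "\<dots> = avg N (\<lambda>x. \<bar>inner a x\<bar>) + c"
    using avg_bij[OF av \<pi>(1), of "\<lambda>x. \<bar>inner a x\<bar>"] by (simp add: avg_add[OF av] avg_const[OF av])
  finally show ?thesis using i by simp
qed

section \<open>Concentration of norms of random words\<close>

text \<open>Replaces a norming functional in the variance bound, so that no Hahn--Banach theorem is needed.\<close>
lemma sum_norm_decrease_le:
  fixes x :: "'a::real_normed_vector"
  assumes "finite J"
  shows "(\<Sum>j\<in>J. norm x - norm (x - v j)) \<le> norm (\<Sum>j\<in>J. v j)"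
proof -
  have "(\<Sum>j\<in>J. norm x) = norm ((\<Sum>j\<in>J. x - v j) + (\<Sum>j\<in>J. v j))"
    by (simp add: sum_subtractf sum_constant_scaleR)
  also have "\<dots> \<le> norm (\<Sum>j\<in>J. x - v j) + norm (\<Sum>j\<in>J. v j)" by (rule norm_triangle_ineq)
  also have "norm (\<Sum>j\<in>J. x - v j) \<le> (\<Sum>j\<in>J. norm (x - v j))" by (rule norm_sum)
  finally show ?thesis by (simp add: sum_subtractf)
qed

definition word_norm :: "nat \<Rightarrow> (nat \<Rightarrow> 'a::real_normed_vector) \<Rightarrow> l2 \<Rightarrow> (nat \<Rightarrow> l2) \<Rightarrow> real" where
  "word_norm L e a w = norm (\<Sum>j<L. inner a (w j) *\<^sub>R e j)"

context
  fixes L :: nat and e :: "nat \<Rightarrow> 'a::real_normed_vector" and \<phi> :: real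
  assumes e1: "\<And>j. j < L \<Longrightarrow> norm (e j) \<le> 1"
    and upper: "\<And>t. (\<forall>j<L. \<bar>t j\<bar> \<le> 1) \<Longrightarrow> norm (\<Sum>j<L. t j *\<^sub>R e j) \<le> \<phi>"
begin

lemma upper_scaled:
  assumes "c > 0" "\<forall>j<L. \<bar>t j\<bar> \<le> c"
  shows "norm (\<Sum>j<L. t j *\<^sub>R e j) \<le> c * \<phi>"
proof -
  have "norm (\<Sum>j<L. (t j / c) *\<^sub>R e j) \<le> \<phi>"
    using assms by (intro upper) simp
  moreover have "(\<Sum>j<L. t j *\<^sub>R e j) = c *\<^sub>R (\<Sum>j<L. (t j / c) *\<^sub>R e j)"
    using assms by (simp add: scaleR_sum_right)
  ultimately show ?thesis using assms by simp
qed

text \<open>Every single decrease is at most 2, so its square is at most twice the decrease. The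
  decreases themselves add up to at most the norm of one combination with coefficients bounded by 2,
  hence to at most \<open>2 * \<phi>\<close>.\<close>

lemma word_norm_decrease:
  assumes a: "norm a \<le> 1" and w: "\<forall>j<L. norm (w j) \<le> 1" and t: "norm t \<le> 1"
  shows "(\<Sum>j<L. (max 0 (word_norm L e a w - word_norm L e a (w(j := t))))\<^sup>2) \<le> 4 * \<phi>"
proof -
  define x where "x = (\<Sum>j<L. inner a (w j) *\<^sub>R e j)"
  define c where "c j = inner a (w j) - inner a t" for j
  \<comment> \<open>Only the indices with a strict decrease contribute; the others receive the
    coefficient 0, which the cube bound permits.\<close>
  define J where "J = {j. j < L \<and> norm (x - c j *\<^sub>R e j) < norm x}"
  have upd: "word_norm L e a (w(j := t)) = norm (x - c j *\<^sub>R e j)" if "j < L" for j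
  proof -
    have "(\<Sum>i<L. inner a ((w(j := t)) i) *\<^sub>R e i)
        = (\<Sum>i<L. inner a (w i) *\<^sub>R e i - (if i = j then c j *\<^sub>R e j else 0))"
      by (rule sum.cong) (auto simp: c_def algebra_simps)
    also have "\<dots> = x - c j *\<^sub>R e j" using that by (simp add: sum_subtractf x_def)
    finally show ?thesis by (simp only: word_norm_def)
  qed
  have ip: "\<bar>inner a u\<bar> \<le> 1" if "norm u \<le> 1" for u
    using Cauchy_Schwarz_ineq2[of a u] mult_mono[OF a that] by simp
  have c2: "\<bar>c j\<bar> \<le> 2" if "j < L" for j
    using ip[OF t] ip[of "w j"] w that unfolding c_def by fastforce
  have "(max 0 (word_norm L e a w - word_norm L e a (w(j := t))))\<^sup>2
      \<le> 2 * (if j \<in> J then norm x - norm (x - c j *\<^sub>R e j) else 0)" if "j < L" for j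
  proof (cases "j \<in> J")
    case True
    have "norm x - norm (x - c j *\<^sub>R e j) \<le> norm (c j *\<^sub>R e j)"
      using norm_triangle_ineq2[of x "x - c j *\<^sub>R e j"] by simp
    also have "\<dots> \<le> 2" using mult_mono[OF c2[OF that] e1[OF that]] by simp
    finally have d2: "norm x - norm (x - c j *\<^sub>R e j) \<le> 2" .
    have d0: "0 \<le> norm x - norm (x - c j *\<^sub>R e j)" using True by (simp add: J_def)
    have "(norm x - norm (x - c j *\<^sub>R e j))\<^sup>2 \<le> 2 * (norm x - norm (x - c j *\<^sub>R e j))"
      unfolding power2_eq_square by (rule mult_right_mono[OF d2 d0])
    then show ?thesis using True d0 that by (simp add: upd) (simp add: word_norm_def x_def)
  next
    case False
    then show ?thesis using that by (simp add: upd J_def) (simp add: word_norm_def x_def)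
  qed
  then have "(\<Sum>j<L. (max 0 (word_norm L e a w - word_norm L e a (w(j := t))))\<^sup>2)
      \<le> (\<Sum>j<L. 2 * (if j \<in> J then norm x - norm (x - c j *\<^sub>R e j) else 0))"
    by (intro sum_mono) simp
  also have "\<dots> = 2 * (\<Sum>j\<in>J. norm x - norm (x - c j *\<^sub>R e j))"
  proof -
    have "{..<L} \<inter> J = J" by (auto simp: J_def)
    then show ?thesis by (simp add: sum.If_cases flip: sum_distrib_left)
  qed
  also have "(\<Sum>j\<in>J. norm x - norm (x - c j *\<^sub>R e j)) \<le> norm (\<Sum>j\<in>J. c j *\<^sub>R e j)"
    by (rule sum_norm_decrease_le) (simp add: J_def)
  also have "(\<Sum>j\<in>J. c j *\<^sub>R e j) = (\<Sum>j<L. (if j \<in> J then c j else 0) *\<^sub>R e j)"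
    by (rule sum.mono_neutral_cong_left) (auto simp: J_def)
  also have "norm \<dots> \<le> 2 * \<phi>" by (rule upper_scaled) (auto simp: c2)
  finally show ?thesis by linarith
qed

lemma word_norm_variance:
  assumes N: "finite N" "N \<noteq> {}" "\<And>x. x \<in> N \<Longrightarrow> norm x \<le> 1" and a: "norm a \<le> 1"
  shows "word_avg N L (\<lambda>w. (word_norm L e a w - word_avg N L (word_norm L e a))\<^sup>2) \<le> 4 * \<phi>"
proof -
  note av = N(1,2)
  let ?F = "word_norm L e a"
  let ?m = "word_avg N L ?F"
  have "(\<lambda>w. (?F w - ?m)\<^sup>2) = (\<lambda>w. ((?F w)\<^sup>2 - (2 * ?m) *\<^sub>R ?F w) + ?m\<^sup>2)"
    by (simp add: fun_eq_iff power2_eq_square algebra_simps)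
  then have "word_avg N L (\<lambda>w. (?F w - ?m)\<^sup>2) = word_avg N L (\<lambda>w. (?F w)\<^sup>2) - ?m\<^sup>2"
    by (simp only: word_avg_add[OF av] word_avg_diff[OF av] word_avg_scaleR[OF av] word_avg_const[OF av])
      (simp add: power2_eq_square)
  also have "\<dots> \<le> (\<Sum>j<L. word_avg N L (\<lambda>w. avg N (\<lambda>t. (max 0 (?F w - ?F (w(j := t))))\<^sup>2)))"
    by (rule Efron_Stein[OF av])
  also have "\<dots> = word_avg N L (\<lambda>w. avg N (\<lambda>t. \<Sum>j<L. (max 0 (?F w - ?F (w(j := t))))\<^sup>2))"
    by (simp only: word_avg_sum[OF av] avg_sum[OF av])
  also have "\<dots> \<le> word_avg N L (\<lambda>w. 4 * \<phi>)"
  proof (rule word_avg_mono[OF av])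
    fix w assume w: "\<forall>j<L. w j \<in> N"
    have "avg N (\<lambda>t. \<Sum>j<L. (max 0 (?F w - ?F (w(j := t))))\<^sup>2) \<le> avg N (\<lambda>t. 4 * \<phi>)"
      by (rule avg_mono[OF av]) (intro word_norm_decrease a; use w N in auto)
    then show "avg N (\<lambda>t. \<Sum>j<L. (max 0 (?F w - ?F (w(j := t))))\<^sup>2) \<le> 4 * \<phi>"
      by (simp add: avg_const[OF av])
  qed
  finally show ?thesis by (simp add: word_avg_const[OF av])
qed

text \<open>Permuting the letters by \<open>\<pi>\<close> preserves the average over words and moves
  each coefficient by at most \<open>c\<close>, which costs at most
  \<open>c * \<phi>\<close>.\<close>

lemma word_norm_mean_diff:
  assumes N: "finite N" "N \<noteq> {}" and c: "c > 0"
    and \<pi>: "bij_betw \<pi> N N" "\<forall>x\<in>N. \<bar>inner a x - inner b (\<pi> x)\<bar> \<le> c"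
  shows "word_avg N L (word_norm L e a) \<le> word_avg N L (word_norm L e b) + c * \<phi>"
proof -
  have "word_avg N L (word_norm L e a) \<le> word_avg N L (\<lambda>w. word_norm L e b (\<lambda>j. \<pi> (w j)) + c * \<phi>)"
  proof (rule word_avg_mono[OF N])
    fix w assume w: "\<forall>j<L. w j \<in> N"
    have "norm (\<Sum>j<L. (inner a (w j) - inner b (\<pi> (w j))) *\<^sub>R e j) \<le> c * \<phi>"
      by (rule upper_scaled[OF c]) (use w \<pi> in auto)
    then show "word_norm L e a w \<le> word_norm L e b (\<lambda>j. \<pi> (w j)) + c * \<phi>"
      using norm_triangle_ineq2[of "\<Sum>j<L. inner a (w j) *\<^sub>R e j" "\<Sum>j<L. inner b (\<pi> (w j)) *\<^sub>R e j"]
      by (simp add: word_norm_def scaleR_diff_left sum_subtractf)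
  qed
  also have "\<dots> = word_avg N L (word_norm L e b) + c * \<phi>"
    using word_avg_bij[OF N \<pi>(1), of L "word_norm L e b"]
    by (simp add: word_avg_add[OF N] word_avg_const[OF N] word_norm_def)
  finally show ?thesis .
qed

text \<open>Unconditionality allows the coefficients to be replaced by their absolute values. The
  mean vector is then a multiple of the sum of the \<open>e j\<close>, and its norm is at most the
  mean of the norms.\<close>

lemma word_norm_mean_lower:
  assumes N: "finite N" "N \<noteq> {}" and C: "C > 0"
    and unc: "\<And>b. norm (\<Sum>j<L. \<bar>b j\<bar> *\<^sub>R e j) \<le> C * norm (\<Sum>j<L. b j *\<^sub>R e j)"
    and comp: "\<phi> \<le> C * norm (\<Sum>j<L. e j)"
    and m: "m \<le> avg N (\<lambda>x. \<bar>inner a x\<bar>)" "m \<ge> 0"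
  shows "m * \<phi> \<le> C\<^sup>2 * word_avg N L (word_norm L e a)"
proof -
  have "word_avg N L (\<lambda>w. \<Sum>j<L. \<bar>inner a (w j)\<bar> *\<^sub>R e j)
      = (\<Sum>j<L. word_avg N L (\<lambda>w. \<bar>inner a (w j)\<bar>) *\<^sub>R e j)"
    by (simp add: word_avg_sum[OF N] word_avg_scaleR_left[OF N])
  also have "\<dots> = (\<Sum>j<L. avg N (\<lambda>x. \<bar>inner a x\<bar>) *\<^sub>R e j)"
    using word_avg_marginal[OF N, of _ L "\<lambda>x. \<bar>inner a x\<bar>"] by (intro sum.cong) auto
  also have "\<dots> = avg N (\<lambda>x. \<bar>inner a x\<bar>) *\<^sub>R (\<Sum>j<L. e j)" by (simp add: scaleR_sum_right)
  finally have "norm (word_avg N L (\<lambda>w. \<Sum>j<L. \<bar>inner a (w j)\<bar> *\<^sub>R e j))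
      = avg N (\<lambda>x. \<bar>inner a x\<bar>) * norm (\<Sum>j<L. e j)" using m by simp
  then have "avg N (\<lambda>x. \<bar>inner a x\<bar>) * norm (\<Sum>j<L. e j)
      \<le> word_avg N L (\<lambda>w. norm (\<Sum>j<L. \<bar>inner a (w j)\<bar> *\<^sub>R e j))"
    using norm_EE_le[OF N, of L "\<lambda>w. \<Sum>j<L. \<bar>inner a (w j)\<bar> *\<^sub>R e j"] by simp
  also have "\<dots> \<le> word_avg N L (\<lambda>w. C *\<^sub>R word_norm L e a w)"
    by (rule word_avg_mono[OF N]) (use unc in \<open>simp add: word_norm_def\<close>)
  also have "\<dots> = C * word_avg N L (word_norm L e a)"
    by (simp only: word_avg_scaleR[OF N]) simp
  finally have "C * (avg N (\<lambda>x. \<bar>inner a x\<bar>) * norm (\<Sum>j<L. e j)) \<le> C * (C * word_avg N L (word_norm L e a))"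
    using C by (intro mult_left_mono) auto
  moreover have "m * \<phi> \<le> avg N (\<lambda>x. \<bar>inner a x\<bar>) * (C * norm (\<Sum>j<L. e j))"
    by (rule order_trans[OF mult_left_mono[OF comp m(2)] mult_right_mono[OF m(1)]]) (use C in simp)
  ultimately show ?thesis by (simp add: power2_eq_square mult_ac)
qed

end

text \<open>For a fixed word, \<open>word_norm\<close> is the norm of a linear image of its
  argument. The estimate therefore extends from the sphere by homogeneity, and the images of the
  unit vectors, divided by \<open>M\<close>, form the system.\<close>

lemma almost_euclidean_of_sphere_estimate:
  fixes e :: "nat \<Rightarrow> 'a::real_normed_vector"
  assumes M: "M > 0" and est: "\<And>x. x \<in> Sph n \<Longrightarrow> \<bar>word_norm L e x w - M\<bar> \<le> \<epsilon> * M"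
  shows "\<exists>u :: nat \<Rightarrow> 'a. \<forall>a :: nat \<Rightarrow> real.
      (1 - \<epsilon>) * sqrt (\<Sum>i<n. (a i)\<^sup>2) \<le> norm (\<Sum>i<n. a i *\<^sub>R u i) \<and>
      norm (\<Sum>i<n. a i *\<^sub>R u i) \<le> (1 + \<epsilon>) * sqrt (\<Sum>i<n. (a i)\<^sup>2)"
proof (rule exI, rule allI)
  fix a :: "nat \<Rightarrow> real"
  \<comment> \<open>This definition does not mention \<open>a\<close>, so it can instantiate the
    witness that \<open>exI\<close> left open.\<close>
  define u where "u i = (1 / M) *\<^sub>R (\<Sum>j<L. inner (unit_l2 i) (w j) *\<^sub>R e j)" for i
  define x where "x = (\<Sum>i<n. a i *\<^sub>R unit_l2 i)"
  define r where "r = sqrt (\<Sum>i<n. (a i)\<^sup>2)"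
  have nx: "norm x = r" unfolding x_def r_def by (rule norm_unit_combination)
  have eq: "norm (\<Sum>i<n. a i *\<^sub>R u i) = word_norm L e x w / M"
  proof -
    have "(\<Sum>i<n. a i *\<^sub>R u i) = (1 / M) *\<^sub>R (\<Sum>i<n. \<Sum>j<L. (a i * inner (unit_l2 i) (w j)) *\<^sub>R e j)"
      by (simp add: u_def scaleR_sum_right mult_ac)
    also have "(\<Sum>i<n. \<Sum>j<L. (a i * inner (unit_l2 i) (w j)) *\<^sub>R e j)
        = (\<Sum>j<L. inner x (w j) *\<^sub>R e j)"
      by (subst sum.swap) (simp add: x_def inner_sum_left scaleR_sum_left)
    finally show ?thesis using M by (simp add: word_norm_def)
  qed
  have "(1 - \<epsilon>) * r \<le> norm (\<Sum>i<n. a i *\<^sub>R u i) \<and> norm (\<Sum>i<n. a i *\<^sub>R u i) \<le> (1 + \<epsilon>) * r"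
  proof (cases "r = 0")
    case True
    then have "x = 0" using nx by simp
    then show ?thesis using True by (simp add: eq) (simp add: word_norm_def)
  next
    case False
    then have r: "r > 0" using nx norm_ge_zero[of x] by linarith
    have "x \<in> Efin n" unfolding x_def by (rule unit_combination_Efin)
    then have "(1 / r) *\<^sub>R x \<in> Sph n"
      using nx r by (auto simp: Sph_def intro: subspace_scale[OF Efin_subspace])
    from est[OF this] have "\<bar>word_norm L e x w / r - M\<bar> \<le> \<epsilon> * M"
    proof -
      have "(\<Sum>j<L. inner ((1 / r) *\<^sub>R x) (w j) *\<^sub>R e j) = (1 / r) *\<^sub>R (\<Sum>j<L. inner x (w j) *\<^sub>R e j)"
        by (simp add: scaleR_sum_right)
      then have "word_norm L e ((1 / r) *\<^sub>R x) w = word_norm L e x w / r"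
        using r by (simp only: word_norm_def norm_scaleR) simp
      then show "\<bar>word_norm L e ((1 / r) *\<^sub>R x) w - M\<bar> \<le> \<epsilon> * M \<Longrightarrow> ?thesis" by simp
    qed
    then have "(1 - \<epsilon>) * M \<le> word_norm L e x w / r" "word_norm L e x w / r \<le> (1 + \<epsilon>) * M"
      by (simp_all add: algebra_simps abs_le_iff)
    then show ?thesis using r M by (simp add: eq field_simps)
  qed
  then show "(1 - \<epsilon>) * sqrt (\<Sum>i<n. (a i)\<^sup>2) \<le> norm (\<Sum>i<n. a i *\<^sub>R u i) \<and>
      norm (\<Sum>i<n. a i *\<^sub>R u i) \<le> (1 + \<epsilon>) * sqrt (\<Sum>i<n. (a i)\<^sup>2)"
    by (simp add: r_def)
qed

definition almost_euclidean :: "nat \<Rightarrow> real \<Rightarrow> (nat \<Rightarrow> 'a::real_normed_vector) \<Rightarrow> bool" where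
  "almost_euclidean n \<epsilon> u \<longleftrightarrow> (\<forall>a :: nat \<Rightarrow> real.
      (1 - \<epsilon>) * sqrt (\<Sum>i<n. (a i)\<^sup>2) \<le> norm (\<Sum>i<n. a i *\<^sub>R u i) \<and>
      norm (\<Sum>i<n. a i *\<^sub>R u i) \<le> (1 + \<epsilon>) * sqrt (\<Sum>i<n. (a i)\<^sup>2))"

text \<open>The number \<open>\<phi>\<close> plays the role of the norm of the sum of the system; it
  is this size, and not the length \<open>L\<close>, that must be large for concentration.\<close>

definition unc_system :: "real \<Rightarrow> nat \<Rightarrow> (nat \<Rightarrow> 'a::real_normed_vector) \<Rightarrow> real \<Rightarrow> bool" where
  "unc_system C L e \<phi> \<longleftrightarrow> (\<forall>j<L. norm (e j) \<le> 1) \<and>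
    (\<forall>t. (\<forall>j<L. \<bar>t j\<bar> \<le> 1) \<longrightarrow> norm (\<Sum>j<L. t j *\<^sub>R e j) \<le> \<phi>) \<and>
    (\<forall>b. norm (\<Sum>j<L. \<bar>b j\<bar> *\<^sub>R e j) \<le> C * norm (\<Sum>j<L. b j *\<^sub>R e j)) \<and>
    \<phi> \<le> C * norm (\<Sum>j<L. e j)"

lemma concentration:
  assumes n: "n > 0" and C: "C \<ge> 1" and \<epsilon>: "0 < \<epsilon>" "\<epsilon> \<le> 1"
  shows "\<exists>\<Phi>>0. \<forall>L (e :: nat \<Rightarrow> 'a::real_normed_vector) \<phi>.
    unc_system C L e \<phi> \<longrightarrow> \<Phi> \<le> \<phi> \<longrightarrow> (\<exists>u :: nat \<Rightarrow> 'a. almost_euclidean n \<epsilon> u)"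
proof -
  \<comment> \<open>The mean word norm will be at least \<open>c0 * \<phi>\<close>: half of the
    \<open>1 / n\<close> from \<open>avg_abs_inner_lower\<close>, divided by the
    \<open>C\<^sup>2\<close> of \<open>word_norm_mean_lower\<close>.\<close>
  define c0 where "c0 = 1 / (2 * real n * C\<^sup>2)"
  have C2: "C\<^sup>2 \<ge> 1" "C > 0" using C by simp_all
  have c0: "c0 > 0" using n C by (simp add: c0_def)
  \<comment> \<open>Three errors of size \<open>\<eta> * \<phi>\<close> occur below: passing to a
    net point, the deviation from the mean there, and the change of the mean with the direction.
    Dividing by 6 keeps their sum below \<open>\<epsilon>\<close> times the mean.\<close>
  define \<eta> where "\<eta> = \<epsilon> * c0 / 6"
  have \<eta>: "\<eta> > 0" using \<epsilon> c0 by (simp add: \<eta>_def)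
  have "2 * real n * 1 \<le> 2 * real n * C\<^sup>2" using C2(1) by (intro mult_left_mono) auto
  then have "c0 \<le> 1 / (2 * real n)" unfolding c0_def using n C2 C by (intro divide_left_mono) auto
  moreover have "\<epsilon> * c0 \<le> 1 * c0" using \<epsilon> c0 by (intro mult_right_mono) auto
  ultimately have \<eta>n: "\<eta> \<le> 1 / (2 * real n)" unfolding \<eta>_def using c0 \<epsilon> by linarith
  obtain N where N: "finite N" "N \<noteq> {}" "N \<subseteq> Sph n"
    and inv: "\<And>a b. a \<in> Sph n \<Longrightarrow> b \<in> Sph n \<Longrightarrow>
      \<exists>\<pi>. bij_betw \<pi> N N \<and> (\<forall>x\<in>N. \<bar>inner a x - inner b (\<pi> x)\<bar> \<le> 2 * (\<eta> / 2))"
    using invariant_net[of "\<eta> / 2" n] \<eta> n by (metis half_gt_zero)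
  obtain A where A: "finite A" "A \<subseteq> Sph n" "\<And>x. x \<in> Sph n \<Longrightarrow> \<exists>s\<in>A. norm (x - s) \<le> \<eta>"
    using sphere_net[OF \<eta>] by metis
  \<comment> \<open>Chebyshev for all points of \<open>A\<close> together:
    \<open>card A * 4 * \<phi>\<close> is at most \<open>(\<eta> * \<phi>)\<^sup>2\<close> once
    \<open>\<phi>\<close> reaches this value. The summand 1 keeps it positive.\<close>
  define \<Phi> where "\<Phi> = 4 * (real (card A) + 1) / \<eta>\<^sup>2"
  have \<Phi>: "\<Phi> > 0" using \<eta> by (simp add: \<Phi>_def)
  have N1: "norm x \<le> 1" if "x \<in> N" for x using that N by (auto simp: Sph_def)
  note av = N(1,2)
  show ?thesis
  proof (rule exI[of _ \<Phi>], intro conjI allI impI \<Phi>)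
    fix L and e :: "nat \<Rightarrow> 'a" and \<phi>
    assume sys: "unc_system C L e \<phi>" and big: "\<Phi> \<le> \<phi>"
    have e1: "\<And>j. j < L \<Longrightarrow> norm (e j) \<le> 1"
      and up: "\<And>t. (\<forall>j<L. \<bar>t j\<bar> \<le> 1) \<Longrightarrow> norm (\<Sum>j<L. t j *\<^sub>R e j) \<le> \<phi>"
      and unc: "\<And>b. norm (\<Sum>j<L. \<bar>b j\<bar> *\<^sub>R e j) \<le> C * norm (\<Sum>j<L. b j *\<^sub>R e j)"
      and comp: "\<phi> \<le> C * norm (\<Sum>j<L. e j)"
      using sys by (auto simp: unc_system_def)
    have \<phi>: "\<phi> > 0" using \<Phi> big by linarith
    let ?F = "word_norm L e"
    define m where "m a = word_avg N L (?F a)" for a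
    define b0 where "b0 = unit_l2 0"
    have b0: "b0 \<in> Sph n" using n by (auto simp: b0_def Sph_def Efin_def)
    have mean: "m a \<le> m b + \<eta> * \<phi>" if ab: "a \<in> Sph n" "b \<in> Sph n" for a b
    proof -
      obtain \<pi> where "bij_betw \<pi> N N" "\<forall>x\<in>N. \<bar>inner a x - inner b (\<pi> x)\<bar> \<le> \<eta>"
        using inv[OF ab] by auto
      from word_norm_mean_diff[OF e1 up av \<eta> this] show ?thesis unfolding m_def by simp
    qed
    have lower: "c0 * \<phi> \<le> m b0"
    proof -
      have "1 / real n - \<eta> \<le> avg N (\<lambda>x. \<bar>inner b0 x\<bar>)"
        using avg_abs_inner_lower[OF N _ b0 n, of \<eta>] inv by simp
      moreover have "1 / (2 * real n) = 1 / real n - 1 / (2 * real n)" using n by simp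
      ultimately have "1 / (2 * real n) \<le> avg N (\<lambda>x. \<bar>inner b0 x\<bar>)" using \<eta>n by linarith
      then have "1 / (2 * real n) * \<phi> \<le> C\<^sup>2 * m b0"
        unfolding m_def using C n
        by (intro word_norm_mean_lower[where e = e and C = C, OF e1 up av _ unc comp]) auto
      then have "1 / (2 * real n) * \<phi> / C\<^sup>2 \<le> m b0"
        using C2 by (subst pos_divide_le_eq) (auto simp: mult_ac)
      then show ?thesis by (simp add: c0_def)
    qed
    have "0 < c0 * \<phi>" using c0 \<phi> by simp
    then have M: "m b0 > 0" using lower by linarith
    have small: "3 * (\<eta> * \<phi>) \<le> \<epsilon> * m b0"
    proof -
      have "3 * (\<eta> * \<phi>) \<le> \<epsilon> * (c0 * \<phi>)" using \<epsilon> c0 \<phi> by (simp add: \<eta>_def)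
      also have "\<dots> \<le> \<epsilon> * m b0" using lower \<epsilon> by (intro mult_left_mono) auto
      finally show ?thesis .
    qed
    have "word_avg N L (\<lambda>w. \<Sum>a\<in>A. (?F a w - m a)\<^sup>2) = (\<Sum>a\<in>A. word_avg N L (\<lambda>w. (?F a w - m a)\<^sup>2))"
      by (rule word_avg_sum[OF av])
    also have "\<dots> \<le> (\<Sum>a\<in>A. 4 * \<phi>)"
    proof (rule sum_mono)
      fix a assume "a \<in> A"
      then have "norm a \<le> 1" using A by (auto simp: Sph_def)
      then show "word_avg N L (\<lambda>w. (?F a w - m a)\<^sup>2) \<le> 4 * \<phi>"
        unfolding m_def using N1 by (intro word_norm_variance[OF e1 up av]) auto
    qed
    also have "\<dots> \<le> (real (card A) + 1) * 4 * \<phi>" using \<phi> by simp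
    also have "\<dots> = \<Phi> * \<phi> * \<eta>\<^sup>2" using \<eta> by (simp add: \<Phi>_def)
    also have "\<dots> \<le> \<phi> * \<phi> * \<eta>\<^sup>2" using big \<phi> \<eta> by (intro mult_right_mono) auto
    also have "\<dots> = (\<eta> * \<phi>)\<^sup>2" by (simp add: power2_eq_square)
    finally have var: "word_avg N L (\<lambda>w. \<Sum>a\<in>A. (?F a w - m a)\<^sup>2) \<le> (\<eta> * \<phi>)\<^sup>2" .
    \<comment> \<open>A word whose total squared deviation does not exceed the mean is good for
      every point of \<open>A\<close> simultaneously.\<close>
    obtain w where w: "\<forall>j<L. w j \<in> N" "(\<Sum>a\<in>A. (?F a w - m a)\<^sup>2) \<le> word_avg N L (\<lambda>w. \<Sum>a\<in>A. (?F a w - m a)\<^sup>2)"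
      using word_avg_exists[OF av, of L "\<lambda>w. \<Sum>a\<in>A. (?F a w - m a)\<^sup>2"] by blast
    have onA: "\<bar>?F a w - m a\<bar> \<le> \<eta> * \<phi>" if "a \<in> A" for a
    proof -
      have "(?F a w - m a)\<^sup>2 \<le> (\<Sum>a\<in>A. (?F a w - m a)\<^sup>2)"
        using that A by (intro member_le_sum) auto
      then have "(?F a w - m a)\<^sup>2 \<le> (\<eta> * \<phi>)\<^sup>2" using w var by linarith
      then have "\<bar>?F a w - m a\<bar> \<le> \<bar>\<eta> * \<phi>\<bar>" by (simp only: abs_le_square_iff)
      then show ?thesis using \<eta> \<phi> by simp
    qed
    have est: "\<bar>?F x w - m b0\<bar> \<le> \<epsilon> * m b0" if x: "x \<in> Sph n" for x
    proof -
      obtain a where a: "a \<in> A" "norm (x - a) \<le> \<eta>" using A(3)[OF x] by blast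
      have "norm (\<Sum>j<L. inner (x - a) (w j) *\<^sub>R e j) \<le> \<eta> * \<phi>"
      proof (rule upper_scaled[OF e1 up \<eta>], simp_all, intro allI impI)
        fix j assume "j < L"
        then have "norm (w j) \<le> 1" using w N1 by auto
        then show "\<bar>inner (x - a) (w j)\<bar> \<le> \<eta>"
          using Cauchy_Schwarz_ineq2[of "x - a" "w j"] a(2)
            mult_mono[of "norm (x - a)" \<eta> "norm (w j)" 1] \<eta> by simp
      qed
      then have "\<bar>?F x w - ?F a w\<bar> \<le> \<eta> * \<phi>"
        using norm_triangle_ineq3[of "\<Sum>j<L. inner x (w j) *\<^sub>R e j" "\<Sum>j<L. inner a (w j) *\<^sub>R e j"]
        by (simp add: word_norm_def inner_diff_left scaleR_diff_left sum_subtractf)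
      moreover have "a \<in> Sph n" using a A by blast
      ultimately show ?thesis
        using onA[OF a(1)] mean[OF _ b0, of a] mean[OF b0, of a] small by linarith
    qed
    show "\<exists>u :: nat \<Rightarrow> 'a. almost_euclidean n \<epsilon> u"
      unfolding almost_euclidean_def by (rule almost_euclidean_of_sphere_estimate[OF M est])
  qed
qed

text \<open>A convex function on a cube is largest at a vertex. The vector \<open>x\<close> absorbs
  the coordinates that have already been set to a sign.\<close>

lemma convex_signs_bound:
  fixes e :: "nat \<Rightarrow> 'a::real_normed_vector"
  assumes "\<And>s. (\<forall>j<L. \<bar>s j\<bar> = (1::real)) \<Longrightarrow> norm (x + (\<Sum>j<L. s j *\<^sub>R e j)) \<le> B"
    and "\<forall>j<L. \<bar>t j\<bar> \<le> 1"
  shows "norm (x + (\<Sum>j<L. t j *\<^sub>R e j)) \<le> B"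
  using assms
proof (induction L arbitrary: x)
  case 0
  then show ?case by simp
next
  case (Suc L)
  have end1: "norm ((x + c *\<^sub>R e L) + (\<Sum>j<L. t j *\<^sub>R e j)) \<le> B" if c: "\<bar>c\<bar> = 1" for c
  proof (rule Suc.IH)
    fix s :: "nat \<Rightarrow> real" assume "\<forall>j<L. \<bar>s j\<bar> = 1"
    then have "norm (x + (\<Sum>j<Suc L. (s(L := c)) j *\<^sub>R e j)) \<le> B"
      by (intro Suc.prems(1)) (auto simp: less_Suc_eq c)
    then show "norm (x + c *\<^sub>R e L + (\<Sum>j<L. s j *\<^sub>R e j)) \<le> B" by (simp add: add_ac)
  qed (use Suc.prems in auto)
  define y where "y = x + (\<Sum>j<L. t j *\<^sub>R e j)"
  define \<tau> where "\<tau> = t L"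
  have \<tau>: "\<bar>\<tau>\<bar> \<le> 1" using Suc.prems by (simp add: \<tau>_def)
  have p: "norm (y + e L) \<le> B" using end1[of 1] by (simp add: y_def add_ac)
  have m: "norm (y - e L) \<le> B" using end1[of "-1"] by (simp add: y_def algebra_simps)
  have "((1 + \<tau>) / 2) *\<^sub>R (y + e L) + ((1 - \<tau>) / 2) *\<^sub>R (y - e L)
      = ((1 + \<tau>) / 2 + (1 - \<tau>) / 2) *\<^sub>R y + ((1 + \<tau>) / 2 - (1 - \<tau>) / 2) *\<^sub>R e L"
    unfolding scaleR_add_left scaleR_diff_left scaleR_add_right scaleR_diff_right by simp
  moreover have "(1 + \<tau>) / 2 + (1 - \<tau>) / 2 = 1" "(1 + \<tau>) / 2 - (1 - \<tau>) / 2 = \<tau>"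
    by (simp_all add: field_simps)
  ultimately have "y + \<tau> *\<^sub>R e L = ((1 + \<tau>) / 2) *\<^sub>R (y + e L) + ((1 - \<tau>) / 2) *\<^sub>R (y - e L)"
    by simp
  then have "norm (y + \<tau> *\<^sub>R e L) \<le> norm (((1 + \<tau>) / 2) *\<^sub>R (y + e L)) + norm (((1 - \<tau>) / 2) *\<^sub>R (y - e L))"
    by (simp only: norm_triangle_ineq)
  also have "\<dots> = ((1 + \<tau>) / 2) * norm (y + e L) + ((1 - \<tau>) / 2) * norm (y - e L)"
    using \<tau> by simp
  also have "\<dots> \<le> ((1 + \<tau>) / 2) * B + ((1 - \<tau>) / 2) * B"
    using \<tau> p m by (intro add_mono mult_left_mono) auto
  also have "\<dots> = B" by (simp add: field_simps)
  finally show ?case by (simp add: y_def \<tau>_def add_ac)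
qed

text \<open>The vertices of the cube are sign changes of the all-one vector, so bounded sign changes
  control the whole cube by convexity; taking absolute values of \<open>b\<close> is one particular
  choice of signs.\<close>

lemma unc_system_of_signs:
  fixes e :: "nat \<Rightarrow> 'a::real_normed_vector"
  assumes e1: "\<And>j. j < L \<Longrightarrow> norm (e j) \<le> 1" and C: "C \<ge> 1"
    and signs: "\<And>s b. (\<forall>j<L. \<bar>s j\<bar> = 1) \<Longrightarrow>
      norm (\<Sum>j<L. (s j * b j) *\<^sub>R e j) \<le> C * norm (\<Sum>j<L. b j *\<^sub>R e j)"
  shows "unc_system C L e (C * norm (\<Sum>j<L. e j))"
  unfolding unc_system_def
proof (intro conjI allI impI)
  fix t :: "nat \<Rightarrow> real" assume t: "\<forall>j<L. \<bar>t j\<bar> \<le> 1"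
  have "norm (0 + (\<Sum>j<L. t j *\<^sub>R e j)) \<le> C * norm (\<Sum>j<L. e j)"
    by (rule convex_signs_bound[OF _ t]) (use signs[of _ "\<lambda>_. 1"] in simp)
  then show "norm (\<Sum>j<L. t j *\<^sub>R e j) \<le> C * norm (\<Sum>j<L. e j)" by simp
next
  fix b :: "nat \<Rightarrow> real"
  define s where "s j = (if b j < 0 then -1 else 1 :: real)" for j
  have "(\<Sum>j<L. \<bar>b j\<bar> *\<^sub>R e j) = (\<Sum>j<L. (s j * b j) *\<^sub>R e j)"
    by (rule sum.cong) (auto simp: s_def)
  then show "norm (\<Sum>j<L. \<bar>b j\<bar> *\<^sub>R e j) \<le> C * norm (\<Sum>j<L. b j *\<^sub>R e j)"
    using signs[of s b] by (simp add: s_def)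
qed (use e1 in auto)

section \<open>Finite-dimensional subspaces and stable sequences\<close>

text \<open>\<open>d\<close> is the distance from \<open>b\<close> to \<open>S\<close>, and the
  general inequality is its homogeneous form.\<close>

lemma subspace_dist:
  fixes S :: "'a::real_normed_vector set"
  assumes "subspace S" "closed S" "b \<notin> S"
  shows "\<exists>d>0. \<forall>t. \<forall>s\<in>S. \<bar>t\<bar> * d \<le> norm (t *\<^sub>R b + s)"
proof -
  have ne: "S \<noteq> {}" using subspace_0[OF assms(1)] by auto
  have d: "infdist b S > 0" using assms ne by (simp add: infdist_pos_not_in_closed)
  have "\<bar>t\<bar> * infdist b S \<le> norm (t *\<^sub>R b + s)" if s: "s \<in> S" for t s
  proof (cases "t = 0")
    case False
    have "(- 1 / t) *\<^sub>R s \<in> S" by (rule subspace_scale[OF assms(1) s])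
    then have "infdist b S \<le> norm (b - (- 1 / t) *\<^sub>R s)" using infdist_le by (metis dist_norm)
    then have "\<bar>t\<bar> * infdist b S \<le> \<bar>t\<bar> * norm (b - (- 1 / t) *\<^sub>R s)" by (intro mult_left_mono) auto
    also have "\<dots> = norm (t *\<^sub>R (b - (- 1 / t) *\<^sub>R s))" by simp
    also have "t *\<^sub>R (b - (- 1 / t) *\<^sub>R s) = t *\<^sub>R b + s" using False by (simp add: algebra_simps)
    finally show ?thesis .
  qed simp
  with d show ?thesis by blast
qed

text \<open>By \<open>subspace_dist\<close> the coefficients of \<open>b\<close> along a convergent
  sequence are Cauchy. Once their limit is subtracted, the rest converges in the closed
  \<open>span B\<close>.\<close>

lemma closed_span_insert:
  fixes B :: "'a::real_normed_vector set"
  assumes cl: "closed (span B)"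
  shows "closed (span (insert b B))"
proof (cases "b \<in> span B")
  case True
  then show ?thesis using cl by (simp add: span_redundant)
next
  case False
  obtain d where d: "d > 0" "\<And>t s. s \<in> span B \<Longrightarrow> \<bar>t\<bar> * d \<le> norm (t *\<^sub>R b + s)"
    using subspace_dist[OF subspace_span cl False] by blast
  show ?thesis
    unfolding closed_sequential_limits
  proof (intro allI impI, elim conjE)
    fix x l assume x: "\<forall>n. x n \<in> span (insert b B)" and lim: "x \<longlonglongrightarrow> l"
    then have "\<forall>n. \<exists>t. x n - t *\<^sub>R b \<in> span B" by (simp add: span_insert)
    then obtain t where t: "\<And>n. x n - t n *\<^sub>R b \<in> span B" by metis
    have "Cauchy t"
    proof (rule metric_CauchyI)
      fix e :: real assume "e > 0"
      then have "e * d > 0" using d by simp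
      with LIMSEQ_imp_Cauchy[OF lim] obtain M
        where M: "\<And>m n. m \<ge> M \<Longrightarrow> n \<ge> M \<Longrightarrow> norm (x m - x n) < e * d"
        by (metis CauchyD)
      have "dist (t m) (t n) < e" if "m \<ge> M" "n \<ge> M" for m n
      proof -
        have "\<bar>t m - t n\<bar> * d \<le> norm ((t m - t n) *\<^sub>R b + ((x m - t m *\<^sub>R b) - (x n - t n *\<^sub>R b)))"
          by (intro d span_diff t)
        also have "(t m - t n) *\<^sub>R b + ((x m - t m *\<^sub>R b) - (x n - t n *\<^sub>R b)) = x m - x n"
          by (simp add: algebra_simps)
        finally have "\<bar>t m - t n\<bar> * d < e * d" using M[OF that] by linarith
        then show ?thesis using d by (simp add: dist_real_def)
      qed
      then show "\<exists>M. \<forall>m\<ge>M. \<forall>n\<ge>M. dist (t m) (t n) < e" by blast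
    qed
    then obtain t0 where "t \<longlonglongrightarrow> t0" using Cauchy_convergent convergent_def by blast
    then have "(\<lambda>n. x n - t n *\<^sub>R b) \<longlonglongrightarrow> l - t0 *\<^sub>R b" by (intro tendsto_intros lim)
    then have "l - t0 *\<^sub>R b \<in> span B"
      using closed_sequentially[OF cl, of "\<lambda>n. x n - t n *\<^sub>R b"] t by simp
    then show "l \<in> span (insert b B)" by (auto simp: span_insert)
  qed
qed

lemma closed_span_finite: "finite B \<Longrightarrow> closed (span B :: 'a::real_normed_vector set)"
  by (induction B rule: finite_induct) (simp_all add: closed_span_insert)

definition inf_dim :: "'a::real_normed_vector itself \<Rightarrow> bool" where
  "inf_dim _ \<longleftrightarrow> \<not> (\<exists>B :: 'a set. finite B \<and> span B = UNIV)"

text \<open>Riesz's lemma: \<open>x - s0\<close> is normalised for an \<open>s0\<close> in the span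
  that is less than twice as far from \<open>x\<close> as the span is, which loses the factor
  1/2.\<close>

lemma Riesz_unit:
  assumes "inf_dim TYPE('a::real_normed_vector)" "finite (B :: 'a set)"
  shows "\<exists>y. norm y = 1 \<and> (\<forall>s\<in>span B. 1 / 2 \<le> norm (y - s))"
proof -
  have ne: "span B \<noteq> {}" using span_zero by blast
  obtain x where x: "x \<notin> span B" using assms by (auto simp: inf_dim_def)
  define d where "d = infdist x (span B)"
  have d: "d > 0"
    unfolding d_def using closed_span_finite[OF assms(2)] x ne by (simp add: infdist_pos_not_in_closed)
  obtain s0 where s0: "s0 \<in> span B" "dist x s0 < 2 * d"
  proof -
    have "(INF a\<in>span B. dist x a) < 2 * d" using d ne by (simp add: d_def infdist_def)
    then show thesis using ne that by (subst (asm) cINF_less_iff) (auto intro: bdd_belowI[of _ 0])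
  qed
  define c where "c = norm (x - s0)"
  have c: "c > 0" "c < 2 * d" using s0 x by (auto simp: c_def dist_norm)
  have "1 / 2 \<le> norm ((1 / c) *\<^sub>R (x - s0) - s)" if "s \<in> span B" for s
  proof -
    have "s0 + c *\<^sub>R s \<in> span B" using s0 that by (intro span_add span_scale)
    then have "d \<le> norm (x - (s0 + c *\<^sub>R s))" unfolding d_def using infdist_le by (metis dist_norm)
    also have "x - (s0 + c *\<^sub>R s) = c *\<^sub>R ((1 / c) *\<^sub>R (x - s0) - s)" using c by (simp add: algebra_simps)
    finally have "d \<le> c * norm ((1 / c) *\<^sub>R (x - s0) - s)" using c by simp
    moreover have "c * norm ((1 / c) *\<^sub>R (x - s0) - s) \<le> (2 * d) * norm ((1 / c) *\<^sub>R (x - s0) - s)"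
      using c by (intro mult_right_mono) auto
    ultimately have "d * 1 \<le> d * (2 * norm ((1 / c) *\<^sub>R (x - s0) - s))" by simp
    then show ?thesis using d by (simp only: mult_le_cancel_left_pos)
  qed
  moreover have "norm ((1 / c) *\<^sub>R (x - s0)) = 1" using c by (simp add: c_def)
  ultimately show ?thesis by blast
qed

lemma separated_sequence:
  assumes "inf_dim TYPE('a::real_normed_vector)"
  obtains y :: "nat \<Rightarrow> 'a::real_normed_vector" where "\<And>n. norm (y n) = 1" "\<And>m n. m \<noteq> n \<Longrightarrow> 1 / 2 \<le> norm (y m - y n)"
proof -
  have "\<exists>y :: nat \<Rightarrow> 'a. \<forall>n. norm (y n) = 1 \<and> (\<forall>s\<in>span (y ` {..<n}). 1 / 2 \<le> norm (y n - s))"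
  proof (rule dependent_wellorder_choice)
    show "(norm r = 1 \<and> (\<forall>s\<in>span (f ` {..<n}). 1 / 2 \<le> norm (r - s)))
      = (norm r = 1 \<and> (\<forall>s\<in>span (g ` {..<n}). 1 / 2 \<le> norm (r - s)))"
      if "\<And>m. m < n \<Longrightarrow> f m = g m" for r and f g :: "nat \<Rightarrow> 'a" and n
    proof -
      have "f ` {..<n} = g ` {..<n}" using that by (intro image_cong) auto
      then show ?thesis by simp
    qed
    show "\<exists>r. norm r = 1 \<and> (\<forall>s\<in>span (f ` {..<n}). 1 / 2 \<le> norm (r - s))" for n and f :: "nat \<Rightarrow> 'a"
      by (rule Riesz_unit[OF assms]) simp
  qed
  then obtain y :: "nat \<Rightarrow> 'a" where y: "\<And>n. norm (y n) = 1"
    "\<And>n s. s \<in> span (y ` {..<n}) \<Longrightarrow> 1 / 2 \<le> norm (y n - s)" by blast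
  have less: "1 / 2 \<le> norm (y n - y m)" if "m < n" for m n
    by (rule y(2)) (use that in \<open>auto intro: span_base\<close>)
  show thesis
  proof
    show "1 / 2 \<le> norm (y m - y n)" if "m \<noteq> n" for m n
      using less[of m n] less[of n m] that by (cases "m < n") (auto simp: norm_minus_commute)
  qed (rule y)
qed

section \<open>Ramsey's theorem for real-valued functions and stable subsequences\<close>

definition small_osc :: "nat \<Rightarrow> real \<Rightarrow> (nat set \<Rightarrow> real) \<Rightarrow> nat set \<Rightarrow> bool" where
  "small_osc r \<eta> f H \<longleftrightarrow>
    (\<forall>X Y. X \<subseteq> H \<longrightarrow> Y \<subseteq> H \<longrightarrow> finite X \<longrightarrow> finite Y \<longrightarrow> card X = r \<longrightarrow> card Y = r \<longrightarrow> \<bar>f X - f Y\<bar> \<le> \<eta>)"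

text \<open>A set is coloured by the integer part of \<open>f X / \<eta>\<close>: boundedness leaves
  finitely many colours, and sets of one colour have values within \<open>\<eta>\<close>.\<close>

lemma Ramsey_real:
  fixes f :: "nat set \<Rightarrow> real" and Z :: "nat set"
  assumes "infinite Z" "\<eta> > 0"
    and bnd: "\<forall>X. finite X \<longrightarrow> card X = r \<longrightarrow> 0 \<le> f X \<and> f X \<le> B"
  shows "\<exists>H. H \<subseteq> Z \<and> infinite H \<and> small_osc r \<eta> f H"
proof -
  define c where "c X = nat \<lfloor>f X / \<eta>\<rfloor>" for X :: "nat set"
  have "\<forall>X. X \<subseteq> Z \<and> finite X \<and> card X = r \<longrightarrow> c X < nat \<lfloor>B / \<eta>\<rfloor> + 1"
  proof (intro allI impI, elim conjE)
    fix X :: "nat set" assume "finite X" "card X = r"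
    then have "f X / \<eta> \<le> B / \<eta>" using bnd assms by (simp add: divide_right_mono)
    then show "c X < nat \<lfloor>B / \<eta>\<rfloor> + 1" unfolding c_def by (simp add: less_Suc_eq_le nat_mono floor_mono)
  qed
  from Ramsey[OF assms(1) this] obtain H t where H: "H \<subseteq> Z" "infinite H"
    "\<forall>X. X \<subseteq> H \<and> finite X \<and> card X = r \<longrightarrow> c X = t" by blast
  show ?thesis
    unfolding small_osc_def
  proof (intro exI conjI allI impI)
    fix X Y :: "nat set" assume X: "X \<subseteq> H" "finite X" "card X = r" and Y: "Y \<subseteq> H" "finite Y" "card Y = r"
    then have "c X = c Y" using H by simp
    moreover have "0 \<le> f X / \<eta>" "0 \<le> f Y / \<eta>" using bnd X Y assms by auto
    ultimately have "\<lfloor>f X / \<eta>\<rfloor> = \<lfloor>f Y / \<eta>\<rfloor>" unfolding c_def by (simp add: eq_nat_nat_iff)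
    then have "\<bar>f X / \<eta> - f Y / \<eta>\<bar> \<le> 1"
      using floor_correct[of "f X / \<eta>"] floor_correct[of "f Y / \<eta>"] by linarith
    then show "\<bar>f X - f Y\<bar> \<le> \<eta>" using assms by (simp add: abs_le_iff field_simps)
  qed (use H in auto)
qed

lemma small_osc_subset: "small_osc r \<eta> f H \<Longrightarrow> H' \<subseteq> H \<Longrightarrow> small_osc r \<eta> f H'"
  unfolding small_osc_def
proof (intro allI impI)
  fix X Y assume *: "\<forall>X Y. X \<subseteq> H \<longrightarrow> Y \<subseteq> H \<longrightarrow> finite X \<longrightarrow> finite Y \<longrightarrow> card X = r \<longrightarrow> card Y = r
    \<longrightarrow> \<bar>f X - f Y\<bar> \<le> \<eta>" "H' \<subseteq> H" "X \<subseteq> H'" "Y \<subseteq> H'" "finite X" "finite Y" "card X = r" "card Y = r"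
  then have "X \<subseteq> H" "Y \<subseteq> H" by auto
  with * show "\<bar>f X - f Y\<bar> \<le> \<eta>" by simp
qed

lemma Ramsey_real_family:
  fixes f :: "'g \<Rightarrow> nat set \<Rightarrow> real"
  assumes "finite G" "\<eta> > 0"
    and bnd: "\<forall>g\<in>G. \<forall>X. finite X \<longrightarrow> card X = r \<longrightarrow> 0 \<le> f g X \<and> f g X \<le> B"
  shows "\<exists>H. infinite H \<and> (\<forall>g\<in>G. small_osc r \<eta> (f g) H)"
  using assms(1,3)
proof (induction G rule: finite_induct)
  case (insert g G)
  then obtain H where H: "infinite H" "\<forall>g\<in>G. small_osc r \<eta> (f g) H"
    by auto
  have "\<forall>X. finite X \<longrightarrow> card X = r \<longrightarrow> 0 \<le> f g X \<and> f g X \<le> B" using insert.prems by blast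
  from Ramsey_real[where f = "f g" and r = r and B = B, OF H(1) assms(2) this]
  obtain H' where H': "H' \<subseteq> H" "infinite H'" "small_osc r \<eta> (f g) H'"
    by (elim exE conjE)
  show ?case
    by (rule exI[of _ H'], intro conjI ballI H'(2)) (use H' H(2) small_osc_subset in blast)
next
  case empty
  show ?case by (rule exI[of _ UNIV]) simp
qed

text \<open>Ramsey's theorem speaks of sets, stability of increasing tuples; this translates between
  them.\<close>

lemma sorted_list_of_increasing_image:
  fixes q :: "nat \<Rightarrow> nat"
  assumes "\<And>i j. i < j \<Longrightarrow> j < r \<Longrightarrow> q i < q j"
  shows "sorted_list_of_set (q ` {..<r}) = map q [0..<r]" "card (q ` {..<r}) = r"
proof -
  have "inj_on q {..<r}"
  proof (rule linorder_inj_onI')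
    fix i j assume "i \<in> {..<r}" "j \<in> {..<r}" "i < j"
    then have "q i < q j" by (intro assms) auto
    then show "q i \<noteq> q j" by simp
  qed
  moreover have "sorted (map q [0..<r])"
    using assms by (auto simp: sorted_iff_nth_mono le_less)
  ultimately show "sorted_list_of_set (q ` {..<r}) = map q [0..<r]"
    by (intro sorted_distinct_set_unique) (auto simp: distinct_map lessThan_atLeast0)
  show "card (q ` {..<r}) = r" using \<open>inj_on q {..<r}\<close> by (simp add: card_image)
qed

lemma norm_combination_diff:
  fixes y :: "nat \<Rightarrow> 'a::real_normed_vector"
  assumes "\<And>i. i < r \<Longrightarrow> norm (y i) \<le> 1" "\<forall>i<r. \<bar>a i - g i\<bar> \<le> h"
  shows "\<bar>norm (\<Sum>i<r. a i *\<^sub>R y i) - norm (\<Sum>i<r. g i *\<^sub>R y i)\<bar> \<le> real r * h"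
proof -
  have "\<bar>norm (\<Sum>i<r. a i *\<^sub>R y i) - norm (\<Sum>i<r. g i *\<^sub>R y i)\<bar> \<le> norm (\<Sum>i<r. (a i - g i) *\<^sub>R y i)"
    using norm_triangle_ineq3[of "\<Sum>i<r. a i *\<^sub>R y i" "\<Sum>i<r. g i *\<^sub>R y i"]
    by (simp add: scaleR_left_diff_distrib sum_subtractf)
  also have "\<dots> \<le> (\<Sum>i<r. h)"
  proof (rule sum_norm_le)
    fix i assume "i \<in> {..<r}"
    then have "\<bar>a i - g i\<bar> * norm (y i) \<le> h * 1"
      using assms by (intro mult_mono) (auto intro: order_trans[OF abs_ge_zero])
    then show "norm ((a i - g i) *\<^sub>R y i) \<le> h" by simp
  qed
  finally show ?thesis by simp
qed

definition incr_upto :: "nat \<Rightarrow> (nat \<Rightarrow> nat) \<Rightarrow> bool" where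
  "incr_upto r q \<longleftrightarrow> (\<forall>i j. i < j \<longrightarrow> j < r \<longrightarrow> q i < q j)"

text \<open>A finite form of a spreading model: along a subsequence the norm of a combination nearly
  depends on its coefficients alone and not on the positions. Ramsey's theorem is applied to each
  vector of a finite net of coefficients.\<close>

lemma stable_subsequence:
  fixes y :: "nat \<Rightarrow> 'a::real_normed_vector" and r :: nat
  assumes y1: "\<forall>n. norm (y n) = 1" and "\<eta> > 0"
  shows "\<exists>h :: nat \<Rightarrow> nat. strict_mono h \<and>
    (\<forall>q q' a. incr_upto r q \<longrightarrow> incr_upto r q' \<longrightarrow> (\<forall>i<r. \<bar>a i\<bar> \<le> 1) \<longrightarrow>
      norm (\<Sum>i<r. a i *\<^sub>R y (h (q i))) \<le> norm (\<Sum>i<r. a i *\<^sub>R y (h (q' i))) + \<eta>)"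
proof -
  \<comment> \<open>Replacing \<open>a\<close> by a net vector costs at most \<open>r * k\<close>, a
    third of \<open>\<eta>\<close>, on each side; the oscillation for the net vector is the
    remaining third.\<close>
  define k where "k = \<eta> / (3 * (real r + 1))"
  have k: "k > 0" using assms by (simp add: k_def)
  have rk: "real r * k \<le> \<eta> / 3" using assms by (simp add: k_def field_simps)
  have "\<forall>a\<in>{a :: nat \<Rightarrow> real. \<forall>i<r. \<bar>a i\<bar> \<le> 1}. \<forall>i<r. \<bar>a i\<bar> \<le> 1" by simp
  from cube_net[OF k this] obtain G where G: "finite G" "G \<subseteq> {a. \<forall>i<r. \<bar>a i\<bar> \<le> 1}"
    "\<forall>a\<in>{a. \<forall>i<r. \<bar>a i\<bar> \<le> 1}. \<exists>g\<in>G. \<forall>i<r. \<bar>a i - g i\<bar> \<le> k" by blast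
  define f where "f g X = norm (\<Sum>i<r. g i *\<^sub>R y (sorted_list_of_set X ! i))" for g :: "nat \<Rightarrow> real" and X
  have bnd: "0 \<le> f g X \<and> f g X \<le> real r" if "g \<in> G" for g X
    using norm_combination_diff[of r "\<lambda>i. y (sorted_list_of_set X ! i)" g "\<lambda>_. 0" 1] that G y1
    by (auto simp: f_def)
  obtain H where H: "infinite H" and osc: "\<forall>g\<in>G. small_osc r (\<eta> / 3) (f g) H"
    using Ramsey_real_family[OF G(1), of "\<eta> / 3" r f "real r"] assms bnd by auto
  define h where "h = enumerate H"
  have h: "strict_mono h" unfolding h_def by (rule strict_mono_enumerate[OF H])
  have inH: "h n \<in> H" for n by (simp add: h_def enumerate_in_set[OF H])
  show ?thesis
  proof (rule exI[of _ h], intro conjI h allI impI)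
    fix q q' :: "nat \<Rightarrow> nat" and a :: "nat \<Rightarrow> real"
    assume q: "incr_upto r q" and q': "incr_upto r q'"
      and a: "\<forall>i<r. \<bar>a i\<bar> \<le> 1"
    obtain g where g: "g \<in> G" "\<forall>i<r. \<bar>a i - g i\<bar> \<le> k" using G(3) a by blast
    define N where "N b p = norm (\<Sum>i<r. b i *\<^sub>R y (h (p i)))" for b :: "nat \<Rightarrow> real" and p
    have fN: "f g ((h \<circ> p) ` {..<r}) = N g p \<and> card ((h \<circ> p) ` {..<r}) = r"
      if "incr_upto r p" for p
    proof -
      have m: "(h \<circ> p) i < (h \<circ> p) j" if "i < j" "j < r" for i j
        using strict_monoD[OF h] \<open>incr_upto r p\<close> that by (simp add: incr_upto_def)
      show ?thesis
        using sorted_list_of_increasing_image[of r "h \<circ> p", OF m] by (simp add: f_def N_def)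
    qed
    have sub: "(h \<circ> p) ` {..<r} \<subseteq> H" for p using inH by auto
    have "\<bar>N g q - N g q'\<bar> \<le> \<eta> / 3"
      using bspec[OF osc g(1), unfolded small_osc_def, rule_format, OF sub[of q] sub[of q']] fN[OF q] fN[OF q'] by simp
    moreover have "\<bar>N a p - N g p\<bar> \<le> \<eta> / 3" for p
      using norm_combination_diff[of r "\<lambda>i. y (h (p i))" a g k] g(2) y1 rk by (simp add: N_def)
    from this[of q] this[of q'] have "\<bar>N a q - N g q\<bar> \<le> \<eta> / 3" "\<bar>N a q' - N g q'\<bar> \<le> \<eta> / 3" .
    ultimately have "N a q \<le> N a q' + \<eta>" by linarith
    then show "norm (\<Sum>i<r. a i *\<^sub>R y (h (q i))) \<le> norm (\<Sum>i<r. a i *\<^sub>R y (h (q' i))) + \<eta>"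
      by (simp add: N_def)
  qed
qed

section \<open>Dvoretzky's theorem\<close>

lemma sum_lessThan_double: "(\<Sum>k<2 * L. g k) = (\<Sum>j<L. g (2 * j) + g (2 * j + 1 :: nat))"
  by (induction L) (simp_all add: add.assoc)

text \<open>Brunel and Sucheston: averaging the pairs \<open>(h (j (m + 2) + i), h (j (m + 2) + i + 1))\<close> over
  \<open>i < m\<close> telescopes, which suppresses the coordinates outside \<open>A\<close>, while stability keeps the norm.\<close>

lemma suppression_bounded:
  fixes y :: "nat \<Rightarrow> 'a::real_normed_vector"
  assumes y1: "\<forall>n. norm (y n) = 1" and sep: "\<forall>m n. m \<noteq> n \<longrightarrow> 1 / 2 \<le> norm (y m - y n)"
  shows "\<exists>z :: nat \<Rightarrow> 'a. (\<forall>j. norm (z j) \<le> 2 \<and> 1 / 2 \<le> norm (z j)) \<and>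
    (\<forall>A a. A \<subseteq> {..<L} \<longrightarrow> (\<forall>j<L. \<bar>a j\<bar> \<le> 1) \<longrightarrow>
      norm (\<Sum>j\<in>A. a j *\<^sub>R z j) \<le> norm (\<Sum>j<L. a j *\<^sub>R z j) + 1 / 4)"
proof -
  obtain h where h: "strict_mono h" and st: "\<forall>q q' a. incr_upto (2 * L) q \<longrightarrow> incr_upto (2 * L) q' \<longrightarrow>
      (\<forall>i<2 * L. \<bar>a i\<bar> \<le> 1) \<longrightarrow>
      norm (\<Sum>i<2 * L. a i *\<^sub>R y (h (q i))) \<le> norm (\<Sum>i<2 * L. a i *\<^sub>R y (h (q' i))) + 1 / 8"
    using stable_subsequence[OF y1, of "1 / 8" "2 * L"] by auto
  \<comment> \<open>The telescoped rest has norm at most \<open>2 * L\<close>, which is at most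
    \<open>m / 8\<close>; the summand 1 makes \<open>m\<close> positive.\<close>
  define m where "m = 16 * L + 1"
  define D where "D i j = y (h (j * (m + 2) + i)) - y (h (j * (m + 2) + i + 1))" for i j :: nat
  have hne: "h k \<noteq> h (k + 1)" for k using strict_monoD[OF h, of k "k + 1"] by simp
  show ?thesis
  proof (rule exI[of _ "D 0"], intro conjI allI impI)
    show "norm (D 0 j) \<le> 2" for j
      using norm_triangle_ineq4[of "y (h (j * (m + 2) + 0))" "y (h (j * (m + 2) + 0 + 1))"] y1
      by (simp add: D_def)
    show "1 / 2 \<le> norm (D 0 j)" for j unfolding D_def using sep hne by blast
    fix A :: "nat set" and a :: "nat \<Rightarrow> real" assume A: "A \<subseteq> {..<L}" and a: "\<forall>j<L. \<bar>a j\<bar> \<le> 1"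
    \<comment> \<open>Alternating signs turn a combination of \<open>2 * L\<close> vectors into one
      of \<open>L\<close> differences.\<close>
    define \<alpha> where "\<alpha> k = (if even k then a (k div 2) else - a (k div 2))" for k :: nat
    define pos where "pos i j = (if j \<in> A then 0 else i)" for i j :: nat
    \<comment> \<open>Block \<open>j\<close> occupies an interval of length \<open>m + 2\<close>.
      Its pair sits at offset 0 for \<open>j\<close> in \<open>A\<close> and at offset
      \<open>i\<close> otherwise, so each \<open>q i\<close> with \<open>i < m\<close> is increasing
      and stability compares \<open>v i\<close> with \<open>v 0\<close>.\<close>
    define q where "q i k = (k div 2) * (m + 2) + pos i (k div 2) + k mod 2" for i k :: nat
    have q_less: "q i k < q i l" if "i < m" "k < l" for i k l
    proof (cases "k div 2 = l div 2")
      case True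
      then have "k mod 2 < l mod 2"
        using that by (metis div_mult_mod_eq nat_add_left_cancel_less)
      then show ?thesis using True by (simp add: q_def)
    next
      case False
      then have "Suc (k div 2) \<le> l div 2" using that div_le_mono[of k l 2] by linarith
      then have "Suc (k div 2) * (m + 2) \<le> (l div 2) * (m + 2)" by (rule mult_right_mono) simp
      moreover have "pos i (k div 2) + k mod 2 < m + 2"
        using that mod_less_divisor[of 2 k] by (simp only: pos_def) (auto split: if_splits)
      ultimately show ?thesis by (simp add: q_def)
    qed
    have q: "incr_upto (2 * L) (q i)" if "i < m" for i
      using q_less[OF that] by (simp add: incr_upto_def)
    have \<alpha>: "\<forall>k<2 * L. \<bar>\<alpha> k\<bar> \<le> 1" using a by (auto simp: \<alpha>_def)
    define v where "v i = (\<Sum>j<L. a j *\<^sub>R D (pos i j) j)" for i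
    have vq: "(\<Sum>k<2 * L. \<alpha> k *\<^sub>R y (h (q i k))) = v i" for i
      by (simp add: sum_lessThan_double \<alpha>_def q_def v_def D_def scaleR_diff_right)
    have v0: "v 0 = (\<Sum>j<L. a j *\<^sub>R D 0 j)" by (simp add: v_def pos_def)
    have m0: "0 < m" by (simp add: m_def)
    have "norm (v i) \<le> norm (v 0) + 1 / 8" if "i < m" for i
      using st[rule_format, OF q[OF that] q[OF m0], of \<alpha>] \<alpha> by (simp only: vq)
    then have "norm (\<Sum>i<m. v i) \<le> (\<Sum>i<m. norm (v 0) + 1 / 8)" by (intro sum_norm_le) simp
    then have up: "norm (\<Sum>i<m. v i) \<le> real m * (norm (v 0) + 1 / 8)" by simp
    define T where "T = (\<Sum>j\<in>{..<L} - A. a j *\<^sub>R (y (h (j * (m + 2))) - y (h (j * (m + 2) + m))))"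
    have "(\<Sum>i<m. v i) = (\<Sum>j<L. a j *\<^sub>R (\<Sum>i<m. D (pos i j) j))"
      unfolding v_def by (subst sum.swap) (simp add: scaleR_sum_right)
    also have "\<dots> = (\<Sum>j\<in>A. a j *\<^sub>R (\<Sum>i<m. D (pos i j) j)) + (\<Sum>j\<in>{..<L} - A. a j *\<^sub>R (\<Sum>i<m. D (pos i j) j))"
      by (subst add.commute, rule sum.subset_diff[OF A]) simp
    also have "(\<Sum>j\<in>A. a j *\<^sub>R (\<Sum>i<m. D (pos i j) j)) = real m *\<^sub>R (\<Sum>j\<in>A. a j *\<^sub>R D 0 j)"
      by (simp add: pos_def sum_constant_scaleR scaleR_sum_right mult.commute)
    also have "(\<Sum>j\<in>{..<L} - A. a j *\<^sub>R (\<Sum>i<m. D (pos i j) j)) = T"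
    proof -
      have "(\<Sum>i<m. D i j) = y (h (j * (m + 2))) - y (h (j * (m + 2) + m))" for j
        using sum_lessThan_telescope'[of "\<lambda>i. y (h (j * (m + 2) + i))" m] by (simp add: D_def)
      then show ?thesis unfolding T_def by (intro sum.cong) (auto simp: pos_def)
    qed
    finally have "real m *\<^sub>R (\<Sum>j\<in>A. a j *\<^sub>R D 0 j) = (\<Sum>i<m. v i) - T" by simp
    then have "norm (real m *\<^sub>R (\<Sum>j\<in>A. a j *\<^sub>R D 0 j)) \<le> norm (\<Sum>i<m. v i) + norm T"
      by (simp only: norm_triangle_ineq4)
    moreover have "norm T \<le> (\<Sum>j\<in>{..<L} - A. 2)"
      unfolding T_def
    proof (rule sum_norm_le)
      fix j assume "j \<in> {..<L} - A"
      then have "\<bar>a j\<bar> * norm (y (h (j * (m + 2))) - y (h (j * (m + 2) + m))) \<le> 1 * 2"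
        using a norm_triangle_ineq4[of "y (h (j * (m + 2)))" "y (h (j * (m + 2) + m))"]
        y1 by (intro mult_mono) auto
      then show "norm (a j *\<^sub>R (y (h (j * (m + 2))) - y (h (j * (m + 2) + m)))) \<le> 2" by simp
    qed
    moreover have "(\<Sum>j\<in>{..<L} - A. 2 :: real) \<le> real m * (1 / 8)"
    proof -
      have "card ({..<L} - A) \<le> L" using card_mono[of "{..<L}" "{..<L} - A"] by simp
      then show ?thesis by (simp add: m_def)
    qed
    ultimately have "real m * norm (\<Sum>j\<in>A. a j *\<^sub>R D 0 j) \<le> real m * (norm (v 0) + 1 / 4)"
      using up by (simp add: algebra_simps)
    then show "norm (\<Sum>j\<in>A. a j *\<^sub>R D 0 j) \<le> norm (\<Sum>j<L. a j *\<^sub>R D 0 j) + 1 / 4"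
      using m0 by (simp add: v0)
  qed
qed

text \<open>Scale so that the largest coefficient has modulus 1. Suppressing all other coordinates
  shows that the norm is at least 1/2 - 1/4, so the additive error 1/4 is absorbed in the factor
  2.\<close>

lemma suppression:
  assumes "inf_dim TYPE('a::real_normed_vector)"
  shows "\<exists>z :: nat \<Rightarrow> 'a. (\<forall>j. norm (z j) \<le> 2 \<and> 1 / 2 \<le> norm (z j)) \<and>
    (\<forall>A a. A \<subseteq> {..<L} \<longrightarrow> norm (\<Sum>j\<in>A. a j *\<^sub>R z j) \<le> 2 * norm (\<Sum>j<L. a j *\<^sub>R z j))"
proof -
  obtain y :: "nat \<Rightarrow> 'a" where y: "\<forall>n. norm (y n) = 1" "\<forall>m n. m \<noteq> n \<longrightarrow> 1 / 2 \<le> norm (y m - y n)"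
    using separated_sequence[OF assms] by blast
  obtain z :: "nat \<Rightarrow> 'a" where z': "\<forall>j. norm (z j) \<le> 2 \<and> 1 / 2 \<le> norm (z j)"
    and sup': "\<forall>A a. A \<subseteq> {..<L} \<longrightarrow> (\<forall>j<L. \<bar>a j\<bar> \<le> 1) \<longrightarrow>
      norm (\<Sum>j\<in>A. a j *\<^sub>R z j) \<le> norm (\<Sum>j<L. a j *\<^sub>R z j) + 1 / 4"
    using suppression_bounded[of y L, OF y] by (elim exE conjE)
  have z: "norm (z j) \<le> 2" "1 / 2 \<le> norm (z j)" for j using z' by auto
  note sup = sup'[rule_format]
  have "norm (\<Sum>j\<in>A. a j *\<^sub>R z j) \<le> 2 * norm (\<Sum>j<L. a j *\<^sub>R z j)" if A: "A \<subseteq> {..<L}" for A a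
  proof (cases "\<forall>j<L. a j = 0")
    case True
    then have "(\<Sum>j\<in>A. a j *\<^sub>R z j) = 0" using A by (intro sum.neutral) auto
    then show ?thesis by simp
  next
    case False
    define M where "M = Max ((\<lambda>j. \<bar>a j\<bar>) ` {..<L})"
    have le: "\<bar>a j\<bar> \<le> M" if "j < L" for j unfolding M_def using that by (intro Max_ge) auto
    obtain k where k: "k < L" "a k \<noteq> 0" using False by blast
    have "M \<in> (\<lambda>j. \<bar>a j\<bar>) ` {..<L}" unfolding M_def using k by (intro Max_in) auto
    then obtain i where i: "i < L" "\<bar>a i\<bar> = M" by auto
    have M: "M > 0" using le[OF k(1)] k by linarith
    define b where "b j = a j / M" for j
    have b: "\<forall>j<L. \<bar>b j\<bar> \<le> 1" using le M by (simp add: b_def)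
    have "norm (\<Sum>j\<in>{i}. b j *\<^sub>R z j) \<le> norm (\<Sum>j<L. b j *\<^sub>R z j) + 1 / 4"
      using i b by (intro sup) auto
    moreover have "norm (\<Sum>j\<in>{i}. b j *\<^sub>R z j) = norm (z i)" using i M by (simp add: b_def)
    ultimately have "1 / 4 \<le> norm (\<Sum>j<L. b j *\<^sub>R z j)" using z(2)[of i] by linarith
    moreover have "norm (\<Sum>j\<in>A. b j *\<^sub>R z j) \<le> norm (\<Sum>j<L. b j *\<^sub>R z j) + 1 / 4"
      using A b by (intro sup) auto
    ultimately have "norm (\<Sum>j\<in>A. b j *\<^sub>R z j) \<le> 2 * norm (\<Sum>j<L. b j *\<^sub>R z j)" by linarith
    moreover have "(\<Sum>j\<in>S. a j *\<^sub>R z j) = M *\<^sub>R (\<Sum>j\<in>S. b j *\<^sub>R z j)" for S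
      using M by (simp add: b_def scaleR_sum_right)
    ultimately show ?thesis using M by simp
  qed
  with z' show ?thesis by (intro exI[of _ z]) simp
qed

text \<open>A sign change is a difference of two suppressions, which doubles the constant 2. Halving
  the vectors puts their norms between 1/4 and 1, and suppression to a single coordinate then gives
  the factor 8.\<close>

lemma unconditional_system:
  assumes "inf_dim TYPE('a::real_normed_vector)"
  shows "\<exists>e :: nat \<Rightarrow> 'a. unc_system 4 L e (4 * norm (\<Sum>j<L. e j)) \<and>
    (\<forall>b. \<forall>j<L. \<bar>b j\<bar> \<le> 8 * norm (\<Sum>j<L. b j *\<^sub>R e j))"
proof -
  obtain z :: "nat \<Rightarrow> 'a" where z': "\<forall>j. norm (z j) \<le> 2 \<and> 1 / 2 \<le> norm (z j)"
    and sup'': "\<forall>A a. A \<subseteq> {..<L} \<longrightarrow> norm (\<Sum>j\<in>A. a j *\<^sub>R z j) \<le> 2 * norm (\<Sum>j<L. a j *\<^sub>R z j)"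
    using suppression[OF assms, of L] by (elim exE conjE)
  have z: "norm (z j) \<le> 2" "1 / 2 \<le> norm (z j)" for j using z' by auto
  note sup = sup''[rule_format]
  define e where "e j = (1 / 2) *\<^sub>R z j" for j
  have half: "(\<Sum>j\<in>A. a j *\<^sub>R e j) = (1 / 2) *\<^sub>R (\<Sum>j\<in>A. a j *\<^sub>R z j)" for A and a :: "nat \<Rightarrow> real"
    by (simp add: e_def scaleR_sum_right)
  have sup': "norm (\<Sum>j\<in>A. a j *\<^sub>R e j) \<le> 2 * norm (\<Sum>j<L. a j *\<^sub>R e j)" if "A \<subseteq> {..<L}" for A a
    unfolding half using sup[OF that, of a] by simp
  show ?thesis
  proof (rule exI[of _ e], intro conjI allI impI)
    show "unc_system 4 L e (4 * norm (\<Sum>j<L. e j))"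
    proof (rule unc_system_of_signs)
      show "norm (e j) \<le> 1" for j using z(1)[of j] by (simp add: e_def)
      fix s b :: "nat \<Rightarrow> real" assume s: "\<forall>j<L. \<bar>s j\<bar> = 1"
      define A where "A = {j. j < L \<and> s j = 1}"
      define B where "B = {j. j < L \<and> s j = -1}"
      have AB: "{..<L} = A \<union> B" "A \<inter> B = {}" "finite A" "finite B" "A \<subseteq> {..<L}" "B \<subseteq> {..<L}"
        using s by (auto simp: A_def B_def abs_if split: if_splits)
      have "(\<Sum>j<L. (s j * b j) *\<^sub>R e j) = (\<Sum>j\<in>A. (s j * b j) *\<^sub>R e j) + (\<Sum>j\<in>B. (s j * b j) *\<^sub>R e j)"
        unfolding AB(1) using AB by (intro sum.union_disjoint) auto
      also have "\<dots> = (\<Sum>j\<in>A. b j *\<^sub>R e j) - (\<Sum>j\<in>B. b j *\<^sub>R e j)"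
        by (simp add: A_def B_def sum_negf)
      finally have "norm (\<Sum>j<L. (s j * b j) *\<^sub>R e j) \<le> norm (\<Sum>j\<in>A. b j *\<^sub>R e j) + norm (\<Sum>j\<in>B. b j *\<^sub>R e j)"
        by (simp only: norm_triangle_ineq4)
      then show "norm (\<Sum>j<L. (s j * b j) *\<^sub>R e j) \<le> 4 * norm (\<Sum>j<L. b j *\<^sub>R e j)"
        using sup'[OF AB(5), of b] sup'[OF AB(6), of b] by linarith
    qed simp
    show "\<bar>b j\<bar> \<le> 8 * norm (\<Sum>j<L. b j *\<^sub>R e j)" if "j < L" for b j
    proof -
      have "\<bar>b j\<bar> * (1 / 4) \<le> \<bar>b j\<bar> * norm (e j)"
        using z(2)[of j] by (intro mult_left_mono) (auto simp: e_def)
      also have "\<dots> \<le> 2 * norm (\<Sum>j<L. b j *\<^sub>R e j)"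
        using sup'[of "{j}" b] that by simp
      finally show ?thesis by simp
    qed
  qed
qed

text \<open>Euclidean space is mapped to the inner products with a 1/2-net of the sphere: for a unit
  vector all of them are at most 1 in modulus and one is at least 1/2. Together with the factor 8
  and the normalisation by \<open>\<Phi>\<close> this gives \<open>16 * \<Phi>\<close>.\<close>

lemma euclidean_in_cube_system:
  fixes e :: "nat \<Rightarrow> 'a::real_normed_vector"
  assumes \<Phi>: "\<Phi> > 0"
    and cube: "\<And>L. \<exists>e :: nat \<Rightarrow> 'a. (\<forall>t. (\<forall>j<L. \<bar>t j\<bar> \<le> 1) \<longrightarrow> norm (\<Sum>j<L. t j *\<^sub>R e j) \<le> \<Phi>) \<and>
      (\<forall>b. \<forall>j<L. \<bar>b j\<bar> \<le> 8 * norm (\<Sum>j<L. b j *\<^sub>R e j))"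
  shows "\<exists>f :: nat \<Rightarrow> 'a. \<forall>b. norm (\<Sum>i<n. b i *\<^sub>R f i) \<le> sqrt (\<Sum>i<n. (b i)\<^sup>2) \<and>
    sqrt (\<Sum>i<n. (b i)\<^sup>2) \<le> 16 * \<Phi> * norm (\<Sum>i<n. b i *\<^sub>R f i)"
proof -
  obtain N where N: "finite N" "N \<subseteq> Sph n" "\<And>x. x \<in> Sph n \<Longrightarrow> \<exists>s\<in>N. norm (x - s) \<le> 1 / 2"
    using sphere_net[of "1 / 2"] by (metis half_gt_zero zero_less_one)
  obtain xs where xs: "set xs = N" using finite_list[OF N(1)] by blast
  define L where "L = length xs"
  define s where "s j = xs ! j" for j
  have s1: "norm (s j) = 1" if "j < L" for j
    using that N(2) xs nth_mem[of j xs] by (auto simp: L_def s_def Sph_def)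
  obtain e :: "nat \<Rightarrow> 'a" where up: "\<And>t. (\<forall>j<L. \<bar>t j\<bar> \<le> 1) \<Longrightarrow> norm (\<Sum>j<L. t j *\<^sub>R e j) \<le> \<Phi>"
    and low: "\<And>b j. j < L \<Longrightarrow> \<bar>b j\<bar> \<le> 8 * norm (\<Sum>j<L. b j *\<^sub>R e j)"
    using cube[of L] by blast
  define f where "f i = (1 / \<Phi>) *\<^sub>R (\<Sum>j<L. inner (unit_l2 i) (s j) *\<^sub>R e j)" for i
  show ?thesis
  proof (rule exI[of _ f], rule allI)
    fix b :: "nat \<Rightarrow> real"
    define x where "x = (\<Sum>i<n. b i *\<^sub>R unit_l2 i)"
    define r where "r = sqrt (\<Sum>i<n. (b i)\<^sup>2)"
    have nx: "norm x = r" unfolding x_def r_def by (rule norm_unit_combination)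
    have eq: "(\<Sum>i<n. b i *\<^sub>R f i) = (1 / \<Phi>) *\<^sub>R (\<Sum>j<L. inner x (s j) *\<^sub>R e j)"
    proof -
      have "(\<Sum>i<n. b i *\<^sub>R f i) = (1 / \<Phi>) *\<^sub>R (\<Sum>i<n. \<Sum>j<L. (b i * inner (unit_l2 i) (s j)) *\<^sub>R e j)"
        by (simp add: f_def scaleR_sum_right mult_ac)
      also have "(\<Sum>i<n. \<Sum>j<L. (b i * inner (unit_l2 i) (s j)) *\<^sub>R e j) = (\<Sum>j<L. inner x (s j) *\<^sub>R e j)"
        by (subst sum.swap) (simp add: x_def inner_sum_left scaleR_sum_left)
      finally show ?thesis .
    qed
    have "norm (\<Sum>i<n. b i *\<^sub>R f i) \<le> r \<and> r \<le> 16 * \<Phi> * norm (\<Sum>i<n. b i *\<^sub>R f i)"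
    proof (cases "r = 0")
      case True
      then have "x = 0" using nx by simp
      then show ?thesis using True by (simp add: eq)
    next
      case False
      then have r: "r > 0" using nx norm_ge_zero[of x] by linarith
      define x' where "x' = (1 / r) *\<^sub>R x"
      have "x \<in> Efin n" unfolding x_def by (rule unit_combination_Efin)
      then have x': "x' \<in> Sph n" "norm x' = 1"
        using nx r by (auto simp: x'_def Sph_def intro: subspace_scale[OF Efin_subspace])
      define W where "W = (\<Sum>j<L. inner x' (s j) *\<^sub>R e j)"
      have W: "(\<Sum>j<L. inner x (s j) *\<^sub>R e j) = r *\<^sub>R W"
        using r by (simp add: W_def x'_def scaleR_sum_right)
      have nf: "norm (\<Sum>i<n. b i *\<^sub>R f i) = r * norm W / \<Phi>" using r \<Phi> by (simp add: eq W)
      have "norm W \<le> \<Phi>"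
        unfolding W_def
      proof (rule up, intro allI impI)
        fix j assume "j < L"
        then show "\<bar>inner x' (s j)\<bar> \<le> 1"
          using Cauchy_Schwarz_ineq2[of x' "s j"] x' s1 by simp
      qed
      moreover have "1 / 2 \<le> 8 * norm W"
      proof -
        obtain u where u: "u \<in> N" "norm (x' - u) \<le> 1 / 2" using N(3)[OF x'(1)] by blast
        then obtain j where j: "j < L" "u = s j" using xs by (auto simp: in_set_conv_nth L_def s_def)
        have "inner x' u = inner x' x' - inner x' (x' - u)" by (simp add: inner_diff_right)
        moreover have "inner x' (x' - u) \<le> norm x' * norm (x' - u)" by (rule norm_cauchy_schwarz)
        moreover have "inner x' x' = 1" using x' by (simp add: norm_eq_1)
        ultimately have "1 / 2 \<le> inner x' (s j)" using u x' j by simp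
        then show ?thesis using low[OF j(1), of "\<lambda>j. inner x' (s j)"] by (simp add: W_def)
      qed
      ultimately show ?thesis using r \<Phi> by (simp add: nf field_simps)
    qed
    then show "norm (\<Sum>i<n. b i *\<^sub>R f i) \<le> sqrt (\<Sum>i<n. (b i)\<^sup>2) \<and>
      sqrt (\<Sum>i<n. (b i)\<^sup>2) \<le> 16 * \<Phi> * norm (\<Sum>i<n. b i *\<^sub>R f i)"
      by (simp add: r_def)
  qed
qed

theorem Dvoretzky:
  assumes inf: "inf_dim TYPE('a::real_normed_vector)" and n: "n > 0" and \<epsilon>: "0 < \<epsilon>" "\<epsilon> \<le> 1"
  shows "\<exists>u :: nat \<Rightarrow> 'a. almost_euclidean n \<epsilon> u"
proof -
  obtain \<Phi> where \<Phi>: "\<Phi> > 0" and conc: "\<And>L (e :: nat \<Rightarrow> 'a) \<phi>.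
      unc_system 4 L e \<phi> \<Longrightarrow> \<Phi> \<le> \<phi> \<Longrightarrow> (\<exists>u :: nat \<Rightarrow> 'a. almost_euclidean n \<epsilon> u)"
    using concentration[OF n _ \<epsilon>, of 4, where 'a = 'a] by auto
  show ?thesis
  proof (cases "\<exists>L (e :: nat \<Rightarrow> 'a) \<phi>. unc_system 4 L e \<phi> \<and> \<Phi> \<le> \<phi>")
    case True
    then show ?thesis using conc by blast
  next
    case False
    have "\<exists>e :: nat \<Rightarrow> 'a. (\<forall>t. (\<forall>j<L. \<bar>t j\<bar> \<le> 1) \<longrightarrow> norm (\<Sum>j<L. t j *\<^sub>R e j) \<le> \<Phi>) \<and>
      (\<forall>b. \<forall>j<L. \<bar>b j\<bar> \<le> 8 * norm (\<Sum>j<L. b j *\<^sub>R e j))" for L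
    proof -
      obtain e :: "nat \<Rightarrow> 'a" where e: "unc_system 4 L e (4 * norm (\<Sum>j<L. e j))"
        "\<forall>b. \<forall>j<L. \<bar>b j\<bar> \<le> 8 * norm (\<Sum>j<L. b j *\<^sub>R e j)"
        using unconditional_system[OF inf, of L] by (elim exE conjE)
      then have "4 * norm (\<Sum>j<L. e j) < \<Phi>" using False by force
      moreover have "\<forall>t. (\<forall>j<L. \<bar>t j\<bar> \<le> 1) \<longrightarrow> norm (\<Sum>j<L. t j *\<^sub>R e j) \<le> 4 * norm (\<Sum>j<L. e j)"
        using e(1) by (simp add: unc_system_def)
      ultimately show ?thesis using e(2) by (intro exI[of _ e]) force
    qed
    note eucl = euclidean_in_cube_system[OF \<Phi> this]
    define C where "C = max 1 (16 * \<Phi>)"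
    have C: "C \<ge> 1" "16 * \<Phi> \<le> C" by (auto simp: C_def)
    obtain \<Phi>' where \<Phi>': "\<Phi>' > 0" and conc': "\<And>L (e :: nat \<Rightarrow> 'a) \<phi>.
        unc_system C L e \<phi> \<Longrightarrow> \<Phi>' \<le> \<phi> \<Longrightarrow> (\<exists>u :: nat \<Rightarrow> 'a. almost_euclidean n \<epsilon> u)"
      using concentration[OF n C(1) \<epsilon>, where 'a = 'a] by auto
    \<comment> \<open>The sum of \<open>k\<close> vectors of such a system has norm at least
      \<open>sqrt k / C\<close>, so this length carries the system past the new threshold.\<close>
    obtain k :: nat where k: "\<Phi>'\<^sup>2 \<le> real k" using real_arch_simple by blast
    obtain f :: "nat \<Rightarrow> 'a" where f: "\<And>b. norm (\<Sum>i<k. b i *\<^sub>R f i) \<le> sqrt (\<Sum>i<k. (b i)\<^sup>2)"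
      "\<And>b. sqrt (\<Sum>i<k. (b i)\<^sup>2) \<le> 16 * \<Phi> * norm (\<Sum>i<k. b i *\<^sub>R f i)"
      using eucl[of k] by blast
    have fC: "sqrt (\<Sum>i<k. (b i)\<^sup>2) \<le> C * norm (\<Sum>i<k. b i *\<^sub>R f i)" for b
      using f(2)[of b] mult_right_mono[OF C(2) norm_ge_zero[of "\<Sum>i<k. b i *\<^sub>R f i"]] by linarith
    have "unc_system C k f (C * norm (\<Sum>j<k. f j))"
    proof (rule unc_system_of_signs[OF _ C(1)])
      fix j assume "j < k"
      then have "norm (\<Sum>i<k. (if i = j then 1 else 0) *\<^sub>R f i) = norm (f j)"
        by (simp add: if_distrib[of "\<lambda>c. c *\<^sub>R _"] cong: if_cong)
      moreover have "(\<Sum>i<k. (if i = j then 1 else 0 :: real)\<^sup>2) = 1"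
        using \<open>j < k\<close> by (simp add: if_distrib[of "\<lambda>c. c\<^sup>2"] cong: if_cong)
      ultimately show "norm (f j) \<le> 1" using f(1)[of "\<lambda>i. if i = j then 1 else 0"] by simp
    next
      fix s b :: "nat \<Rightarrow> real" assume s: "\<forall>j<k. \<bar>s j\<bar> = 1"
      have "(s j)\<^sup>2 = 1" if "j < k" for j using s that by (metis power2_abs power_one)
      then have "(\<Sum>j<k. (s j * b j)\<^sup>2) = (\<Sum>j<k. (b j)\<^sup>2)"
        by (intro sum.cong) (auto simp: power_mult_distrib)
      then show "norm (\<Sum>j<k. (s j * b j) *\<^sub>R f j) \<le> C * norm (\<Sum>j<k. b j *\<^sub>R f j)"
        using f(1)[of "\<lambda>j. s j * b j"] fC[of b] by simp
    qed
    moreover have "\<Phi>' \<le> C * norm (\<Sum>j<k. f j)"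
    proof -
      have "\<Phi>' \<le> sqrt (real k)" using k by (rule real_le_rsqrt)
      then show ?thesis using fC[of "\<lambda>_. 1"] by simp
    qed
    ultimately show ?thesis by (rule conc')
  qed
qed

section \<open>Extension of pseudonorms to real sequences\<close>

abbreviation lookup :: "('k \<Rightarrow>\<^sub>0 'c::zero) \<Rightarrow> 'k \<Rightarrow> 'c" where "lookup \<equiv> Poly_Mapping.lookup"

text \<open>With this instance the scaling of \<open>c00_space\<close> becomes
  \<open>scaleR\<close>, and linear maps and spans apply to \<open>c00\<close>.\<close>

instantiation poly_mapping :: (type, real_vector) real_vector
begin

lift_definition scaleR_poly_mapping :: "real \<Rightarrow> ('a \<Rightarrow>\<^sub>0 'b) \<Rightarrow> 'a \<Rightarrow>\<^sub>0 'b" is "\<lambda>r f k. r *\<^sub>R f k"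
  by (rule finite_subset[rotated]) auto

instance
  by standard (transfer; simp add: fun_eq_iff scaleR_add_right scaleR_add_left)+

end

lemma lookup_scaleR [simp]: "lookup (r *\<^sub>R x) k = r *\<^sub>R lookup x k"
  by transfer simp

lemma map_times_eq_scaleR: "Poly_Mapping.map ((*) r) (x :: c00) = r *\<^sub>R x"
  by (rule poly_mapping_eqI) (simp add: Poly_Mapping.map.rep_eq when_def)

definition emb :: "V \<Rightarrow> c00" where "emb v = Poly_Mapping.map of_rat v"

lemma lookup_emb [simp]: "lookup (emb v) k = of_rat (lookup v k)"
  by (simp add: emb_def Poly_Mapping.map.rep_eq when_def)

abbreviation bas :: "nat \<Rightarrow> c00" where "bas i \<equiv> Poly_Mapping.single i 1"

abbreviation qscale :: "rat \<Rightarrow> V \<Rightarrow> V" where "qscale q \<equiv> Poly_Mapping.map ((*) q)"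

lemma lookup_qscale [simp]: "lookup (qscale q v) k = q * lookup v k"
  by (simp add: Poly_Mapping.map.rep_eq when_def)

lemma emb_simps [simp]:
  "emb 0 = 0" "emb (v + w) = emb v + emb w" "emb (v - w) = emb v - emb w" "emb (- v) = - emb v"
  "emb (qscale q v) = of_rat q *\<^sub>R emb v" "emb (Poly_Mapping.single i q) = of_rat q *\<^sub>R bas i"
  by (rule poly_mapping_eqI,
      simp add: lookup_add lookup_minus of_rat_add of_rat_diff of_rat_minus of_rat_mult lookup_single when_def)+

lemma emb_sum: "emb (sum f A) = (\<Sum>i\<in>A. emb (f i))"
  by (induction A rule: infinite_finite_induct) auto

lemma c00_expand:
  assumes "finite A" "Poly_Mapping.keys x \<subseteq> A"
  shows "(\<Sum>i\<in>A. lookup x i *\<^sub>R bas i) = (x :: c00)"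
proof (rule poly_mapping_eqI)
  fix k
  have "lookup (\<Sum>i\<in>A. lookup x i *\<^sub>R bas i) k = (\<Sum>i\<in>A. if i = k then lookup x i else 0)"
    by (auto simp: lookup_sum lookup_single when_def intro!: sum.cong)
  also have "\<dots> = lookup x k" using assms by (auto simp: in_keys_iff)
  finally show "lookup (\<Sum>i\<in>A. lookup x i *\<^sub>R bas i) k = lookup x k" .
qed

lemma V_expand: "(\<Sum>i\<in>Poly_Mapping.keys v. Poly_Mapping.single i (lookup v i)) = (v :: V)"
proof (rule poly_mapping_eqI)
  fix k
  have "lookup (\<Sum>i\<in>Poly_Mapping.keys v. Poly_Mapping.single i (lookup v i)) k
      = (\<Sum>i\<in>Poly_Mapping.keys v. if i = k then lookup v i else 0)"
    by (auto simp: lookup_sum lookup_single when_def intro!: sum.cong)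
  also have "\<dots> = lookup v k" by (auto simp: in_keys_iff)
  finally show "lookup (\<Sum>i\<in>Poly_Mapping.keys v. Poly_Mapping.single i (lookup v i)) k = lookup v k" .
qed

locale seminorm =
  fixes \<nu> :: "'v::real_vector \<Rightarrow> real"
  assumes triangle: "\<nu> (x + y) \<le> \<nu> x + \<nu> y" and scale: "\<nu> (r *\<^sub>R x) = \<bar>r\<bar> * \<nu> x"
begin

lemma zero [simp]: "\<nu> 0 = 0"
  using scale[of 0 0] by simp

lemma minus [simp]: "\<nu> (- x) = \<nu> x"
  using scale[of "-1" x] by simp

lemma nonneg [simp]: "0 \<le> \<nu> x"
  using triangle[of x "- x"] by simp

lemma diff_commute: "\<nu> (x - y) = \<nu> (y - x)"
  using minus[of "x - y"] by simp

lemma triangle_diff: "\<nu> x \<le> \<nu> y + \<nu> (x - y)"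
  using triangle[of y "x - y"] by simp

lemma abs_diff_le: "\<bar>\<nu> x - \<nu> y\<bar> \<le> \<nu> (x - y)"
  using triangle_diff[of x y] triangle_diff[of y x] by (simp add: diff_commute)

lemma sum_le: "\<nu> (\<Sum>i\<in>A. f i) \<le> (\<Sum>i\<in>A. \<nu> (f i))"
proof (induction A rule: infinite_finite_induct)
  case (insert i A)
  then show ?case using triangle[of "f i" "sum f A"] by simp
qed auto

end

lemma pseudonorm_c00_iff: "pseudonorm_c00 \<nu> \<longleftrightarrow> seminorm \<nu>"
  by (auto simp: pseudonorm_c00_def seminorm_def map_times_eq_scaleR)

lemma seminorm_add: "seminorm \<mu> \<Longrightarrow> seminorm \<nu> \<Longrightarrow> seminorm (\<lambda>x. \<mu> x + \<nu> x)"
  by (auto simp: seminorm_def algebra_simps intro: add_mono order_trans) (smt (verit))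

text \<open>The error lives on the finite support of \<open>x\<close>, where \<open>\<nu>\<close> is
  dominated by a weighted sum of the absolute coordinates.\<close>

lemma rational_approximation:
  fixes \<nu> :: "c00 \<Rightarrow> real"
  assumes "seminorm \<nu>" "\<epsilon> > 0"
  shows "\<exists>v. \<nu> (x - emb v) < \<epsilon>"
proof -
  interpret seminorm \<nu> by (rule assms)
  let ?K = "Poly_Mapping.keys x"
  define \<delta> where "\<delta> = \<epsilon> / ((\<Sum>i\<in>?K. \<nu> (bas i)) + 1)"
  have s: "0 \<le> (\<Sum>i\<in>?K. \<nu> (bas i))" by (intro sum_nonneg) simp
  then have \<delta>: "\<delta> > 0" using assms(2) by (simp add: \<delta>_def)
  have "\<exists>q. \<bar>lookup x i - of_rat q\<bar> < \<delta>" for i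
    using of_rat_dense[of "lookup x i - \<delta>" "lookup x i + \<delta>"] \<delta> by (auto simp: abs_less_iff) (smt (verit))
  then obtain q where q: "\<And>i. \<bar>lookup x i - of_rat (q i)\<bar> < \<delta>" by metis
  define v where "v = (\<Sum>i\<in>?K. Poly_Mapping.single i (q i))"
  have "x - emb v = (\<Sum>i\<in>?K. lookup x i *\<^sub>R bas i) - (\<Sum>i\<in>?K. of_rat (q i) *\<^sub>R bas i)"
    by (simp add: c00_expand v_def emb_sum)
  also have "\<dots> = (\<Sum>i\<in>?K. (lookup x i - of_rat (q i)) *\<^sub>R bas i)"
    by (simp add: scaleR_diff_left sum_subtractf)
  finally have "\<nu> (x - emb v) \<le> (\<Sum>i\<in>?K. \<nu> ((lookup x i - of_rat (q i)) *\<^sub>R bas i))"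
    by (simp only: sum_le)
  also have "\<dots> \<le> (\<Sum>i\<in>?K. \<delta> * \<nu> (bas i))"
    by (intro sum_mono) (simp add: scale mult_right_mono less_imp_le[OF q])
  also have "\<dots> = \<delta> * (\<Sum>i\<in>?K. \<nu> (bas i))" by (simp add: sum_distrib_left)
  also have "\<dots> < \<epsilon>" using s assms(2) by (simp add: \<delta>_def field_simps)
  finally show ?thesis by blast
qed

lemma seminorm_unique:
  fixes \<mu> \<nu> :: "c00 \<Rightarrow> real"
  assumes "seminorm \<mu>" "seminorm \<nu>" "\<And>v. \<mu> (emb v) = \<nu> (emb v)"
  shows "\<mu> = \<nu>"
proof
  fix x
  have "\<bar>\<mu> x - \<nu> x\<bar> \<le> \<epsilon>" if \<epsilon>: "\<epsilon> > 0" for \<epsilon>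
  proof -
    \<comment> \<open>A single \<open>v\<close> that is close to \<open>x\<close> in the sum of the
      two seminorms serves both.\<close>
    obtain v where "\<mu> (x - emb v) + \<nu> (x - emb v) < \<epsilon>"
      using rational_approximation[OF seminorm_add[OF assms(1,2)] \<epsilon>] by blast
    then show ?thesis
      using seminorm.abs_diff_le[OF assms(1), of x "emb v"] seminorm.abs_diff_le[OF assms(2), of x "emb v"]
        assms(3)[of v] by linarith
  qed
  then have "\<bar>\<mu> x - \<nu> x\<bar> \<le> 0" by (rule field_le_epsilon[of _ 0, simplified])
  then show "\<mu> x = \<nu> x" by simp
qed

context
  fixes \<mu> :: "V \<Rightarrow> real"
  assumes \<mu>: "\<mu> \<in> pseudonorms"
begin

lemma pn_triangle: "\<mu> (v + w) \<le> \<mu> v + \<mu> w" and pn_scale: "\<mu> (qscale q v) = \<bar>of_rat q\<bar> * \<mu> v"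
  using \<mu> by (auto simp: pseudonorms_def)

lemma pn_minus: "\<mu> (- v) = \<mu> v"
proof -
  have "qscale (-1) v = - v" by (rule poly_mapping_eqI) simp
  then show ?thesis using pn_scale[of "-1" v] by (simp add: of_rat_minus)
qed

lemma pn_zero: "\<mu> 0 = 0"
proof -
  have "qscale 0 0 = 0" by (rule poly_mapping_eqI) simp
  then show ?thesis using pn_scale[of 0 0] by simp
qed

lemma pn_nonneg: "0 \<le> \<mu> v"
  using pn_triangle[of v "- v"] by (simp add: pn_minus pn_zero)

text \<open>The largest seminorm on \<open>c00\<close> that has the values of \<open>\<mu>\<close>
  on the basis vectors.\<close>

definition ell1 :: "c00 \<Rightarrow> real" where
  "ell1 x = (\<Sum>i\<in>Poly_Mapping.keys x. \<bar>lookup x i\<bar> * \<mu> (Poly_Mapping.single i 1))"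

lemma ell1_superset:
  assumes "finite A" "Poly_Mapping.keys x \<subseteq> A"
  shows "ell1 x = (\<Sum>i\<in>A. \<bar>lookup x i\<bar> * \<mu> (Poly_Mapping.single i 1))"
  unfolding ell1_def using assms by (intro sum.mono_neutral_left) (auto simp: in_keys_iff)

lemma seminorm_ell1: "seminorm ell1"
proof
  fix x y :: c00 and r :: real
  let ?A = "Poly_Mapping.keys x \<union> Poly_Mapping.keys y"
  have "ell1 (x + y) = (\<Sum>i\<in>?A. \<bar>lookup (x + y) i\<bar> * \<mu> (Poly_Mapping.single i 1))"
    by (intro ell1_superset) (use Poly_Mapping.keys_add[of x y] in auto)
  also have "\<dots> \<le> (\<Sum>i\<in>?A. \<bar>lookup x i\<bar> * \<mu> (Poly_Mapping.single i 1) + \<bar>lookup y i\<bar> * \<mu> (Poly_Mapping.single i 1))"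
    by (intro sum_mono)
      (auto simp: lookup_add pn_nonneg simp flip: distrib_right intro!: mult_right_mono)
  also have "\<dots> = ell1 x + ell1 y"
    by (simp add: sum.distrib ell1_superset[of ?A])
  finally show "ell1 (x + y) \<le> ell1 x + ell1 y" .
  have "ell1 (r *\<^sub>R x) = (\<Sum>i\<in>Poly_Mapping.keys x. \<bar>lookup (r *\<^sub>R x) i\<bar> * \<mu> (Poly_Mapping.single i 1))"
    by (intro ell1_superset) (auto simp: in_keys_iff)
  then show "ell1 (r *\<^sub>R x) = \<bar>r\<bar> * ell1 x"
    by (simp add: ell1_def abs_mult sum_distrib_left mult.assoc)
qed

lemma pn_le_ell1: "\<mu> v \<le> ell1 (emb v)"
proof -
  have sum: "\<mu> (sum f A) \<le> (\<Sum>i\<in>A. \<mu> (f i))" for f :: "nat \<Rightarrow> V" and A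
  proof (induction A rule: infinite_finite_induct)
    case (insert i A)
    then show ?case using pn_triangle[of "f i" "sum f A"] by simp
  qed (auto simp: pn_zero)
  have single: "\<mu> (Poly_Mapping.single i q) = \<bar>of_rat q\<bar> * \<mu> (Poly_Mapping.single i 1)" for i q
    using pn_scale[of q "Poly_Mapping.single i 1"] by (simp add: map_single)
  have "\<mu> v = \<mu> (\<Sum>i\<in>Poly_Mapping.keys v. Poly_Mapping.single i (lookup v i))" by (simp only: V_expand)
  also have "\<dots> \<le> (\<Sum>i\<in>Poly_Mapping.keys v. \<bar>of_rat (lookup v i)\<bar> * \<mu> (Poly_Mapping.single i 1))"
    by (rule order_trans[OF sum]) (subst single, rule order_refl)
  also have "\<dots> = ell1 (emb v)"
    by (subst ell1_superset[of "Poly_Mapping.keys v"]) (auto simp: in_keys_iff)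
  finally show ?thesis .
qed

text \<open>Inf-convolution with the seminorm \<open>ell1\<close> leaves \<open>\<mu>\<close> unchanged on rational vectors because \<open>ell1\<close>
  dominates \<open>\<mu>\<close> there.\<close>
definition infconv :: "c00 \<Rightarrow> real" where
  "infconv x = (INF v. \<mu> v + ell1 (x - emb v))"

lemma infconv_le: "infconv x \<le> \<mu> v + ell1 (x - emb v)"
  unfolding infconv_def
  by (rule cINF_lower) (auto intro!: bdd_belowI[of _ 0] add_nonneg_nonneg pn_nonneg seminorm.nonneg[OF seminorm_ell1])

lemma infconv_greatest: "(\<And>v. c \<le> \<mu> v + ell1 (x - emb v)) \<Longrightarrow> c \<le> infconv x"
  unfolding infconv_def by (rule cINF_greatest) auto

lemma infconv_emb: "infconv (emb v) = \<mu> v"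
proof (rule antisym)
  show "infconv (emb v) \<le> \<mu> v" using infconv_le[of "emb v" v] by (simp add: seminorm.zero[OF seminorm_ell1])
  show "\<mu> v \<le> infconv (emb v)"
  proof (rule infconv_greatest)
    fix w show "\<mu> v \<le> \<mu> w + ell1 (emb v - emb w)"
      using pn_triangle[of w "v - w"] pn_le_ell1[of "v - w"] by simp
  qed
qed

lemma infconv_lipschitz: "infconv x \<le> infconv y + ell1 (x - y)"
proof -
  have "infconv x - ell1 (x - y) \<le> infconv y"
  proof (rule infconv_greatest)
    fix v show "infconv x - ell1 (x - y) \<le> \<mu> v + ell1 (y - emb v)"
      using infconv_le[of x v] seminorm.triangle[OF seminorm_ell1, of "x - y" "y - emb v"] by simp
  qed
  then show ?thesis by simp
qed

lemma infconv_qscale_le: "infconv (of_rat q *\<^sub>R x) \<le> \<bar>of_rat q\<bar> * infconv x"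
proof (cases "q = 0")
  case True
  then show ?thesis using infconv_emb[of 0] by (simp add: pn_zero)
next
  case False
  have "infconv (of_rat q *\<^sub>R x) / \<bar>of_rat q\<bar> \<le> infconv x"
  proof (rule infconv_greatest)
    fix v
    have "infconv (of_rat q *\<^sub>R x) \<le> \<mu> (qscale q v) + ell1 (of_rat q *\<^sub>R (x - emb v))"
      using infconv_le[of "of_rat q *\<^sub>R x" "qscale q v"] by (simp add: scaleR_diff_right)
    also have "\<dots> = \<bar>of_rat q\<bar> * (\<mu> v + ell1 (x - emb v))"
      by (simp only: pn_scale seminorm.scale[OF seminorm_ell1] distrib_left)
    finally show "infconv (of_rat q *\<^sub>R x) / \<bar>of_rat q\<bar> \<le> \<mu> v + ell1 (x - emb v)"
      using False by (simp add: field_simps)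
  qed
  then show ?thesis using False by (simp add: field_simps)
qed

lemma infconv_qscale: "infconv (of_rat q *\<^sub>R x) = \<bar>of_rat q\<bar> * infconv x"
proof (cases "q = 0")
  case True
  then show ?thesis using infconv_emb[of 0] by (simp add: pn_zero)
next
  case False
  have "infconv x \<le> \<bar>of_rat (1 / q)\<bar> * infconv (of_rat q *\<^sub>R x)"
    using infconv_qscale_le[of "1 / q" "of_rat q *\<^sub>R x"] False by (simp add: of_rat_divide)
  then have "\<bar>of_rat q\<bar> * infconv x \<le> infconv (of_rat q *\<^sub>R x)"
    using False by (simp add: of_rat_divide field_simps)
  then show ?thesis using infconv_qscale_le[of q x] by simp
qed

text \<open>Homogeneity is known for rational factors, and the Lipschitz bound with respect to
  \<open>ell1\<close> carries it over to real ones.\<close>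

lemma seminorm_infconv: "seminorm infconv"
proof
  fix x y :: c00 and r :: real
  have "infconv (x + y) - infconv y \<le> infconv x"
  proof (rule infconv_greatest)
    fix v
    have "infconv (x + y) - (\<mu> v + ell1 (x - emb v)) \<le> infconv y"
    proof (rule infconv_greatest)
      fix w show "infconv (x + y) - (\<mu> v + ell1 (x - emb v)) \<le> \<mu> w + ell1 (y - emb w)"
        using infconv_le[of "x + y" "v + w"] pn_triangle[of v w]
          seminorm.triangle[OF seminorm_ell1, of "x - emb v" "y - emb w"] by (simp add: add_diff_add)
    qed
    then show "infconv (x + y) - infconv y \<le> \<mu> v + ell1 (x - emb v)" by simp
  qed
  then show "infconv (x + y) \<le> infconv x + infconv y" by simp
  have nn: "0 \<le> infconv x" "0 \<le> ell1 x"
    by (auto intro!: infconv_greatest add_nonneg_nonneg pn_nonneg seminorm.nonneg[OF seminorm_ell1])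
  have "\<bar>infconv (r *\<^sub>R x) - \<bar>r\<bar> * infconv x\<bar> \<le> \<epsilon>" if \<epsilon>: "\<epsilon> > 0" for \<epsilon>
  proof -
    define \<delta> where "\<delta> = \<epsilon> / (ell1 x + infconv x + 1)"
    have \<delta>: "\<delta> > 0" using \<epsilon> nn by (simp add: \<delta>_def)
    obtain q where q: "r < of_rat q" "of_rat q < r + \<delta>" using of_rat_dense[of r "r + \<delta>"] \<delta> by auto
    define s :: real where "s = of_rat q"
    have s: "\<bar>r - s\<bar> \<le> \<delta>" using q by (simp add: s_def)
    have "ell1 (r *\<^sub>R x - s *\<^sub>R x) = \<bar>r - s\<bar> * ell1 x"
      by (simp only: seminorm.scale[OF seminorm_ell1] flip: scaleR_diff_left)
    moreover have "ell1 (s *\<^sub>R x - r *\<^sub>R x) = \<bar>r - s\<bar> * ell1 x"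
      by (simp only: seminorm.scale[OF seminorm_ell1] abs_minus_commute flip: scaleR_diff_left)
    ultimately have "\<bar>infconv (r *\<^sub>R x) - infconv (s *\<^sub>R x)\<bar> \<le> \<bar>r - s\<bar> * ell1 x"
      using infconv_lipschitz[of "r *\<^sub>R x" "s *\<^sub>R x"] infconv_lipschitz[of "s *\<^sub>R x" "r *\<^sub>R x"] by linarith
    moreover have "\<bar>\<bar>s\<bar> * infconv x - \<bar>r\<bar> * infconv x\<bar> \<le> \<bar>r - s\<bar> * infconv x"
    proof -
      have "\<bar>\<bar>s\<bar> * infconv x - \<bar>r\<bar> * infconv x\<bar> = \<bar>\<bar>s\<bar> - \<bar>r\<bar>\<bar> * infconv x"
        using nn by (simp add: abs_mult flip: left_diff_distrib)
      also have "\<dots> \<le> \<bar>r - s\<bar> * infconv x" using nn by (intro mult_right_mono) auto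
      finally show ?thesis .
    qed
    moreover have "infconv (s *\<^sub>R x) = \<bar>s\<bar> * infconv x" unfolding s_def by (rule infconv_qscale)
    ultimately have "\<bar>infconv (r *\<^sub>R x) - \<bar>r\<bar> * infconv x\<bar> \<le> \<bar>r - s\<bar> * (ell1 x + infconv x)"
      unfolding distrib_left by linarith
    also have "\<dots> \<le> \<delta> * (ell1 x + infconv x)" using s nn by (intro mult_right_mono) auto
    also have "\<dots> \<le> \<epsilon>" using nn \<epsilon> by (simp add: \<delta>_def field_simps)
    finally show ?thesis .
  qed
  then have "\<bar>infconv (r *\<^sub>R x) - \<bar>r\<bar> * infconv x\<bar> \<le> 0" by (rule field_le_epsilon[of _ 0, simplified])
  then show "infconv (r *\<^sub>R x) = \<bar>r\<bar> * infconv x" by simp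
qed

text \<open>The uniqueness half of the extension theorem; with \<open>infconv\<close> as the
  existence half it determines the definite description in \<open>ext\<close>.\<close>

lemma ext_eqI:
  assumes "seminorm \<nu>" "\<And>v. \<nu> (emb v) = \<mu> v"
  shows "ext \<mu> = \<nu>"
  unfolding ext_def
proof (rule the_equality)
  show "pseudonorm_c00 \<nu> \<and> (\<forall>v. \<nu> (Poly_Mapping.map of_rat v) = \<mu> v)"
    using assms by (simp add: pseudonorm_c00_iff emb_def)
  show "\<nu>' = \<nu>" if "pseudonorm_c00 \<nu>' \<and> (\<forall>v. \<nu>' (Poly_Mapping.map of_rat v) = \<mu> v)" for \<nu>'
    using that assms by (intro seminorm_unique) (auto simp: pseudonorm_c00_iff emb_def)
qed

lemma seminorm_ext: "seminorm (ext \<mu>)" and ext_emb: "ext \<mu> (emb v) = \<mu> v"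
  using ext_eqI[OF seminorm_infconv infconv_emb] seminorm_infconv infconv_emb by simp_all

end

lemma pseudonorm_of_seminorm:
  assumes "seminorm \<nu>"
  shows "(\<lambda>v. \<nu> (emb v)) \<in> pseudonorms" "ext (\<lambda>v. \<nu> (emb v)) = \<nu>"
proof -
  show *: "(\<lambda>v. \<nu> (emb v)) \<in> pseudonorms"
    by (auto simp: pseudonorms_def seminorm.scale[OF assms] seminorm.triangle[OF assms])
  show "ext (\<lambda>v. \<nu> (emb v)) = \<nu>" by (rule ext_eqI[OF * assms]) simp
qed

section \<open>Quotients and completions of pseudonormed spaces\<close>

text \<open>The properties of \<^const>\<open>ndist\<close> and \<^const>\<open>nnorm\<close> that are inherited by
  \<^const>\<open>kernel_quotient\<close> and \<^const>\<open>cauchy_space\<close>.\<close>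
locale pnspace =
  fixes S :: "'p nspace" 
  assumes add_closed: "\<lbrakk>x \<in> points S; y \<in> points S\<rbrakk> \<Longrightarrow> nadd S x y \<in> points S"
    and scale_closed: "x \<in> points S \<Longrightarrow> nscale S r x \<in> points S"
    and ndist_refl: "x \<in> points S \<Longrightarrow> ndist S x x = 0"
    and ndist_sym: "\<lbrakk>x \<in> points S; y \<in> points S\<rbrakk> \<Longrightarrow> ndist S x y = ndist S y x"
    and ndist_triangle: "\<lbrakk>x \<in> points S; y \<in> points S; z \<in> points S\<rbrakk> \<Longrightarrow>
      ndist S x z \<le> ndist S x y + ndist S y z"
    and ndist_add: "\<lbrakk>x \<in> points S; y \<in> points S; x' \<in> points S; y' \<in> points S\<rbrakk> \<Longrightarrow>
      ndist S (nadd S x y) (nadd S x' y') \<le> ndist S x x' + ndist S y y'"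
    and ndist_scale: "\<lbrakk>x \<in> points S; y \<in> points S\<rbrakk> \<Longrightarrow>
      ndist S (nscale S r x) (nscale S r y) = \<bar>r\<bar> * ndist S x y"
    and nnorm_lipschitz: "\<lbrakk>x \<in> points S; y \<in> points S\<rbrakk> \<Longrightarrow> \<bar>nnorm S x - nnorm S y\<bar> \<le> ndist S x y"
begin

lemma ndist_nonneg: "\<lbrakk>x \<in> points S; y \<in> points S\<rbrakk> \<Longrightarrow> 0 \<le> ndist S x y"
  using nnorm_lipschitz[of x y] by simp

definition cls :: "'p \<Rightarrow> 'p set" where "cls x = kernel_rel S `` {x}"

lemma in_cls: "x \<in> points S \<Longrightarrow> y \<in> cls x \<longleftrightarrow> y \<in> points S \<and> ndist S x y = 0"
  by (simp add: cls_def kernel_rel_def)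

lemma cls_self: "x \<in> points S \<Longrightarrow> x \<in> cls x"
  by (simp add: in_cls ndist_refl)

lemma cls_eq:
  assumes x: "x \<in> points S" and y: "y \<in> points S"
  shows "cls x = cls y \<longleftrightarrow> ndist S x y = 0"
proof
  assume "cls x = cls y"
  then show "ndist S x y = 0" using cls_self[OF y] in_cls[OF x] by blast
next
  assume 0: "ndist S x y = 0"
  have "ndist S x z = 0 \<longleftrightarrow> ndist S y z = 0" if z: "z \<in> points S" for z
    using ndist_triangle[OF x y z] ndist_triangle[OF y x z] ndist_sym[OF x y] 0
      ndist_nonneg[OF x z] ndist_nonneg[OF y z] by linarith
  then show "cls x = cls y" by (auto simp: in_cls x y)
qed

lemma points_kq: "points (kernel_quotient S) = cls ` points S"
  by (auto simp: kernel_quotient_def quotient_def cls_def)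

text \<open>The operation of the quotient is a union of classes over all pairs of representatives,
  and \<open>ndist_add\<close> makes these classes coincide.\<close>

lemma nadd_kq:
  assumes x: "x \<in> points S" and y: "y \<in> points S"
  shows "nadd (kernel_quotient S) (cls x) (cls y) = cls (nadd S x y)"
proof -
  have "kernel_rel S `` {nadd S a b | a b. a \<in> cls x \<and> b \<in> cls y}
      = (\<Union>(a, b) \<in> cls x \<times> cls y. cls (nadd S a b))"
    unfolding cls_def[of "nadd S _ _"] by auto
  also have "\<dots> = (\<Union>(a, b) \<in> cls x \<times> cls y. cls (nadd S x y))"
  proof (intro SUP_cong refl, clarify)
    fix a b assume "a \<in> cls x" "b \<in> cls y"
    then have ab: "a \<in> points S" "ndist S x a = 0" "b \<in> points S" "ndist S y b = 0"
      using x y by (auto simp: in_cls)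
    then have "ndist S (nadd S x y) (nadd S a b) = 0"
      using ndist_add[OF x y ab(1,3)] ndist_nonneg[of "nadd S x y" "nadd S a b"] x y
      by (simp add: add_closed)
    then show "cls (nadd S a b) = cls (nadd S x y)"
      using ab x y by (subst eq_commute, subst cls_eq) (auto simp: add_closed)
  qed
  also have "\<dots> = cls (nadd S x y)" using cls_self[OF x] cls_self[OF y] by blast
  finally show ?thesis by (simp add: kernel_quotient_def)
qed

lemma nscale_kq:
  assumes x: "x \<in> points S"
  shows "nscale (kernel_quotient S) r (cls x) = cls (nscale S r x)"
proof -
  have "kernel_rel S `` (nscale S r ` cls x) = (\<Union>a \<in> cls x. cls (nscale S r a))"
    unfolding cls_def[of "nscale S _ _"] by auto
  also have "\<dots> = (\<Union>a \<in> cls x. cls (nscale S r x))"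
  proof (intro SUP_cong refl)
    fix a assume "a \<in> cls x"
    then have a: "a \<in> points S" "ndist S x a = 0" using x by (auto simp: in_cls)
    then show "cls (nscale S r a) = cls (nscale S r x)"
      using x by (subst eq_commute, subst cls_eq) (auto simp: scale_closed ndist_scale)
  qed
  also have "\<dots> = cls (nscale S r x)" using cls_self[OF x] by blast
  finally show ?thesis by (simp add: kernel_quotient_def)
qed

lemma nnorm_kq:
  assumes x: "x \<in> points S"
  shows "nnorm (kernel_quotient S) (cls x) = nnorm S x"
proof -
  have "nnorm S a = nnorm S x" if "a \<in> cls x" for a
    using that x nnorm_lipschitz[of x a] by (simp add: in_cls)
  then have "nnorm S ` cls x = {nnorm S x}" using cls_self[OF x] by blast
  then show ?thesis by (simp add: kernel_quotient_def)
qed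

lemma ndist_kq:
  assumes x: "x \<in> points S" and y: "y \<in> points S"
  shows "ndist (kernel_quotient S) (cls x) (cls y) = ndist S x y"
  using x y by (simp add: ndist_def nscale_kq nadd_kq nnorm_kq scale_closed add_closed)

lemma pnspace_kq: "pnspace (kernel_quotient S)"
  by standard
    (auto simp: points_kq nadd_kq nscale_kq nnorm_kq ndist_kq add_closed scale_closed ndist_refl
      intro: ndist_sym ndist_triangle ndist_add ndist_scale nnorm_lipschitz)

definition cauchy_seq :: "(nat \<Rightarrow> 'p) \<Rightarrow> bool" where
  "cauchy_seq s \<longleftrightarrow> (\<forall>n. s n \<in> points S) \<and> (\<forall>e>0. \<exists>N. \<forall>m\<ge>N. \<forall>n\<ge>N. ndist S (s m) (s n) < e)"

lemma points_cauchy: "s \<in> points (cauchy_space S) \<longleftrightarrow> cauchy_seq s"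
  by (simp add: cauchy_space_def cauchy_seq_def)

lemma cauchy_space_sel:
  "nadd (cauchy_space S) s t = (\<lambda>n. nadd S (s n) (t n))"
  "nscale (cauchy_space S) r s = (\<lambda>n. nscale S r (s n))"
  "nnorm (cauchy_space S) s = lim (\<lambda>n. nnorm S (s n))"
  by (simp_all add: cauchy_space_def)

lemma cauchy_add: 
  assumes s: "cauchy_seq s" and t: "cauchy_seq t"
  shows "cauchy_seq (\<lambda>n. nadd S (s n) (t n))"
  unfolding cauchy_seq_def
proof (intro conjI allI impI)
  show "nadd S (s n) (t n) \<in> points S" for n using s t by (auto simp: cauchy_seq_def add_closed)
  fix e :: real assume "e > 0"
  then obtain N M where N: "\<And>m n. m \<ge> N \<Longrightarrow> n \<ge> N \<Longrightarrow> ndist S (s m) (s n) < e / 2"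
    and M: "\<And>m n. m \<ge> M \<Longrightarrow> n \<ge> M \<Longrightarrow> ndist S (t m) (t n) < e / 2"
    using s t unfolding cauchy_seq_def by (meson half_gt_zero)
  have "ndist S (nadd S (s m) (t m)) (nadd S (s n) (t n)) < e" if "m \<ge> max N M" "n \<ge> max N M" for m n
    using ndist_add[of "s m" "t m" "s n" "t n"] N[of m n] M[of m n] that s t by (simp add: cauchy_seq_def)
  then show "\<exists>N. \<forall>m\<ge>N. \<forall>n\<ge>N. ndist S (nadd S (s m) (t m)) (nadd S (s n) (t n)) < e" by blast
qed

lemma cauchy_scale:
  assumes s: "cauchy_seq s"
  shows "cauchy_seq (\<lambda>n. nscale S r (s n))"
  unfolding cauchy_seq_def
proof (intro conjI allI impI)
  show "nscale S r (s n) \<in> points S" for n using s by (auto simp: cauchy_seq_def scale_closed)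
  fix e :: real assume "e > 0"
  then have "e / (\<bar>r\<bar> + 1) > 0" by simp
  then obtain N where N: "\<And>m n. m \<ge> N \<Longrightarrow> n \<ge> N \<Longrightarrow> ndist S (s m) (s n) < e / (\<bar>r\<bar> + 1)"
    using s unfolding cauchy_seq_def by meson
  have "ndist S (nscale S r (s m)) (nscale S r (s n)) < e" if "m \<ge> N" "n \<ge> N" for m n
  proof -
    have p: "s m \<in> points S" "s n \<in> points S" using s by (auto simp: cauchy_seq_def)
    have "\<bar>r\<bar> * ndist S (s m) (s n) \<le> (\<bar>r\<bar> + 1) * ndist S (s m) (s n)"
      using ndist_nonneg[OF p] by (intro mult_right_mono) auto
    also have "\<dots> < e" using N[OF that] by (simp add: field_simps)
    finally show ?thesis using p by (simp add: ndist_scale)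
  qed
  then show "\<exists>N. \<forall>m\<ge>N. \<forall>n\<ge>N. ndist S (nscale S r (s m)) (nscale S r (s n)) < e" by blast
qed

lemma nnorm_cauchy_limit:
  assumes s: "cauchy_seq s"
  shows "(\<lambda>n. nnorm S (s n)) \<longlonglongrightarrow> nnorm (cauchy_space S) s"
proof -
  have "Cauchy (\<lambda>n. nnorm S (s n))"
  proof (rule metric_CauchyI)
    fix e :: real assume "e > 0"
    then obtain N where N: "\<And>m n. m \<ge> N \<Longrightarrow> n \<ge> N \<Longrightarrow> ndist S (s m) (s n) < e"
      using s unfolding cauchy_seq_def by meson
    have "dist (nnorm S (s m)) (nnorm S (s n)) < e" if "m \<ge> N" "n \<ge> N" for m n
      using nnorm_lipschitz[of "s m" "s n"] N[OF that] s by (simp add: cauchy_seq_def dist_real_def)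
    then show "\<exists>N. \<forall>m\<ge>N. \<forall>n\<ge>N. dist (nnorm S (s m)) (nnorm S (s n)) < e" by blast
  qed
  then show ?thesis
    by (simp add: cauchy_space_sel Cauchy_convergent_iff convergent_LIMSEQ_iff)
qed

lemma ndist_cauchy_limit:
  assumes "cauchy_seq s" "cauchy_seq t"
  shows "(\<lambda>n. ndist S (s n) (t n)) \<longlonglongrightarrow> ndist (cauchy_space S) s t"
  using nnorm_cauchy_limit[OF cauchy_add[OF assms(1) cauchy_scale[OF assms(2), of "-1"]]]
  by (simp add: ndist_def cauchy_space_sel)

text \<open>Each law for distances and norms is a relation between convergent real sequences, valid
  termwise, and so it passes to the limit.\<close>

lemma pnspace_cauchy: "pnspace (cauchy_space S)"
proof
  have P: "s n \<in> points S" if "cauchy_seq s" for s n using that by (simp add: cauchy_seq_def)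
  fix x y x' y' z and r :: real
  assume "x \<in> points (cauchy_space S)"
  then have x: "cauchy_seq x" by (simp add: points_cauchy)
  show "nscale (cauchy_space S) r x \<in> points (cauchy_space S)"
    using cauchy_scale[OF x] by (simp add: points_cauchy cauchy_space_sel)
  show "ndist (cauchy_space S) x x = 0"
    by (rule LIMSEQ_unique[OF ndist_cauchy_limit[OF x x]]) (simp add: ndist_refl P[OF x])
  assume "y \<in> points (cauchy_space S)"
  then have y: "cauchy_seq y" by (simp add: points_cauchy)
  show "nadd (cauchy_space S) x y \<in> points (cauchy_space S)"
    using cauchy_add[OF x y] by (simp add: points_cauchy cauchy_space_sel)
  show "ndist (cauchy_space S) x y = ndist (cauchy_space S) y x"
    by (rule LIMSEQ_unique[OF ndist_cauchy_limit[OF x y]])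
      (use ndist_cauchy_limit[OF y x] in \<open>simp add: ndist_sym[OF P[OF x] P[OF y]]\<close>)
  show "ndist (cauchy_space S) (nscale (cauchy_space S) r x) (nscale (cauchy_space S) r y)
      = \<bar>r\<bar> * ndist (cauchy_space S) x y"
    by (rule LIMSEQ_unique[OF ndist_cauchy_limit])
      (use cauchy_scale[OF x] cauchy_scale[OF y] in
        \<open>auto simp: cauchy_space_sel ndist_scale P x y intro!: tendsto_mult_left ndist_cauchy_limit\<close>)
  show "\<bar>nnorm (cauchy_space S) x - nnorm (cauchy_space S) y\<bar> \<le> ndist (cauchy_space S) x y"
    by (rule LIMSEQ_le[OF tendsto_rabs[OF tendsto_diff[OF nnorm_cauchy_limit[OF x] nnorm_cauchy_limit[OF y]]]
          ndist_cauchy_limit[OF x y]])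
      (use nnorm_lipschitz P x y in blast)
  assume "z \<in> points (cauchy_space S)"
  then have z: "cauchy_seq z" by (simp add: points_cauchy)
  show "ndist (cauchy_space S) x z \<le> ndist (cauchy_space S) x y + ndist (cauchy_space S) y z"
    by (rule LIMSEQ_le[OF ndist_cauchy_limit[OF x z]
          tendsto_add[OF ndist_cauchy_limit[OF x y] ndist_cauchy_limit[OF y z]]])
      (use ndist_triangle P x y z in blast)
next
  have P: "s n \<in> points S" if "cauchy_seq s" for s n using that by (simp add: cauchy_seq_def)
  fix x y x' y'
  assume "x \<in> points (cauchy_space S)" "y \<in> points (cauchy_space S)"
    "x' \<in> points (cauchy_space S)" "y' \<in> points (cauchy_space S)"
  then have c: "cauchy_seq x" "cauchy_seq y" "cauchy_seq x'" "cauchy_seq y'"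
    by (simp_all add: points_cauchy)
  show "ndist (cauchy_space S) (nadd (cauchy_space S) x y) (nadd (cauchy_space S) x' y')
      \<le> ndist (cauchy_space S) x x' + ndist (cauchy_space S) y y'"
    unfolding cauchy_space_sel
    by (rule LIMSEQ_le[OF ndist_cauchy_limit[OF cauchy_add[OF c(1,2)] cauchy_add[OF c(3,4)]]
          tendsto_add[OF ndist_cauchy_limit[OF c(1,3)] ndist_cauchy_limit[OF c(2,4)]]])
      (use ndist_add P c in blast)
qed

end

section \<open>Completions of seminorms on \<open>c00\<close> in terms of Cauchy sequences\<close>

definition ncauchy :: "(c00 \<Rightarrow> real) \<Rightarrow> (nat \<Rightarrow> c00) \<Rightarrow> bool" where
  "ncauchy \<nu> a \<longleftrightarrow> (\<forall>e>0. \<exists>N. \<forall>m\<ge>N. \<forall>n\<ge>N. \<nu> (a m - a n) < e)"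

definition cpl :: "(c00 \<Rightarrow> real) \<Rightarrow> (nat \<Rightarrow> c00 set) set nspace" where
  "cpl \<nu> = completion (kernel_quotient (c00_space \<nu>))"

text \<open>The limit of a Cauchy sequence of \<open>c00\<close> in the completion. It hides the two
  quotients, modulo the kernel of \<open>\<nu>\<close> and modulo null sequences.\<close>

definition lim_pt :: "(c00 \<Rightarrow> real) \<Rightarrow> (nat \<Rightarrow> c00) \<Rightarrow> (nat \<Rightarrow> c00 set) set" where
  "lim_pt \<nu> a = pnspace.cls (cauchy_space (kernel_quotient (c00_space \<nu>)))
    (\<lambda>n. pnspace.cls (c00_space \<nu>) (a n))"

lemma X_space_eq: "X_space \<mu> = cpl (ext \<mu>)"
  by (simp add: X_space_def cpl_def)

lemma c00_space_sel:
  "points (c00_space \<nu>) = UNIV" "nadd (c00_space \<nu>) = (+)" "nscale (c00_space \<nu>) = (*\<^sub>R)"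
  "nnorm (c00_space \<nu>) = \<nu>" "ndist (c00_space \<nu>) x y = \<nu> (x - y)"
  by (simp_all add: c00_space_def map_times_eq_scaleR fun_eq_iff ndist_def)

context
  fixes \<nu> :: "c00 \<Rightarrow> real"
  assumes \<nu>: "seminorm \<nu>"
begin

interpretation seminorm \<nu> by (rule \<nu>)

lemma pnspace_c00: "pnspace (c00_space \<nu>)"
proof
  fix x y z x' y' :: c00 and r :: real
  show "ndist (c00_space \<nu>) x z \<le> ndist (c00_space \<nu>) x y + ndist (c00_space \<nu>) y z"
    using triangle[of "x - y" "y - z"] by (simp add: c00_space_sel)
  show "ndist (c00_space \<nu>) (nadd (c00_space \<nu>) x y) (nadd (c00_space \<nu>) x' y')
      \<le> ndist (c00_space \<nu>) x x' + ndist (c00_space \<nu>) y y'"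
    using triangle[of "x - x'" "y - y'"] by (simp add: c00_space_sel add_diff_add)
  show "ndist (c00_space \<nu>) (nscale (c00_space \<nu>) r x) (nscale (c00_space \<nu>) r y)
      = \<bar>r\<bar> * ndist (c00_space \<nu>) x y"
    using scale[of r "x - y"] by (simp add: c00_space_sel scaleR_diff_right)
qed (simp_all add: c00_space_sel diff_commute abs_diff_le)

interpretation S0: pnspace "c00_space \<nu>" by (rule pnspace_c00)
interpretation S1: pnspace "kernel_quotient (c00_space \<nu>)" by (rule S0.pnspace_kq)
interpretation S2: pnspace "cauchy_space (kernel_quotient (c00_space \<nu>))" by (rule S1.pnspace_cauchy)

lemma pnspace_cpl: "pnspace (cpl \<nu>)"
  unfolding cpl_def completion_def by (rule S2.pnspace_kq)

lemma lim_pt_eq: "lim_pt \<nu> a = S2.cls (\<lambda>n. S0.cls (a n))"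
  by (simp add: lim_pt_def)

lemma cauchy_cls: "S1.cauchy_seq (\<lambda>n. S0.cls (a n)) \<longleftrightarrow> ncauchy \<nu> a"
  by (simp add: S1.cauchy_seq_def ncauchy_def S0.points_kq S0.ndist_kq c00_space_sel)

text \<open>A Cauchy sequence of kernel classes lifts to one in \<open>c00\<close> by a choice of
  representatives, since the quotient map preserves distances.\<close>

lemma points_cpl: "points (cpl \<nu>) = lim_pt \<nu> ` {a. ncauchy \<nu> a}"
proof -
  have "s \<in> points (cauchy_space (kernel_quotient (c00_space \<nu>))) \<longleftrightarrow>
      (\<exists>a. s = (\<lambda>n. S0.cls (a n)) \<and> ncauchy \<nu> a)" for s
  proof
    assume "s \<in> points (cauchy_space (kernel_quotient (c00_space \<nu>)))"
    then have s: "S1.cauchy_seq s" by (simp add: S1.points_cauchy)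
    then have "\<forall>n. \<exists>a. s n = S0.cls a" unfolding S1.cauchy_seq_def S0.points_kq by blast
    then obtain a where "s = (\<lambda>n. S0.cls (a n))" by metis
    with s cauchy_cls show "\<exists>a. s = (\<lambda>n. S0.cls (a n)) \<and> ncauchy \<nu> a" by blast
  qed (auto simp: S1.points_cauchy cauchy_cls)
  then have "points (cauchy_space (kernel_quotient (c00_space \<nu>))) = (\<lambda>a n. S0.cls (a n)) ` {a. ncauchy \<nu> a}"
    by auto
  then show ?thesis by (simp add: cpl_def completion_def S2.points_kq lim_pt_eq image_image)
qed

lemma mem_points: "ncauchy \<nu> a \<Longrightarrow> (\<lambda>n. S0.cls (a n)) \<in> points (cauchy_space (kernel_quotient (c00_space \<nu>)))"
  by (simp add: S1.points_cauchy cauchy_cls)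

lemma nadd_cpl:
  assumes "ncauchy \<nu> a" "ncauchy \<nu> b"
  shows "nadd (cpl \<nu>) (lim_pt \<nu> a) (lim_pt \<nu> b) = lim_pt \<nu> (\<lambda>n. a n + b n)"
  using mem_points[OF assms(1)] mem_points[OF assms(2)]
  by (simp add: cpl_def completion_def lim_pt_eq S2.nadd_kq S1.cauchy_space_sel S0.nadd_kq c00_space_sel)

lemma nscale_cpl:
  assumes "ncauchy \<nu> a"
  shows "nscale (cpl \<nu>) r (lim_pt \<nu> a) = lim_pt \<nu> (\<lambda>n. r *\<^sub>R a n)"
  using mem_points[OF assms(1)]
  by (simp add: cpl_def completion_def lim_pt_eq S2.nscale_kq S1.cauchy_space_sel S0.nscale_kq c00_space_sel)

lemma nnorm_cpl:
  assumes "ncauchy \<nu> a"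
  shows "(\<lambda>n. \<nu> (a n)) \<longlonglongrightarrow> nnorm (cpl \<nu>) (lim_pt \<nu> a)"
  using S1.nnorm_cauchy_limit[of "\<lambda>n. S0.cls (a n)"] mem_points[OF assms] assms
  by (simp add: cpl_def completion_def lim_pt_eq S2.nnorm_kq S0.nnorm_kq cauchy_cls c00_space_sel)

lemma lim_pt_eq_iff:
  assumes "ncauchy \<nu> a" "ncauchy \<nu> b"
  shows "lim_pt \<nu> a = lim_pt \<nu> b \<longleftrightarrow> (\<lambda>n. \<nu> (a n - b n)) \<longlonglongrightarrow> 0"
proof -
  let ?d = "ndist (cauchy_space (kernel_quotient (c00_space \<nu>))) (\<lambda>n. S0.cls (a n)) (\<lambda>n. S0.cls (b n))"
  have "(\<lambda>n. \<nu> (a n - b n)) \<longlonglongrightarrow> ?d"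
    using S1.ndist_cauchy_limit[of "\<lambda>n. S0.cls (a n)" "\<lambda>n. S0.cls (b n)"] assms
    by (simp add: cauchy_cls S0.ndist_kq c00_space_sel)
  then have "?d = 0 \<longleftrightarrow> (\<lambda>n. \<nu> (a n - b n)) \<longlonglongrightarrow> 0"
    using LIMSEQ_unique by auto
  then show ?thesis by (simp add: lim_pt_eq S2.cls_eq mem_points assms)
qed

lemma ncauchy_const: "ncauchy \<nu> (\<lambda>_. x)"
  by (auto simp: ncauchy_def)

lemma lim_pt_scale_add:
  "nadd (cpl \<nu>) (lim_pt \<nu> (\<lambda>_. x)) (lim_pt \<nu> (\<lambda>_. y)) = lim_pt \<nu> (\<lambda>_. x + y)"
  "nscale (cpl \<nu>) r (lim_pt \<nu> (\<lambda>_. x)) = lim_pt \<nu> (\<lambda>_. r *\<^sub>R x)"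
  by (simp_all add: nadd_cpl nscale_cpl ncauchy_const)

lemma lim_pt_const_points: "lim_pt \<nu> (\<lambda>_. x) \<in> points (cpl \<nu>)"
  by (auto simp: points_cpl ncauchy_const)

lemma nnorm_lim_pt_const: "nnorm (cpl \<nu>) (lim_pt \<nu> (\<lambda>_. x)) = \<nu> x"
  using nnorm_cpl[OF ncauchy_const, of x] by (simp add: LIMSEQ_const_iff)

end

text \<open>With the constant explicit, isometries are the case \<open>K = 1\<close> and an
  isomorphism class is a union over \<open>K\<close>.\<close>

definition bounded_iso :: "real \<Rightarrow> 'p nspace \<Rightarrow> 'q nspace \<Rightarrow> ('p \<Rightarrow> 'q) \<Rightarrow> bool" where
  "bounded_iso K S T f \<longleftrightarrow> nlinear_bij S T f \<and>
    (\<forall>x\<in>points S. nnorm T (f x) \<le> K * nnorm S x \<and> nnorm S x \<le> K * nnorm T (f x))"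

lemma linearly_isomorphic_iff: "linearly_isomorphic S T \<longleftrightarrow> (\<exists>K f. bounded_iso K S T f)"
  by (auto simp: linearly_isomorphic_def bounded_iso_def)

lemma linearly_isometric_iff: "linearly_isometric S T \<longleftrightarrow> (\<exists>f. bounded_iso 1 S T f)"
  by (auto simp: linearly_isometric_def bounded_iso_def intro: antisym)

lemma bounded_iso_trans:
  assumes f: "bounded_iso K S T f" and g: "bounded_iso K' T U g" and K: "0 \<le> K" "0 \<le> K'"
  shows "bounded_iso (K * K') S U (g \<circ> f)"
proof -
  have bij: "bij_betw (g \<circ> f) (points S) (points U)"
    using f g bij_betw_trans by (auto simp: bounded_iso_def nlinear_bij_def)
  have fT: "f x \<in> points T" if "x \<in> points S" for x
    using f that by (auto simp: bounded_iso_def nlinear_bij_def bij_betw_def)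
  have "nnorm U (g (f x)) \<le> K * K' * nnorm S x \<and> nnorm S x \<le> K * K' * nnorm U (g (f x))"
    if x: "x \<in> points S" for x
  proof
    have 1: "nnorm U (g (f x)) \<le> K' * nnorm T (f x)" "nnorm T (f x) \<le> K' * nnorm U (g (f x))"
      and 2: "nnorm T (f x) \<le> K * nnorm S x" "nnorm S x \<le> K * nnorm T (f x)"
      using f g x fT[OF x] by (auto simp: bounded_iso_def)
    show "nnorm U (g (f x)) \<le> K * K' * nnorm S x"
      using order_trans[OF 1(1) mult_left_mono[OF 2(1) K(2)]] by (simp add: mult_ac)
    show "nnorm S x \<le> K * K' * nnorm U (g (f x))"
      using order_trans[OF 2(2) mult_left_mono[OF 1(2) K(1)]] by (simp add: mult_ac)
  qed
  with bij f g fT show ?thesis by (auto simp: bounded_iso_def nlinear_bij_def)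
qed

lemma bounded_iso_inverse:
  assumes S: "pnspace S" and f: "bounded_iso K S T f"
  shows "bounded_iso K T S (inv_into (points S) f)"
proof -
  interpret pnspace S by (rule S)
  let ?g = "inv_into (points S) f"
  have bij: "bij_betw f (points S) (points T)" using f by (simp add: bounded_iso_def nlinear_bij_def)
  have g: "?g y \<in> points S" "f (?g y) = y" if "y \<in> points T" for y
    using bij that by (auto simp: bij_betw_def inv_into_into f_inv_into_f)
  have gf: "?g (f x) = x" if "x \<in> points S" for x
    using bij that by (auto simp: bij_betw_def)
  have "?g (nadd T y y') = nadd S (?g y) (?g y')" if "y \<in> points T" "y' \<in> points T" for y y'
    using gf[of "nadd S (?g y) (?g y')"] g[OF that(1)] g[OF that(2)] f
    by (simp add: bounded_iso_def nlinear_bij_def add_closed)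
  moreover have "?g (nscale T r y) = nscale S r (?g y)" if "y \<in> points T" for r y
    using gf[of "nscale S r (?g y)"] g[OF that(1)] f
    by (simp add: bounded_iso_def nlinear_bij_def scale_closed)
  moreover have "nnorm S (?g y) \<le> K * nnorm T y \<and> nnorm T y \<le> K * nnorm S (?g y)" if "y \<in> points T" for y
    using f g[OF that] by (force simp: bounded_iso_def)
  ultimately show ?thesis
    using bij_betw_inv_into[OF bij] by (simp add: bounded_iso_def nlinear_bij_def)
qed

lemma nspan_image:
  assumes S: "pnspace S" and f: "bounded_iso K S T f" and B: "B \<subseteq> points S"
  shows "nspan S B \<subseteq> points S" "f ` nspan S B = nspan T (f ` B)"
proof -
  interpret pnspace S by (rule S)
  have sub: "x \<in> points S" if "x \<in> nspan S B" for x
    using that B by induction (auto simp: add_closed scale_closed)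
  then show "nspan S B \<subseteq> points S" by blast
  have lin1: "f (nadd S x y) = nadd T (f x) (f y)" if "x \<in> points S" "y \<in> points S" for x y
    using f that by (auto simp: bounded_iso_def nlinear_bij_def)
  have lin2: "f (nscale S r x) = nscale T r (f x)" if "x \<in> points S" for x r
    using f that by (auto simp: bounded_iso_def nlinear_bij_def)
  have "f x \<in> nspan T (f ` B)" if "x \<in> nspan S B" for x
    using that
    by induction (auto simp: lin1 lin2 sub intro: nspan.base nspan.add nspan.scale)
  moreover have "\<exists>x\<in>nspan S B. y = f x" if "y \<in> nspan T (f ` B)" for y
    using that
  proof induction
    case (base y)
    then show ?case by (auto intro: nspan.base)
  next
    case (add y y')
    then show ?case using lin1 sub by (metis nspan.add)
  next
    case (scale y r)
    then show ?case using lin2 sub by (metis nspan.scale)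
  qed
  ultimately show "f ` nspan S B = nspan T (f ` B)" by blast
qed

lemma infinite_dimensional_iso:
  assumes S: "pnspace S" and f: "bounded_iso K S T f" and T: "infinite_dimensional T"
  shows "infinite_dimensional S"
  unfolding infinite_dimensional_def
proof clarify
  fix B assume B: "finite B" "B \<subseteq> points S" "nspan S B = points S"
  have bij: "f ` points S = points T" using f by (auto simp: bounded_iso_def nlinear_bij_def bij_betw_def)
  have "nspan T (f ` B) = points T" using nspan_image(2)[OF S f B(2)] B(3) bij by simp
  moreover have "f ` B \<subseteq> points T" using B bij by blast
  ultimately show False using T B(1) unfolding infinite_dimensional_def by blast
qed

lemma space_of_type_sel [simp]:
  "points (space_of_type TYPE('a::real_normed_vector)) = UNIV"
  "nadd (space_of_type TYPE('a)) x y = x + y" "nscale (space_of_type TYPE('a)) r x = r *\<^sub>R x"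
  "nnorm (space_of_type TYPE('a)) x = norm x" "ndist (space_of_type TYPE('a)) x y = norm (x - y)"
  by (simp_all add: space_of_type_def ndist_def)

lemma pnspace_type: "pnspace (space_of_type TYPE('a::real_normed_vector))"
proof
  fix x y z x' y' :: 'a and r :: real
  show "ndist (space_of_type TYPE('a)) x z \<le> ndist (space_of_type TYPE('a)) x y + ndist (space_of_type TYPE('a)) y z"
    using norm_triangle_ineq[of "x - y" "y - z"] by simp
  show "ndist (space_of_type TYPE('a)) (nadd (space_of_type TYPE('a)) x y) (nadd (space_of_type TYPE('a)) x' y')
      \<le> ndist (space_of_type TYPE('a)) x x' + ndist (space_of_type TYPE('a)) y y'"
    using norm_triangle_ineq[of "x - x'" "y - y'"] by (simp add: add_diff_add)
  show "ndist (space_of_type TYPE('a)) (nscale (space_of_type TYPE('a)) r x) (nscale (space_of_type TYPE('a)) r y)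
      = \<bar>r\<bar> * ndist (space_of_type TYPE('a)) x y"
    by (simp flip: scaleR_diff_right)
qed (simp_all add: norm_minus_commute norm_triangle_ineq3)

section \<open>Representing sequences\<close>

lemma cpl_nnorm_nonneg:
  assumes "seminorm \<nu>" "p \<in> points (cpl \<nu>)"
  shows "0 \<le> nnorm (cpl \<nu>) p"
proof -
  obtain a where a: "ncauchy \<nu> a" "p = lim_pt \<nu> a" using assms by (auto simp: points_cpl)
  show ?thesis
    unfolding a(2)
    by (rule LIMSEQ_le_const[OF nnorm_cpl[OF assms(1) a(1)]]) (simp add: seminorm.nonneg[OF assms(1)])
qed

lemma bounded_iso_mono:
  assumes f: "bounded_iso K S (space_of_type TYPE('b::real_normed_vector)) f"
    and nn: "\<And>x. x \<in> points S \<Longrightarrow> 0 \<le> nnorm S x" and "K \<le> K'"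
  shows "bounded_iso K' S (space_of_type TYPE('b)) f"
proof -
  have "K * nnorm S x \<le> K' * nnorm S x" "K * norm (f x) \<le> K' * norm (f x)" if "x \<in> points S" for x
    using nn[OF that] assms(3) by (auto intro: mult_right_mono)
  then show ?thesis using f unfolding bounded_iso_def by (simp, meson order_trans)
qed

text \<open>\<open>linearly_isomorphic\<close> admits any real constant. As norms are nonnegative it
  can be raised to at least 1, which makes isomorphisms composable by
  \<open>bounded_iso_trans\<close>.\<close>

lemma isomorphic_X_space_iff:
  assumes "\<mu> \<in> pseudonorms"
  shows "linearly_isomorphic (X_space \<mu>) (space_of_type TYPE('b::real_normed_vector)) \<longleftrightarrow>
    (\<exists>K\<ge>1. \<exists>f. bounded_iso K (X_space \<mu>) (space_of_type TYPE('b)) f)"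
proof
  assume "linearly_isomorphic (X_space \<mu>) (space_of_type TYPE('b))"
  then obtain K f where "bounded_iso K (X_space \<mu>) (space_of_type TYPE('b)) f"
    by (auto simp: linearly_isomorphic_iff)
  then have "bounded_iso (max 1 K) (X_space \<mu>) (space_of_type TYPE('b)) f"
    by (rule bounded_iso_mono) (auto simp: X_space_eq intro: cpl_nnorm_nonneg seminorm_ext[OF assms])
  then show "\<exists>K\<ge>1. \<exists>f. bounded_iso K (X_space \<mu>) (space_of_type TYPE('b)) f"
    by (intro exI[of _ "max 1 K"]) auto
qed (auto simp: linearly_isomorphic_iff)

lemma isomorphic_type_iff:
  "linearly_isomorphic (space_of_type TYPE('a::real_normed_vector)) (space_of_type TYPE('b::real_normed_vector)) \<longleftrightarrow>
    (\<exists>K\<ge>1. \<exists>f. bounded_iso K (space_of_type TYPE('a)) (space_of_type TYPE('b)) f)"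
proof
  assume "linearly_isomorphic (space_of_type TYPE('a)) (space_of_type TYPE('b))"
  then obtain K f where "bounded_iso K (space_of_type TYPE('a)) (space_of_type TYPE('b)) f"
    by (auto simp: linearly_isomorphic_iff)
  then have "bounded_iso (max 1 K) (space_of_type TYPE('a)) (space_of_type TYPE('b)) f"
    by (rule bounded_iso_mono) auto
  then show "\<exists>K\<ge>1. \<exists>f. bounded_iso K (space_of_type TYPE('a)) (space_of_type TYPE('b)) f"
    by (intro exI[of _ "max 1 K"]) auto
qed (auto simp: linearly_isomorphic_iff)

text \<open>The linear map on \<open>c00\<close> that sends \<open>bas i\<close> to
  \<open>x i\<close>: its kernel consists of the linear relations of the sequence and its range is
  the span.\<close>

definition comb :: "(nat \<Rightarrow> 'b::real_vector) \<Rightarrow> c00 \<Rightarrow> 'b" where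
  "comb x c = (\<Sum>i\<in>Poly_Mapping.keys c. lookup c i *\<^sub>R x i)"

lemma comb_superset:
  "finite A \<Longrightarrow> Poly_Mapping.keys c \<subseteq> A \<Longrightarrow> comb x c = (\<Sum>i\<in>A. lookup c i *\<^sub>R x i)"
  unfolding comb_def by (intro sum.mono_neutral_left) (auto simp: in_keys_iff)

lemma comb_add: "comb x (c + d) = comb x c + comb x d"
proof -
  let ?A = "Poly_Mapping.keys c \<union> Poly_Mapping.keys d"
  have "comb x (c + d) = (\<Sum>i\<in>?A. lookup (c + d) i *\<^sub>R x i)"
    by (rule comb_superset) (use Poly_Mapping.keys_add[of c d] in auto)
  then show ?thesis
    by (simp add: comb_superset[of ?A] lookup_add scaleR_add_left sum.distrib)
qed

lemma comb_scaleR: "comb x (r *\<^sub>R c) = r *\<^sub>R comb x c"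
proof -
  have "comb x (r *\<^sub>R c) = (\<Sum>i\<in>Poly_Mapping.keys c. lookup (r *\<^sub>R c) i *\<^sub>R x i)"
    by (rule comb_superset) (auto simp: in_keys_iff)
  then show ?thesis by (simp add: comb_def scaleR_sum_right)
qed

lemma linear_comb: "linear (comb x)"
  by (rule linearI) (simp_all add: comb_add comb_scaleR)

lemma comb_simps [simp]: "comb x (c - d) = comb x c - comb x d" "comb x (- c) = - comb x c" "comb x 0 = 0"
  using linear_comb[of x] by (auto simp: linear_diff linear_neg linear_0)

lemma comb_sum: "comb x (sum f A) = (\<Sum>i\<in>A. comb x (f i))"
  using linear_comb[of x] by (rule linear_sum)

lemma comb_bas [simp]: "comb x (bas i) = x i"
  by (simp add: comb_def)

lemma comb_unique:
  assumes "linear F" "\<And>i. F (bas i) = x i"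
  shows "F c = comb x c"
proof -
  have "F c = F (\<Sum>i\<in>Poly_Mapping.keys c. lookup c i *\<^sub>R bas i)" by (simp only: c00_expand finite_keys order_refl)
  also have "\<dots> = comb x c" using assms by (simp add: linear_sum linear_scale comb_def)
  finally show ?thesis .
qed

lemma comb_image: "linear g \<Longrightarrow> g (comb x c) = comb (\<lambda>i. g (x i)) c"
  using comb_unique[of "\<lambda>c. g (comb x c)" "\<lambda>i. g (x i)" c] linear_compose[OF linear_comb, of g x]
  by (simp add: o_def)

lemma range_comb: "range (comb x) = span (range x)"
proof
  show "range (comb x) \<subseteq> span (range x)"
  proof clarify
    show "comb x c \<in> span (range x)" for c
      unfolding comb_def by (rule span_sum, rule span_scale, rule span_base) simp
  qed
  have "subspace (range (comb x))" using linear_subspace_image[OF linear_comb subspace_UNIV] .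
  moreover have "range x \<subseteq> range (comb x)" by (metis comb_bas image_subsetI rangeI)
  ultimately show "span (range x) \<subseteq> range (comb x)" by (simp add: span_minimal)
qed

lemma seminorm_norm_comb: "seminorm (\<lambda>c. norm (comb x c))"
  by standard (simp_all add: comb_add comb_scaleR norm_triangle_ineq)

text \<open>A rational vector close to \<open>c\<close> in the seminorm \<open>p + K * q\<close>
  controls both sides of the inequality at once.\<close>

lemma seminorm_bound_extend:
  fixes p q :: "c00 \<Rightarrow> real"
  assumes p: "seminorm p" and q: "seminorm q" and K: "0 \<le> K" and le: "\<And>v. p (emb v) \<le> K * q (emb v)"
  shows "p c \<le> K * q c"
proof (rule field_le_epsilon)
  fix e :: real assume e: "e > 0"
  have "seminorm (\<lambda>c. K * q c)"
  proof
    show "K * q (c + d) \<le> K * q c + K * q d" for c d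
      using mult_left_mono[OF seminorm.triangle[OF q] K] by (simp add: distrib_left)
    show "K * q (r *\<^sub>R c) = \<bar>r\<bar> * (K * q c)" for r c by (simp add: seminorm.scale[OF q])
  qed
  then obtain v where v: "p (c - emb v) + K * q (c - emb v) < e"
    using rational_approximation[OF seminorm_add[OF p] e] by blast
  have "p c \<le> p (emb v) + p (c - emb v)" by (rule seminorm.triangle_diff[OF p])
  also have "p (emb v) \<le> K * q (emb v)" by (rule le)
  also have "K * q (emb v) \<le> K * (q c + q (c - emb v))"
    using seminorm.triangle_diff[OF q, of "emb v" c] K
    by (intro mult_left_mono) (simp_all add: seminorm.diff_commute[OF q])
  finally show "p c \<le> K * q c + e" using v by (simp add: distrib_left)
qed

lemma ncauchy_add_scale:
  assumes "seminorm \<nu>"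
  shows "ncauchy \<nu> a \<Longrightarrow> ncauchy \<nu> b \<Longrightarrow> ncauchy \<nu> (\<lambda>n. a n + b n)"
    and "ncauchy \<nu> a \<Longrightarrow> ncauchy \<nu> (\<lambda>n. r *\<^sub>R a n)"
proof -
  interpret seminorm \<nu> by (rule assms)
  show "ncauchy \<nu> (\<lambda>n. a n + b n)" if "ncauchy \<nu> a" "ncauchy \<nu> b" for a b
    unfolding ncauchy_def
  proof (intro allI impI)
    fix e :: real assume "e > 0"
    then obtain N M where N: "\<And>m n. m \<ge> N \<Longrightarrow> n \<ge> N \<Longrightarrow> \<nu> (a m - a n) < e / 2"
      and M: "\<And>m n. m \<ge> M \<Longrightarrow> n \<ge> M \<Longrightarrow> \<nu> (b m - b n) < e / 2"
      using \<open>ncauchy \<nu> a\<close> \<open>ncauchy \<nu> b\<close> unfolding ncauchy_def by (meson half_gt_zero)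
    have "\<nu> (a m + b m - (a n + b n)) < e" if "m \<ge> max N M" "n \<ge> max N M" for m n
      using triangle[of "a m - a n" "b m - b n"] N[of m n] M[of m n] that by (simp add: add_diff_add)
    then show "\<exists>N. \<forall>m\<ge>N. \<forall>n\<ge>N. \<nu> (a m + b m - (a n + b n)) < e" by blast
  qed
  show "ncauchy \<nu> (\<lambda>n. r *\<^sub>R a n)" if a: "ncauchy \<nu> a" for a r
    unfolding ncauchy_def
  proof (intro allI impI)
    fix e :: real assume "e > 0"
    then have "e / (\<bar>r\<bar> + 1) > 0" by simp
    then obtain N where N: "\<And>m n. m \<ge> N \<Longrightarrow> n \<ge> N \<Longrightarrow> \<nu> (a m - a n) < e / (\<bar>r\<bar> + 1)"
      using a unfolding ncauchy_def by meson
    have "\<nu> (r *\<^sub>R a m - r *\<^sub>R a n) < e" if "m \<ge> N" "n \<ge> N" for m n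
    proof -
      have "\<bar>r\<bar> * \<nu> (a m - a n) \<le> (\<bar>r\<bar> + 1) * \<nu> (a m - a n)" by (intro mult_right_mono) auto
      also have "\<dots> < e" using N[OF that] by (simp add: field_simps)
      finally show ?thesis by (simp only: scale flip: scaleR_diff_right)
    qed
    then show "\<exists>N. \<forall>m\<ge>N. \<forall>n\<ge>N. \<nu> (r *\<^sub>R a m - r *\<^sub>R a n) < e" by blast
  qed
qed

text \<open>The sequence \<open>x\<close> is the image of the unit vectors under a
  \<open>K\<close>-isomorphism from \<open>X_space \<mu>\<close>. Stated on rational vectors, the
  condition involves no completion.\<close>

definition represents :: "real \<Rightarrow> (V \<Rightarrow> real) \<Rightarrow> (nat \<Rightarrow> 'b::real_normed_vector) \<Rightarrow> bool" where
  "represents K \<mu> x \<longleftrightarrow> closure (range (comb x)) = UNIV \<and>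
    (\<forall>v. norm (comb x (emb v)) \<le> K * \<mu> v \<and> \<mu> v \<le> K * norm (comb x (emb v)))"

lemma represents_ext:
  assumes \<mu>: "\<mu> \<in> pseudonorms" and r: "represents K \<mu> x" and K: "K \<ge> 0"
  shows "norm (comb x c) \<le> K * ext \<mu> c" "ext \<mu> c \<le> K * norm (comb x c)"
proof -
  show "norm (comb x c) \<le> K * ext \<mu> c"
    by (rule seminorm_bound_extend[OF seminorm_norm_comb seminorm_ext[OF \<mu>] K])
      (use r in \<open>simp add: ext_emb[OF \<mu>] represents_def\<close>)
  show "ext \<mu> c \<le> K * norm (comb x c)"
    by (rule seminorm_bound_extend[OF seminorm_ext[OF \<mu>] seminorm_norm_comb K])
      (use r in \<open>simp add: ext_emb[OF \<mu>] represents_def\<close>)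
qed

lemma represents_of_bounded_iso:
  assumes \<mu>: "\<mu> \<in> pseudonorms" and f: "bounded_iso K (X_space \<mu>) (space_of_type TYPE('b::real_normed_vector)) f"
    and K: "K \<ge> 0"
  shows "\<exists>x :: nat \<Rightarrow> 'b. represents K \<mu> x"
proof -
  define \<nu> where "\<nu> = ext \<mu>"
  have \<nu>: "seminorm \<nu>" unfolding \<nu>_def by (rule seminorm_ext[OF \<mu>])
  have X: "X_space \<mu> = cpl \<nu>" by (simp add: X_space_eq \<nu>_def)
  define F where "F c = f (lim_pt \<nu> (\<lambda>_. c))" for c
  note fX = f[unfolded X bounded_iso_def nlinear_bij_def]
  have add: "f (nadd (cpl \<nu>) p q) = f p + f q"
    if "p \<in> points (cpl \<nu>)" "q \<in> points (cpl \<nu>)" for p q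
    using fX that by auto
  have sc: "f (nscale (cpl \<nu>) r p) = r *\<^sub>R f p" if "p \<in> points (cpl \<nu>)" for p r
    using fX that by auto
  have linF: "linear F"
  proof (rule linearI)
    show "F (c + d) = F c + F d" for c d
      unfolding F_def lim_pt_scale_add(1)[OF \<nu>, symmetric] by (intro add lim_pt_const_points[OF \<nu>])
    show "F (r *\<^sub>R c) = r *\<^sub>R F c" for r c
      unfolding F_def lim_pt_scale_add(2)[OF \<nu>, symmetric] by (intro sc lim_pt_const_points[OF \<nu>])
  qed
  define x where "x i = F (bas i)" for i
  have comb: "comb x c = F c" for c using comb_unique[OF linF, of x c] by (simp add: x_def)
  have bd: "norm (F c) \<le> K * \<nu> c \<and> \<nu> c \<le> K * norm (F c)" for c
  proof -
    have "norm (f p) \<le> K * nnorm (cpl \<nu>) p \<and> nnorm (cpl \<nu>) p \<le> K * norm (f p)"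
      if "p \<in> points (cpl \<nu>)" for p using fX that by auto
    from this[OF lim_pt_const_points[OF \<nu>, of c]] show ?thesis
      unfolding nnorm_lim_pt_const[OF \<nu>] F_def .
  qed
  have "y \<in> closure (range (comb x))" for y
  proof -
    have "y \<in> f ` points (cpl \<nu>)" using fX by (simp add: bij_betw_def)
    then obtain a where a: "ncauchy \<nu> a" "y = f (lim_pt \<nu> a)" by (auto simp: points_cpl[OF \<nu>])
    have "(\<lambda>k. F (a k)) \<longlonglongrightarrow> y"
    proof (rule LIMSEQ_I)
      fix e :: real assume e: "e > 0"
      then have "e / (K + 1) > 0" using K by simp
      then obtain N where N: "\<And>m n. m \<ge> N \<Longrightarrow> n \<ge> N \<Longrightarrow> \<nu> (a m - a n) < e / (K + 1)"
        using a(1) unfolding ncauchy_def by meson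
      have "norm (F (a k) - y) < e" if k: "k \<ge> N" for k
      proof -
        \<comment> \<open>\<open>b\<close> represents the difference of the constant
          \<open>a k\<close> and the limit point of \<open>a\<close>, so its norm in the completion
          bounds the error at \<open>k\<close>.\<close>
        define b where "b n = a k + (-1) *\<^sub>R a n" for n
        have c1: "ncauchy \<nu> (\<lambda>n. (-1) *\<^sub>R a n)"
          using a(1) by (simp add: ncauchy_def seminorm.diff_commute[OF \<nu>])
        have b: "ncauchy \<nu> b"
          using a(1) by (simp add: b_def ncauchy_def seminorm.diff_commute[OF \<nu>])
        have "lim_pt \<nu> b = nadd (cpl \<nu>) (lim_pt \<nu> (\<lambda>_. a k)) (nscale (cpl \<nu>) (-1) (lim_pt \<nu> a))"
          by (simp only: nscale_cpl[OF \<nu> a(1)] nadd_cpl[OF \<nu> ncauchy_const[OF \<nu>] c1] b_def[abs_def])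
        then have fb: "f (lim_pt \<nu> b) = F (a k) - y"
          using add[of "lim_pt \<nu> (\<lambda>_. a k)" "nscale (cpl \<nu>) (-1) (lim_pt \<nu> a)"]
            sc[of "lim_pt \<nu> a" "-1"] a lim_pt_const_points[OF \<nu>, of "a k"]
            pnspace.scale_closed[OF pnspace_cpl[OF \<nu>], of "lim_pt \<nu> a" "-1"]
          by (simp add: points_cpl[OF \<nu>] F_def)
        have "norm (F (a k) - y) \<le> K * nnorm (cpl \<nu>) (lim_pt \<nu> b)"
          using fX b by (simp add: points_cpl[OF \<nu>] flip: fb)
        also have "nnorm (cpl \<nu>) (lim_pt \<nu> b) \<le> e / (K + 1)"
        proof (rule LIMSEQ_le_const2[OF nnorm_cpl[OF \<nu> b]], intro exI[of _ N] allI impI)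
          fix n assume "N \<le> n"
          then show "\<nu> (b n) \<le> e / (K + 1)" using N[OF k, of n] by (simp add: b_def)
        qed
        then have "K * nnorm (cpl \<nu>) (lim_pt \<nu> b) \<le> K * (e / (K + 1))" using K by (rule mult_left_mono)
        also have "\<dots> < e" using K e by (simp add: field_simps)
        finally show ?thesis .
      qed
      then show "\<exists>no. \<forall>n\<ge>no. norm (F (a n) - y) < e" by blast
    qed
    then show ?thesis by (auto simp: closure_sequential comb intro!: exI[of _ "\<lambda>k. F (a k)"])
  qed
  then have "closure (range (comb x)) = UNIV" by blast
  moreover have "norm (comb x (emb v)) \<le> K * \<mu> v \<and> \<mu> v \<le> K * norm (comb x (emb v))" for v
    using bd[of "emb v"] by (simp only: comb \<nu>_def ext_emb[OF \<mu>])
  ultimately have "represents K \<mu> x" by (simp add: represents_def)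
  then show ?thesis by blast
qed

text \<open>The point of a Cauchy sequence \<open>a\<close> is sent to the limit of
  \<open>comb x (a n)\<close>, which exists by completeness. The upper estimate makes this well
  defined, the lower one makes it injective, and density with the lower one makes it
  surjective.\<close>

lemma bounded_iso_of_represents:
  fixes x :: "nat \<Rightarrow> 'b::banach"
  assumes \<mu>: "\<mu> \<in> pseudonorms" and r: "represents K \<mu> x" and K: "K > 0"
  shows "\<exists>f. bounded_iso K (X_space \<mu>) (space_of_type TYPE('b)) f"
proof -
  define \<nu> where "\<nu> = ext \<mu>"
  have \<nu>: "seminorm \<nu>" unfolding \<nu>_def by (rule seminorm_ext[OF \<mu>])
  interpret seminorm \<nu> by (rule \<nu>)
  have X: "X_space \<mu> = cpl \<nu>" by (simp add: X_space_eq \<nu>_def)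
  have up: "norm (comb x c) \<le> K * \<nu> c" and lo: "\<nu> c \<le> K * norm (comb x c)" for c
    using represents_ext[OF \<mu> r, of c] K by (simp_all add: \<nu>_def)
  have conv: "convergent (\<lambda>n. comb x (a n))" if a: "ncauchy \<nu> a" for a
  proof -
    have "Cauchy (\<lambda>n. comb x (a n))"
    proof (rule metric_CauchyI)
      fix e :: real assume "e > 0"
      then have "e / K > 0" using K by simp
      then obtain N where N: "\<And>m n. m \<ge> N \<Longrightarrow> n \<ge> N \<Longrightarrow> \<nu> (a m - a n) < e / K"
        using a unfolding ncauchy_def by meson
      have "dist (comb x (a m)) (comb x (a n)) < e" if "m \<ge> N" "n \<ge> N" for m n
        using up[of "a m - a n"] N[OF that] K by (simp add: dist_norm field_simps)
      then show "\<exists>N. \<forall>m\<ge>N. \<forall>n\<ge>N. dist (comb x (a m)) (comb x (a n)) < e" by blast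
    qed
    then show ?thesis by (rule Cauchy_convergent)
  qed
  define f where "f p = lim (\<lambda>n. comb x ((SOME a. ncauchy \<nu> a \<and> p = lim_pt \<nu> a) n))" for p
  have f: "(\<lambda>n. comb x (a n)) \<longlonglongrightarrow> f (lim_pt \<nu> a)" if a: "ncauchy \<nu> a" for a
  proof -
    define b where "b = (SOME b. ncauchy \<nu> b \<and> lim_pt \<nu> a = lim_pt \<nu> b)"
    have b: "ncauchy \<nu> b" "lim_pt \<nu> a = lim_pt \<nu> b"
      using someI[of "\<lambda>b. ncauchy \<nu> b \<and> lim_pt \<nu> a = lim_pt \<nu> b" a] a by (auto simp: b_def)
    have "(\<lambda>n. K * \<nu> (a n - b n)) \<longlonglongrightarrow> 0"
      using b lim_pt_eq_iff[OF \<nu> a b(1)] by (intro tendsto_mult_right_zero) simp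
    then have "(\<lambda>n. comb x (a n - b n)) \<longlonglongrightarrow> 0"
      by (rule Lim_null_comparison[rotated]) (simp add: up del: comb_simps)
    moreover have "(\<lambda>n. comb x (b n)) \<longlonglongrightarrow> f (lim_pt \<nu> a)"
      unfolding f_def b_def[symmetric] using conv[OF b(1)] by (simp add: convergent_LIMSEQ_iff)
    ultimately show ?thesis using tendsto_add[of "\<lambda>n. comb x (a n - b n)" 0 _ "\<lambda>n. comb x (b n)"] by simp
  qed
  have P: "points (cpl \<nu>) = lim_pt \<nu> ` {a. ncauchy \<nu> a}" by (rule points_cpl[OF \<nu>])
  have add: "f (nadd (cpl \<nu>) p q) = f p + f q" if pq: "p \<in> points (cpl \<nu>)" "q \<in> points (cpl \<nu>)" for p q
  proof -
    obtain a b where a: "ncauchy \<nu> a" "p = lim_pt \<nu> a" and b: "ncauchy \<nu> b" "q = lim_pt \<nu> b"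
      using pq by (auto simp: P)
    have "(\<lambda>n. comb x (a n + b n)) \<longlonglongrightarrow> f p + f q"
      unfolding comb_add a(2) b(2) by (intro tendsto_add f a b)
    then show ?thesis
      using LIMSEQ_unique[OF f[OF ncauchy_add_scale(1)[OF \<nu>, OF a(1) b(1)]]] a b by (simp add: nadd_cpl[OF \<nu>])
  qed
  have sc: "f (nscale (cpl \<nu>) r p) = r *\<^sub>R f p" if p: "p \<in> points (cpl \<nu>)" for p r
  proof -
    obtain a where a: "ncauchy \<nu> a" "p = lim_pt \<nu> a" using p by (auto simp: P)
    have "(\<lambda>n. comb x (r *\<^sub>R a n)) \<longlonglongrightarrow> r *\<^sub>R f p"
      unfolding comb_scaleR a(2) by (intro tendsto_intros f a)
    then show ?thesis using LIMSEQ_unique[OF f[OF ncauchy_add_scale(2)[OF \<nu>, OF a(1)]]] a by (simp add: nscale_cpl[OF \<nu>])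
  qed
  have bd: "norm (f p) \<le> K * nnorm (cpl \<nu>) p \<and> nnorm (cpl \<nu>) p \<le> K * norm (f p)"
    if p: "p \<in> points (cpl \<nu>)" for p
  proof -
    obtain a where a: "ncauchy \<nu> a" "p = lim_pt \<nu> a" using p by (auto simp: P)
    have 1: "(\<lambda>n. norm (comb x (a n))) \<longlonglongrightarrow> norm (f p)" unfolding a(2) by (intro tendsto_norm f a)
    have 2: "(\<lambda>n. \<nu> (a n)) \<longlonglongrightarrow> nnorm (cpl \<nu>) p" unfolding a(2) by (intro nnorm_cpl \<nu> a)
    show ?thesis
      using LIMSEQ_le[OF 1 tendsto_mult_left[OF 2, of K]] LIMSEQ_le[OF 2 tendsto_mult_left[OF 1, of K]] up lo
      by blast
  qed
  have "inj_on f (points (cpl \<nu>))"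
  proof (rule inj_onI)
    fix p q assume pq: "p \<in> points (cpl \<nu>)" "q \<in> points (cpl \<nu>)" "f p = f q"
    obtain a b where a: "ncauchy \<nu> a" "p = lim_pt \<nu> a" and b: "ncauchy \<nu> b" "q = lim_pt \<nu> b"
      using pq by (auto simp: P)
    have "(\<lambda>n. comb x (a n - b n)) \<longlonglongrightarrow> 0"
      using tendsto_diff[OF f[OF a(1)] f[OF b(1)]] pq(3) a b by simp
    then have "(\<lambda>n. K * norm (comb x (a n - b n))) \<longlonglongrightarrow> 0"
      by (intro tendsto_mult_right_zero tendsto_norm_zero)
    then have "(\<lambda>n. \<nu> (a n - b n)) \<longlonglongrightarrow> 0"
      by (rule Lim_null_comparison[rotated]) (simp add: lo del: comb_simps)
    then show "p = q" using lim_pt_eq_iff[OF \<nu> a(1) b(1)] a b by simp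
  qed
  moreover have "y \<in> f ` points (cpl \<nu>)" for y
  proof -
    have "y \<in> closure (range (comb x))" using r by (simp add: represents_def)
    then obtain z where z: "\<And>n. z n \<in> range (comb x)" "z \<longlonglongrightarrow> y" unfolding closure_sequential by blast
    then have "\<forall>n. \<exists>c. z n = comb x c" by auto
    then obtain a where a: "\<And>n. z n = comb x (a n)" by metis
    have "ncauchy \<nu> a"
      unfolding ncauchy_def
    proof (intro allI impI)
      fix e :: real assume "e > 0"
      then have "e / K > 0" using K by simp
      then obtain N where N: "\<And>m n. m \<ge> N \<Longrightarrow> n \<ge> N \<Longrightarrow> norm (z m - z n) < e / K"
        using LIMSEQ_imp_Cauchy[OF z(2)] by (meson CauchyD)
      have "\<nu> (a m - a n) < e" if "m \<ge> N" "n \<ge> N" for m n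
        using lo[of "a m - a n"] N[OF that] K by (simp add: a field_simps)
      then show "\<exists>N. \<forall>m\<ge>N. \<forall>n\<ge>N. \<nu> (a m - a n) < e" by blast
    qed
    moreover have "(\<lambda>n. comb x (a n)) \<longlonglongrightarrow> y" using z(2) by (simp flip: a)
    with f[OF \<open>ncauchy \<nu> a\<close>] have "y = f (lim_pt \<nu> a)" by (rule LIMSEQ_unique[rotated])
    ultimately show ?thesis by (auto simp: P)
  qed
  ultimately have "bounded_iso K (X_space \<mu>) (space_of_type TYPE('b)) f"
    using add sc bd by (auto simp: bounded_iso_def nlinear_bij_def bij_betw_def X)
  then show ?thesis by blast
qed

lemma bounded_iso_iff_represents:
  assumes "\<mu> \<in> pseudonorms" "K > 0"
  shows "(\<exists>f. bounded_iso K (X_space \<mu>) (space_of_type TYPE('b::banach)) f) \<longleftrightarrow>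
    (\<exists>x :: nat \<Rightarrow> 'b. represents K \<mu> x)"
  using represents_of_bounded_iso[OF assms(1)] bounded_iso_of_represents[OF assms(1)] assms(2)
  by (metis less_imp_le)

section \<open>Quadratic pseudonorms and Gram--Schmidt\<close>

definition mu_of :: "(nat \<Rightarrow> 'b::real_normed_vector) \<Rightarrow> V \<Rightarrow> real" where
  "mu_of x v = norm (comb x (emb v))"

lemma mu_of_pseudonorm: "mu_of x \<in> pseudonorms" and ext_mu_of: "ext (mu_of x) = (\<lambda>c. norm (comb x c))"
  using pseudonorm_of_seminorm[OF seminorm_norm_comb[of x]] by (simp_all add: mu_of_def[abs_def])

lemma represents_mu_of: "closure (range (comb x)) = UNIV \<Longrightarrow> represents 1 (mu_of x) x"
  by (simp add: represents_def mu_of_def)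

lemma pnspace_X_space: "\<mu> \<in> pseudonorms \<Longrightarrow> pnspace (X_space \<mu>)"
  unfolding X_space_eq by (rule pnspace_cpl[OF seminorm_ext])

lemma mu_of_P_infty:
  fixes x :: "nat \<Rightarrow> 'b::banach"
  assumes "closure (range (comb x)) = UNIV" "infinite_dimensional (space_of_type TYPE('b))"
  shows "mu_of x \<in> P_infty"
proof -
  obtain f where "bounded_iso 1 (X_space (mu_of x)) (space_of_type TYPE('b)) f"
    using bounded_iso_of_represents[OF mu_of_pseudonorm represents_mu_of[OF assms(1)]] by auto
  then have "infinite_dimensional (X_space (mu_of x))"
    by (rule infinite_dimensional_iso[OF pnspace_X_space[OF mu_of_pseudonorm] _ assms(2)])
  then show ?thesis by (simp add: P_infty_def mu_of_pseudonorm)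
qed

lemma mu_of_B_norms:
  fixes x :: "nat \<Rightarrow> 'b::banach"
  assumes "closure (range (comb x)) = UNIV" "infinite_dimensional (space_of_type TYPE('b))"
    and "\<And>c. comb x c = 0 \<Longrightarrow> c = 0"
  shows "mu_of x \<in> B_norms"
  using mu_of_P_infty[OF assms(1,2)] assms(3) by (simp add: B_norms_def ext_mu_of)

lemma l2_partial_sums: "(\<lambda>n. \<Sum>i<n. l2_nth x i *\<^sub>R unit_l2 i) \<longlonglongrightarrow> x"
proof -
  define S where "S n = (\<Sum>i<n. l2_nth x i *\<^sub>R unit_l2 i)" for n
  have eq: "(norm (x - S n))\<^sup>2 = (norm x)\<^sup>2 - (\<Sum>i<n. (l2_nth x i)\<^sup>2)" for n
  proof -
    have 1: "inner x (S n) = (\<Sum>i<n. (l2_nth x i)\<^sup>2)"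
      unfolding S_def inner_unit_combination by (simp add: power2_eq_square)
    have "(norm (S n))\<^sup>2 = (\<Sum>i<n. (l2_nth x i)\<^sup>2)"
      unfolding S_def norm_unit_combination by (simp add: sum_nonneg)
    then have 2: "inner (S n) (S n) = (\<Sum>i<n. (l2_nth x i)\<^sup>2)" by (simp only: power2_norm_eq_inner)
    show ?thesis
      unfolding power2_norm_eq_inner inner_diff_left inner_diff_right inner_commute[of "S n" x] 1 2 by simp
  qed
  have "summable (\<lambda>n. (l2_nth x n)\<^sup>2)" using l2_nth[of x] by simp
  then have "(\<lambda>n. \<Sum>i<n. (l2_nth x i)\<^sup>2) \<longlonglongrightarrow> (norm x)\<^sup>2"
    unfolding l2_norm_sq by (rule summable_LIMSEQ)
  then have "(\<lambda>n. (norm (x - S n))\<^sup>2) \<longlonglongrightarrow> (norm x)\<^sup>2 - (norm x)\<^sup>2"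
    unfolding eq by (intro tendsto_diff tendsto_const)
  then have "(\<lambda>n. sqrt ((norm (x - S n))\<^sup>2)) \<longlonglongrightarrow> sqrt 0" by (intro tendsto_real_sqrt) simp
  then have "(\<lambda>n. norm (S n - x)) \<longlonglongrightarrow> 0" by (simp add: norm_minus_commute)
  then show ?thesis by (simp add: S_def LIM_zero_iff tendsto_norm_zero_iff)
qed

lemma l2_dense_of_units:
  assumes "\<And>i. unit_l2 i \<in> range (comb x)"
  shows "closure (range (comb x)) = (UNIV :: l2 set)"
proof -
  have "y \<in> closure (range (comb x))" for y
  proof -
    have "(\<Sum>i<n. l2_nth y i *\<^sub>R unit_l2 i) \<in> range (comb x)" for n
      using assms unfolding range_comb by (intro span_sum span_scale)
    then show ?thesis
      unfolding closure_sequential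
      by (intro exI[of _ "\<lambda>n. \<Sum>i<n. l2_nth y i *\<^sub>R unit_l2 i"] conjI l2_partial_sums allI)
  qed
  then show ?thesis by blast
qed

lemma unit_l2_dense: "closure (range (comb unit_l2)) = UNIV"
  by (rule l2_dense_of_units) (metis comb_bas rangeI)

lemma comb_unit_l2_nth: "l2_nth (comb unit_l2 c) i = lookup c i"
proof -
  have "l2_nth (comb unit_l2 c) i = (\<Sum>k\<in>Poly_Mapping.keys c. if k = i then lookup c k else 0)"
    unfolding comb_def l2_nth_sum by (intro sum.cong) auto
  then show ?thesis by (auto simp: in_keys_iff)
qed

lemma unit_l2_independent: "comb unit_l2 c = 0 \<Longrightarrow> c = 0"
  by (rule poly_mapping_eqI) (metis comb_unit_l2_nth l2_nth_simps(1) lookup_zero)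

text \<open>Polarisation: if the square of \<open>\<nu>\<close> is a quadratic form, this is its
  bilinear form at two basis vectors.\<close>

definition gram :: "(V \<Rightarrow> real) \<Rightarrow> nat \<Rightarrow> nat \<Rightarrow> real" where
  "gram \<nu> i j = ((\<nu> (Poly_Mapping.single i 1 + Poly_Mapping.single j 1))\<^sup>2
    - (\<nu> (Poly_Mapping.single i 1))\<^sup>2 - (\<nu> (Poly_Mapping.single j 1))\<^sup>2) / 2"

text \<open>For each \<open>v\<close> this is a closed condition on finitely many values of
  \<open>\<nu>\<close>. Semidefiniteness of the form is implicit in the square on the left.\<close>

definition quadratic :: "(V \<Rightarrow> real) \<Rightarrow> bool" where
  "quadratic \<nu> \<longleftrightarrow> (\<forall>v. 0 \<le> \<nu> v \<and> (\<nu> v)\<^sup>2 =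
    (\<Sum>i\<in>Poly_Mapping.keys v. \<Sum>j\<in>Poly_Mapping.keys v. of_rat (lookup v i) * of_rat (lookup v j) * gram \<nu> i j))"

lemma keys_emb [simp]: "Poly_Mapping.keys (emb v) = Poly_Mapping.keys v"
  by (auto simp: in_keys_iff)

lemma quadratic_mu_of: "quadratic (mu_of (x :: nat \<Rightarrow> 'h::real_inner))"
proof -
  have g: "gram (mu_of x) i j = inner (x i) (x j)" for i j
    by (simp add: gram_def mu_of_def comb_add power2_norm_eq_inner inner_add_left inner_add_right inner_commute)
  have "(mu_of x v)\<^sup>2 = (\<Sum>i\<in>Poly_Mapping.keys v. \<Sum>j\<in>Poly_Mapping.keys v.
      of_rat (lookup v i) * of_rat (lookup v j) * inner (x i) (x j))" for v
    unfolding mu_of_def power2_norm_eq_inner comb_def inner_sum_left inner_sum_right keys_emb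
    by (intro sum.cong refl) (simp add: inner_commute)
  then show ?thesis unfolding quadratic_def g by (simp add: mu_of_def)
qed

section \<open>Semidefinite forms on \<open>c00\<close>, Gram--Schmidt and realisation in
  \<open>l2\<close>\<close>

definition bform :: "(nat \<Rightarrow> nat \<Rightarrow> real) \<Rightarrow> c00 \<Rightarrow> c00 \<Rightarrow> real" where
  "bform G c d = (\<Sum>i\<in>Poly_Mapping.keys c. \<Sum>j\<in>Poly_Mapping.keys d. lookup c i * lookup d j * G i j)"

lemma bform_comb: "bform G c d = comb (\<lambda>i. comb (\<lambda>j. G i j) d) c"
  by (simp add: bform_def comb_def sum_distrib_left mult.assoc)

lemma bform_sym: "(\<And>i j. G i j = G j i) \<Longrightarrow> bform G c d = bform G d c"
  unfolding bform_def by (subst sum.swap) (simp add: mult_ac)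

text \<open>Supports inside that of \<open>c\<close> keep the range of summation fixed when
  \<open>bform_nonneg\<close> passes to the limit.\<close>

lemma rational_sequence:
  fixes c :: c00
  shows "\<exists>v :: nat \<Rightarrow> V. (\<forall>n. Poly_Mapping.keys (v n) \<subseteq> Poly_Mapping.keys c) \<and>
    (\<forall>i. (\<lambda>n. of_rat (lookup (v n) i)) \<longlonglongrightarrow> lookup c i)"
proof -
  have ex: "\<exists>q. lookup c i < of_rat q \<and> of_rat q < lookup c i + 1 / real (Suc n)" for n i
    by (rule of_rat_dense) simp
  define q where "q n i = (SOME q. lookup c i < of_rat q \<and> of_rat q < lookup c i + 1 / real (Suc n))" for n i
  have q: "lookup c i < of_rat (q n i)" "of_rat (q n i) < lookup c i + 1 / real (Suc n)" for n i
    using someI_ex[OF ex[of i n]] by (simp_all add: q_def)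
  define v where "v n = (\<Sum>i\<in>Poly_Mapping.keys c. Poly_Mapping.single i (q n i))" for n
  have v: "lookup (v n) i = (if i \<in> Poly_Mapping.keys c then q n i else 0)" for n i
  proof -
    have "lookup (v n) i = (\<Sum>k\<in>Poly_Mapping.keys c. if k = i then q n k else 0)"
      unfolding v_def lookup_sum by (intro sum.cong) (auto simp: lookup_single when_def)
    then show ?thesis by simp
  qed
  have "(\<lambda>n. of_rat (lookup (v n) i)) \<longlonglongrightarrow> lookup c i" for i
  proof (cases "i \<in> Poly_Mapping.keys c")
    case True
    have "(\<lambda>n. lookup c i + 1 / real (Suc n)) \<longlonglongrightarrow> lookup c i + 0"
      by (intro tendsto_add tendsto_const LIMSEQ_Suc lim_1_over_n)
    then have lim: "(\<lambda>n. lookup c i + 1 / real (Suc n)) \<longlonglongrightarrow> lookup c i" by simp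
    have "(\<lambda>n. of_rat (q n i)) \<longlonglongrightarrow> lookup c i"
    proof (rule tendsto_sandwich[OF _ _ tendsto_const lim])
      show "\<forall>\<^sub>F n in sequentially. lookup c i \<le> of_rat (q n i)"
        by (intro always_eventually allI less_imp_le q)
      show "\<forall>\<^sub>F n in sequentially. of_rat (q n i) \<le> lookup c i + 1 / real (Suc n)"
        by (intro always_eventually allI less_imp_le q)
    qed
    then show ?thesis using True by (simp add: v)
  next
    case False
    then show ?thesis by (simp add: v in_keys_iff)
  qed
  moreover have "Poly_Mapping.keys (v n) \<subseteq> Poly_Mapping.keys c" for n by (auto simp: v in_keys_iff split: if_splits)
  ultimately show ?thesis by blast
qed

lemma bform_superset:
  assumes "finite A" "Poly_Mapping.keys c \<subseteq> A" "Poly_Mapping.keys d \<subseteq> A"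
  shows "bform G c d = (\<Sum>i\<in>A. \<Sum>j\<in>A. lookup c i * lookup d j * G i j)"
  unfolding bform_comb using assms
  by (simp add: comb_superset[OF assms(1)] sum_distrib_left mult.assoc)

lemma bform_nonneg:
  assumes "\<And>v. 0 \<le> bform G (emb v) (emb v)"
  shows "0 \<le> bform G c c"
proof -
  obtain v where v: "\<forall>n. Poly_Mapping.keys (v n) \<subseteq> Poly_Mapping.keys c"
    "\<forall>i. (\<lambda>n. of_rat (lookup (v n) i)) \<longlonglongrightarrow> lookup c i"
    using rational_sequence[of c] by (elim exE conjE)
  have "bform G (emb (v n)) (emb (v n)) = (\<Sum>i\<in>Poly_Mapping.keys c. \<Sum>j\<in>Poly_Mapping.keys c.
      of_rat (lookup (v n) i) * of_rat (lookup (v n) j) * G i j)" for n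
    using v(1) by (subst bform_superset[of "Poly_Mapping.keys c"]) auto
  then have "(\<lambda>n. bform G (emb (v n)) (emb (v n))) \<longlonglongrightarrow> bform G c c"
    unfolding bform_def[of G c c] by (simp only:) (intro tendsto_intros v(2)[rule_format])
  then show ?thesis by (rule LIMSEQ_le_const) (use assms in auto)
qed

text \<open>Gram--Schmidt for a positive semidefinite form; a vector of length \<open>0\<close> is replaced by \<open>0\<close>,
  because \<open>1 / sqrt 0 = 0\<close>.\<close>
function gs :: "(nat \<Rightarrow> nat \<Rightarrow> real) \<Rightarrow> nat \<Rightarrow> c00" where
  "gs G n = (let r = bas n - (\<Sum>k<n. bform G (bas n) (gs G k) *\<^sub>R gs G k) in (1 / sqrt (bform G r r)) *\<^sub>R r)"
  by pat_completeness auto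
termination by (relation "Wellfounded.measure snd") auto

declare gs.simps [simp del]

context
  fixes G :: "nat \<Rightarrow> nat \<Rightarrow> real"
  assumes sym: "\<And>i j. G i j = G j i" and psd: "\<And>c. 0 \<le> bform G c c"
begin

abbreviation ipG where "ipG \<equiv> bform G"

lemma B_commute: "ipG c d = ipG d c"
  by (rule bform_sym[OF sym])

lemma B_simps [simp]: "ipG (c + c') d = ipG c d + ipG c' d" "ipG (c - c') d = ipG c d - ipG c' d"
  "ipG (r *\<^sub>R c) d = r * ipG c d" "ipG 0 d = 0"
  unfolding bform_comb by (simp_all add: comb_add comb_scaleR)

lemma B_sum: "ipG (sum f A) d = (\<Sum>i\<in>A. ipG (f i) d)"
  unfolding bform_comb by (rule comb_sum)

lemma B_right [simp]: "ipG d (c + c') = ipG d c + ipG d c'" "ipG d (c - c') = ipG d c - ipG d c'"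
  "ipG d (r *\<^sub>R c) = r * ipG d c" "ipG d 0 = 0"
  by (simp_all add: B_commute[of d])

lemma B_Cauchy_Schwarz: "(ipG c d)\<^sup>2 \<le> ipG c c * ipG d d"
proof (cases "ipG d d = 0")
  case True
  have "ipG c d = 0"
  proof (rule ccontr)
    assume ne: "ipG c d \<noteq> 0"
    \<comment> \<open>As \<open>d\<close> has length 0, the form at \<open>c + t *\<^sub>R d\<close>
      is affine in \<open>t\<close>; this value makes it -1.\<close>
    define t where "t = - (ipG c c + 1) / (2 * ipG c d)"
    have "ipG (c + t *\<^sub>R d) (c + t *\<^sub>R d) = ipG c c + 2 * t * ipG c d"
      using True by (simp add: B_commute[of d c])
    also have "\<dots> = -1" using ne by (simp add: t_def field_simps)
    finally show False using psd[of "c + t *\<^sub>R d"] by simp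
  qed
  then show ?thesis using psd by simp
next
  case False
  then have pos: "ipG d d > 0" using psd[of d] by simp
  have "0 \<le> ipG (ipG d d *\<^sub>R c - ipG c d *\<^sub>R d) (ipG d d *\<^sub>R c - ipG c d *\<^sub>R d)" by (rule psd)
  also have "\<dots> = ipG d d * (ipG c c * ipG d d - (ipG c d)\<^sup>2)"
    by (simp add: B_commute[of d c] algebra_simps power2_eq_square)
  finally show ?thesis using pos by (simp add: zero_le_mult_iff)
qed

lemma seminorm_sqrt_B: "seminorm (\<lambda>c. sqrt (ipG c c))"
proof
  fix c d :: c00 and r :: real
  have "\<bar>ipG c d\<bar> \<le> sqrt (ipG c c * ipG d d)" using real_sqrt_le_mono[OF B_Cauchy_Schwarz[of c d]] by simp
  then have "ipG c d \<le> sqrt (ipG c c) * sqrt (ipG d d)" by (simp add: real_sqrt_mult)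
  then have "ipG (c + d) (c + d) \<le> (sqrt (ipG c c) + sqrt (ipG d d))\<^sup>2"
    using psd by (simp add: power2_sum B_commute[of d c])
  then show "sqrt (ipG (c + d) (c + d)) \<le> sqrt (ipG c c) + sqrt (ipG d d)"
    using psd by (intro real_le_lsqrt) auto
  show "sqrt (ipG (r *\<^sub>R c) (r *\<^sub>R c)) = \<bar>r\<bar> * sqrt (ipG c c)"
    by (simp add: real_sqrt_mult flip: mult.assoc)
qed

abbreviation onG where "onG \<equiv> gs G"

lemma gs_orthonormal:
  "(\<forall>m<n. ipG (onG n) (onG m) = 0) \<and> (onG n \<noteq> 0 \<longrightarrow> ipG (onG n) (onG n) = 1)"
proof (induction n rule: less_induct)
  case (less n)
  define r where "r = bas n - (\<Sum>k<n. ipG (bas n) (onG k) *\<^sub>R onG k)"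
  have bn: "onG n = (1 / sqrt (ipG r r)) *\<^sub>R r" by (subst gs.simps) (simp add: r_def Let_def)
  have orth: "ipG (onG k) (onG m) = 0" if "k < n" "m < n" "k \<noteq> m" for k m
    using less.IH[OF that(1)] less.IH[OF that(2)] that B_commute[of "onG k" "onG m"] by (cases "k < m") auto
  have "ipG r (onG m) = 0" if m: "m < n" for m
  proof -
    have "(\<Sum>k<n. ipG (bas n) (onG k) * ipG (onG k) (onG m)) = (\<Sum>k<n. if k = m then ipG (bas n) (onG m) * ipG (onG m) (onG m) else 0)"
      using orth m by (intro sum.cong) auto
    then have "ipG r (onG m) = ipG (bas n) (onG m) - ipG (bas n) (onG m) * ipG (onG m) (onG m)"
      using m by (simp add: r_def B_sum)
    then show ?thesis using less.IH[OF m] by (cases "onG m = 0") auto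
  qed
  moreover have "ipG (onG n) (onG n) = 1" if "onG n \<noteq> 0"
  proof -
    have "ipG r r \<noteq> 0" using that bn by auto
    then have "ipG r r > 0" using psd[of r] by simp
    then show ?thesis by (simp add: bn field_simps)
  qed
  ultimately show ?case by (simp add: bn)
qed

lemma b_orth: "m \<noteq> n \<Longrightarrow> ipG (onG m) (onG n) = 0"
  using gs_orthonormal[of m] gs_orthonormal[of n] B_commute[of "onG m" "onG n"] by (cases "m < n") auto

lemma b_norm: "onG n \<noteq> 0 \<Longrightarrow> ipG (onG n) (onG n) = 1"
  using gs_orthonormal by blast

text \<open>The residue \<open>r\<close> of the projection may be a nonzero vector of length 0.
  Cauchy--Schwarz then makes it orthogonal to everything, so the expansion holds inside the form
  although it can fail in \<open>c00\<close>.\<close>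

lemma basis_expansion: "ipG (bas n) y = (\<Sum>k\<le>n. ipG (bas n) (onG k) * ipG (onG k) y)"
proof -
  define r where "r = bas n - (\<Sum>k<n. ipG (bas n) (onG k) *\<^sub>R onG k)"
  have bn: "onG n = (1 / sqrt (ipG r r)) *\<^sub>R r" by (subst gs.simps) (simp add: r_def Let_def)
  have ex: "bas n = r + (\<Sum>k<n. ipG (bas n) (onG k) *\<^sub>R onG k)" by (simp add: r_def)
  have "ipG (bas n) (onG n) = ipG r (onG n) + (\<Sum>k<n. ipG (bas n) (onG k) * ipG (onG k) (onG n))"
    using arg_cong[OF ex, of "\<lambda>c. ipG c (onG n)"] by (simp only: B_simps B_sum)
  also have "(\<Sum>k<n. ipG (bas n) (onG k) * ipG (onG k) (onG n)) = 0" by (intro sum.neutral) (simp add: b_orth)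
  finally have c: "ipG (bas n) (onG n) = ipG r (onG n)" by simp
  have "ipG r y = ipG r (onG n) * ipG (onG n) y"
  proof (cases "ipG r r = 0")
    case True
    then have "(ipG r y)\<^sup>2 \<le> 0" using B_Cauchy_Schwarz[of r y] by simp
    then show ?thesis using True bn by simp
  next
    case False
    then have pos: "ipG r r > 0" using psd[of r] by simp
    then have "sqrt (ipG r r) * sqrt (ipG r r) = ipG r r" by simp
    then show ?thesis using pos by (simp add: bn field_simps)
  qed
  moreover have "ipG (bas n) y = ipG r y + (\<Sum>k<n. ipG (bas n) (onG k) * ipG (onG k) y)"
    using arg_cong[OF ex, of "\<lambda>c. ipG c y"] by (simp only: B_simps B_sum)
  ultimately have "ipG (bas n) y = (\<Sum>k<n. ipG (bas n) (onG k) * ipG (onG k) y) + ipG (bas n) (onG n) * ipG (onG n) y"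
    using c by simp
  then show ?thesis by (simp add: lessThan_Suc_atMost[symmetric])
qed

lemma b_beyond: "n < k \<Longrightarrow> ipG (bas n) (onG k) = 0"
  by (subst basis_expansion) (auto intro!: sum.neutral simp: b_orth)

lemma basis_expansion_upto: "n < M \<Longrightarrow> ipG (bas n) y = (\<Sum>k<M. ipG (bas n) (onG k) * ipG (onG k) y)"
  by (subst basis_expansion, rule sum.mono_neutral_left) (auto simp: b_beyond)

lemma expansion:
  assumes "Poly_Mapping.keys c \<subseteq> {..<M}"
  shows "ipG c y = (\<Sum>k<M. ipG c (onG k) * ipG (onG k) y)"
proof -
  have ex: "c = (\<Sum>i\<in>{..<M}. lookup c i *\<^sub>R bas i)" using assms by (simp add: c00_expand)
  have Bc: "ipG c z = (\<Sum>i<M. lookup c i * ipG (bas i) z)" for z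
    using arg_cong[OF ex, of "\<lambda>c. ipG c z"] by (simp add: B_sum)
  have "ipG c y = (\<Sum>i<M. lookup c i * (\<Sum>k<M. ipG (bas i) (onG k) * ipG (onG k) y))"
    unfolding Bc by (intro sum.cong refl arg_cong2[of _ _ _ _ "(*)"] basis_expansion_upto) simp
  also have "\<dots> = (\<Sum>k<M. \<Sum>i<M. lookup c i * (ipG (bas i) (onG k) * ipG (onG k) y))"
    unfolding sum_distrib_left by (rule sum.swap)
  also have "\<dots> = (\<Sum>k<M. ipG c (onG k) * ipG (onG k) y)"
    unfolding Bc by (simp add: sum_distrib_right mult.assoc)
  finally show ?thesis .
qed

end

lemma keys_bounded: "\<exists>M. Poly_Mapping.keys (c :: c00) \<subseteq> {..<M}"
  using finite_nat_set_iff_bounded[of "Poly_Mapping.keys c"] by auto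

context
  fixes G :: "nat \<Rightarrow> nat \<Rightarrow> real"
  assumes sym: "\<And>i j. G i j = G j i" and psd: "\<And>c. 0 \<le> bform G c c"
begin

lemma bform_basis: "bform G c z = (\<Sum>i\<in>Poly_Mapping.keys c. lookup c i * bform G (bas i) z)"
  by (simp add: bform_comb comb_def)

lemma bform_gs_beyond:
  assumes "Poly_Mapping.keys c \<subseteq> {..<M}" "M \<le> k"
  shows "bform G c (gs G k) = 0"
  unfolding bform_basis[of c] using assms
  by (intro sum.neutral) (auto intro!: b_beyond[OF sym psd])

text \<open>\<open>x m\<close> lists the coefficients of \<open>bas m\<close> with respect to the
  nonzero Gram--Schmidt vectors, renumbered by \<open>\<sigma>\<close>. Those vectors are mapped to
  the unit vectors, which gives density, and Parseval's identity gives the norm.\<close>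

lemma gram_vectors:
  assumes inf: "infinite {k. gs G k \<noteq> 0}"
  shows "\<exists>x :: nat \<Rightarrow> l2. closure (range (comb x)) = UNIV \<and> (\<forall>c. norm (comb x c) = sqrt (bform G c c))"
proof -
  define \<sigma> where "\<sigma> = enumerate {k. gs G k \<noteq> 0}"
  have ge: "k \<le> \<sigma> k" for k unfolding \<sigma>_def by (rule le_enumerate[OF inf])
  have inJ: "gs G (\<sigma> k) \<noteq> 0" for k using enumerate_in_set[OF inf, of k] by (simp add: \<sigma>_def)
  have inj: "inj \<sigma>" unfolding \<sigma>_def using strict_mono_enumerate[OF inf] by (rule strict_mono_imp_inj_on)
  have surj: "\<exists>k. j = \<sigma> k" if "gs G j \<noteq> 0" for j
  proof -
    have "\<exists>n. \<sigma> n = j" unfolding \<sigma>_def by (rule enumerate_Ex[OF inf]) (use that in simp)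
    then show ?thesis by blast
  qed
  \<comment> \<open>As \<open>k \<le> \<sigma> k\<close>, the coefficients with \<open>k > m\<close>
    vanish, so \<open>m + 1\<close> terms capture them all.\<close>
  define x where "x m = (\<Sum>k<m + 1. bform G (bas m) (gs G (\<sigma> k)) *\<^sub>R unit_l2 k)" for m
  have nth: "l2_nth (x m) k = bform G (bas m) (gs G (\<sigma> k))" for m k
  proof (cases "k < m + 1")
    case True
    then show ?thesis unfolding x_def by (rule nth_unit_combination)
  next
    case False
    then have "m < \<sigma> k" using ge[of k] by simp
    moreover have "l2_nth (x m) k = 0"
      using False unit_combination_Efin[of _ "m + 1"] by (simp only: x_def Efin_def) simp
    ultimately show ?thesis using b_beyond[OF sym psd] by simp
  qed
  have cnth: "l2_nth (comb x c) k = bform G c (gs G (\<sigma> k))" for c k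
    unfolding bform_basis[of c] by (simp add: comb_def nth)
  have "unit_l2 j \<in> range (comb x)" for j
  proof -
    have "comb x (gs G (\<sigma> j)) = unit_l2 j"
    proof (rule l2_eqI)
      fix k
      show "l2_nth (comb x (gs G (\<sigma> j))) k = l2_nth (unit_l2 j) k"
        using b_norm[OF sym psd inJ[of j]] b_orth[OF sym psd, of "\<sigma> j" "\<sigma> k"] inj
        by (auto simp: cnth inj_eq)
    qed
    then show ?thesis by (metis rangeI)
  qed
  then have dense: "closure (range (comb x)) = UNIV" by (rule l2_dense_of_units)
  have "norm (comb x c) = sqrt (bform G c c)" for c
  proof -
    obtain M where M: "Poly_Mapping.keys c \<subseteq> {..<M}" using keys_bounded by blast
    define h where "h k = (bform G c (gs G k))\<^sup>2" for k
    have hM: "h k = 0" if "\<not> k < M" for k using bform_gs_beyond[OF M, of k] that by (simp add: h_def)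
    have "comb x c \<in> Efin M"
      using bform_gs_beyond[OF M] ge by (auto simp: Efin_def cnth intro: order_trans)
    then have "(norm (comb x c))\<^sup>2 = (\<Sum>k<M. h (\<sigma> k))" by (simp only: Efin_norm cnth h_def)
    also have "\<dots> = sum h (\<sigma> ` {..<M})"
      using inj by (subst sum.reindex) (auto intro: inj_on_subset)
    also have "\<dots> = sum h ({..<M} \<inter> \<sigma> ` {..<M})"
      by (rule sum.mono_neutral_right) (use hM in blast)+
    also have "\<dots> = sum h {..<M}"
    proof (rule sum.mono_neutral_left)
      show "\<forall>i\<in>{..<M} - {..<M} \<inter> \<sigma> ` {..<M}. h i = 0"
      proof
        fix i assume i: "i \<in> {..<M} - {..<M} \<inter> \<sigma> ` {..<M}"
        have "gs G i = 0"
        proof (rule ccontr)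
          assume "gs G i \<noteq> 0"
          then obtain k where "i = \<sigma> k" using surj by blast
          moreover from this have "k < M" using ge[of k] i by simp
          ultimately show False using i by auto
        qed
        then show "h i = 0" by (simp add: h_def B_right[OF sym psd])
      qed
    qed auto
    also have "\<dots> = bform G c c"
      unfolding expansion[OF sym psd M, of c] h_def
      by (intro sum.cong refl) (simp add: power2_eq_square B_commute[OF sym psd, of "gs G _" c])
    finally show ?thesis by (metis norm_ge_zero real_sqrt_unique)
  qed
  with dense show ?thesis by blast
qed

end

text \<open>Along a Cauchy sequence the finitely many coefficients against nonzero Gram--Schmidt
  vectors converge. By Parseval the combination with the limit coefficients represents the same
  point of the completion.\<close>

lemma finite_rank_finite_dimensional:
  assumes sym: "\<And>i j. G i j = G j i" and psd: "\<And>c. 0 \<le> bform G c c"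
    and \<nu>: "seminorm \<nu>" and K: "K > 0"
    and up: "\<And>c. \<nu> c \<le> K * sqrt (bform G c c)" and lo: "\<And>c. sqrt (bform G c c) \<le> K * \<nu> c"
    and fin: "finite {k. gs G k \<noteq> 0}"
  shows "\<not> infinite_dimensional (cpl \<nu>)"
proof -
  let ?J = "{k. gs G k \<noteq> 0}"
  let ?B = "bform G"
  let ?pt = "\<lambda>c. lim_pt \<nu> (\<lambda>_. c)"
  \<comment> \<open>\<open>nspan\<close> of the empty set is empty, so the zero point is included to
    supply the empty combination.\<close>
  define D where "D = insert (?pt 0) ((\<lambda>k. ?pt (gs G k)) ` ?J)"
  have finD: "finite D" using fin by (simp add: D_def)
  have subD: "D \<subseteq> points (cpl \<nu>)" by (auto simp: D_def lim_pt_const_points[OF \<nu>])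
  have spanD: "?pt (\<Sum>k\<in>A. \<beta> k *\<^sub>R gs G k) \<in> nspan (cpl \<nu>) D" if "finite A" "A \<subseteq> ?J" for A \<beta>
    using that
  proof (induction A rule: finite_induct)
    case empty
    show ?case by (rule nspan.base) (simp add: D_def)
  next
    case (insert k A)
    have "nscale (cpl \<nu>) (\<beta> k) (?pt (gs G k)) \<in> nspan (cpl \<nu>) D"
      using insert.prems by (intro nspan.scale nspan.base) (auto simp: D_def)
    then have "nadd (cpl \<nu>) (?pt (\<beta> k *\<^sub>R gs G k)) (?pt (\<Sum>k\<in>A. \<beta> k *\<^sub>R gs G k)) \<in> nspan (cpl \<nu>) D"
      using insert by (intro nspan.add) (simp_all add: lim_pt_scale_add[OF \<nu>])
    then show ?case using insert by (simp add: lim_pt_scale_add[OF \<nu>])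
  qed
  have parseval: "?B d d = (\<Sum>k\<in>?J. (?B d (gs G k))\<^sup>2)" for d
  proof -
    obtain M where M: "Poly_Mapping.keys d \<subseteq> {..<M}" "?J \<subseteq> {..<M}"
    proof -
      have "finite (Poly_Mapping.keys d \<union> ?J)" using fin by simp
      then obtain M where "\<forall>i\<in>Poly_Mapping.keys d \<union> ?J. i < M"
        using finite_nat_set_iff_bounded by blast
      then show thesis by (intro that[of M]) auto
    qed
    have "?B d d = (\<Sum>k<M. (?B d (gs G k))\<^sup>2)"
      unfolding expansion[OF sym psd M(1), of d]
      by (intro sum.cong refl) (simp add: power2_eq_square B_commute[OF sym psd, of "gs G _" d])
    also have "\<dots> = (\<Sum>k\<in>?J. (?B d (gs G k))\<^sup>2)"
      using M(2) by (intro sum.mono_neutral_right) (auto simp: B_right[OF sym psd])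
    finally show ?thesis .
  qed
  have "p \<in> nspan (cpl \<nu>) D" if p: "p \<in> points (cpl \<nu>)" for p
  proof -
    obtain a where a: "ncauchy \<nu> a" "p = lim_pt \<nu> a" using p by (auto simp: points_cpl[OF \<nu>])
    have "\<exists>l. (\<lambda>n. ?B (a n) (gs G k)) \<longlonglongrightarrow> l" if k: "gs G k \<noteq> 0" for k
    proof -
      have le: "\<bar>?B c (gs G k)\<bar> \<le> K * \<nu> c" for c
      proof -
        have "(?B c (gs G k))\<^sup>2 \<le> ?B c c"
          using B_Cauchy_Schwarz[OF sym psd, of c "gs G k"] b_norm[OF sym psd k] by simp
        then have "\<bar>?B c (gs G k)\<bar> \<le> sqrt (?B c c)" by (rule real_le_rsqrt[of "\<bar>_\<bar>", simplified])
        then show ?thesis using lo[of c] by linarith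
      qed
      have "Cauchy (\<lambda>n. ?B (a n) (gs G k))"
      proof (rule metric_CauchyI)
        fix e :: real assume "e > 0"
        then have "e / K > 0" using K by simp
        then obtain N where N: "\<And>m n. m \<ge> N \<Longrightarrow> n \<ge> N \<Longrightarrow> \<nu> (a m - a n) < e / K"
          using a(1) unfolding ncauchy_def by meson
        have "dist (?B (a m) (gs G k)) (?B (a n) (gs G k)) < e" if "m \<ge> N" "n \<ge> N" for m n
          using le[of "a m - a n"] N[OF that] K by (simp add: dist_real_def B_simps[OF sym psd] field_simps)
        then show "\<exists>N. \<forall>m\<ge>N. \<forall>n\<ge>N. dist (?B (a m) (gs G k)) (?B (a n) (gs G k)) < e" by blast
      qed
      then show ?thesis using Cauchy_convergent convergent_def by blast
    qed
    then obtain \<beta> where \<beta>: "\<And>k. gs G k \<noteq> 0 \<Longrightarrow> (\<lambda>n. ?B (a n) (gs G k)) \<longlonglongrightarrow> \<beta> k" by metis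
    define c where "c = (\<Sum>k\<in>?J. \<beta> k *\<^sub>R gs G k)"
    have Bc: "?B c (gs G k) = \<beta> k" if k: "k \<in> ?J" for k
    proof -
      have "?B c (gs G k) = (\<Sum>i\<in>?J. \<beta> i * ?B (gs G i) (gs G k))"
        by (simp add: c_def B_sum[OF sym psd] B_simps[OF sym psd])
      also have "\<dots> = (\<Sum>i\<in>?J. if i = k then \<beta> k else 0)"
        using k by (intro sum.cong refl) (auto simp: b_norm[OF sym psd] b_orth[OF sym psd])
      finally show ?thesis using fin k by simp
    qed
    have "(\<lambda>n. \<Sum>k\<in>?J. (?B (a n) (gs G k) - \<beta> k)\<^sup>2) \<longlonglongrightarrow> (\<Sum>k\<in>?J. (\<beta> k - \<beta> k)\<^sup>2)"
      by (intro tendsto_sum tendsto_power tendsto_diff tendsto_const \<beta>) simp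
    moreover have "?B (a n - c) (a n - c) = (\<Sum>k\<in>?J. (?B (a n) (gs G k) - \<beta> k)\<^sup>2)" for n
      unfolding parseval by (intro sum.cong refl) (simp add: B_simps[OF sym psd] Bc)
    ultimately have "(\<lambda>n. ?B (a n - c) (a n - c)) \<longlonglongrightarrow> 0" by simp
    then have "(\<lambda>n. K * sqrt (?B (a n - c) (a n - c))) \<longlonglongrightarrow> 0"
      using tendsto_real_sqrt by (intro tendsto_mult_right_zero) fastforce
    then have "(\<lambda>n. \<nu> (a n - c)) \<longlonglongrightarrow> 0"
      by (rule Lim_null_comparison[rotated]) (simp add: up seminorm.nonneg[OF \<nu>])
    then have "p = ?pt c" using lim_pt_eq_iff[OF \<nu> a(1) ncauchy_const[OF \<nu>], of c] a(2) by simp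
    then show ?thesis using spanD[OF fin order_refl] by (simp add: c_def)
  qed
  moreover have "nspan (cpl \<nu>) D \<subseteq> points (cpl \<nu>)"
  proof
    fix p assume "p \<in> nspan (cpl \<nu>) D"
    then show "p \<in> points (cpl \<nu>)"
      using subD pnspace.add_closed[OF pnspace_cpl[OF \<nu>]] pnspace.scale_closed[OF pnspace_cpl[OF \<nu>]]
      by induction auto
  qed
  ultimately have "nspan (cpl \<nu>) D = points (cpl \<nu>)" by blast
  then show ?thesis using finD subD unfolding infinite_dimensional_def by blast
qed

text \<open>Membership is closed in \<open>\<mu>\<close>: the quotient of the two pseudonorms ranges over a compact product,
  along which one can project.\<close>
definition quad_equiv :: "real \<Rightarrow> (V \<Rightarrow> real) \<Rightarrow> bool" where
  "quad_equiv K \<mu> \<longleftrightarrow> (\<exists>\<nu>. quadratic \<nu> \<and> (\<forall>v. \<nu> v \<le> K * \<mu> v \<and> \<mu> v \<le> K * \<nu> v))"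

text \<open>Infinite dimension excludes forms of finite rank, which satisfy
  \<open>quad_equiv\<close> as well but yield only a finite-dimensional Euclidean space.\<close>

lemma represents_l2_iff:
  assumes \<mu>: "\<mu> \<in> P_infty" and K: "K > 0"
  shows "(\<exists>x :: nat \<Rightarrow> l2. represents K \<mu> x) \<longleftrightarrow> quad_equiv K \<mu>"
proof
  assume "\<exists>x :: nat \<Rightarrow> l2. represents K \<mu> x"
  then obtain x :: "nat \<Rightarrow> l2" where "represents K \<mu> x" by blast
  then show "quad_equiv K \<mu>"
    unfolding quad_equiv_def using quadratic_mu_of[of x]
    by (intro exI[of _ "mu_of x"]) (simp add: represents_def mu_of_def)
next
  assume "quad_equiv K \<mu>"
  then obtain \<nu> where q: "quadratic \<nu>" and bd: "\<And>v. \<nu> v \<le> K * \<mu> v" "\<And>v. \<mu> v \<le> K * \<nu> v"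
    by (auto simp: quad_equiv_def)
  have pn: "\<mu> \<in> pseudonorms" and inf: "infinite_dimensional (cpl (ext \<mu>))"
    using \<mu> by (auto simp: P_infty_def X_space_eq)
  define G where "G = gram \<nu>"
  have sym: "G i j = G j i" for i j by (simp add: G_def gram_def add.commute)
  have Bv: "bform G (emb v) (emb v) = (\<nu> v)\<^sup>2" for v
    using q by (simp add: bform_def quadratic_def G_def)
  have psd: "0 \<le> bform G c c" for c by (rule bform_nonneg) (simp add: Bv)
  have nn: "0 \<le> \<nu> v" for v using q by (simp add: quadratic_def)
  note s = seminorm_sqrt_B[of G, OF sym psd]
  have up: "ext \<mu> c \<le> K * sqrt (bform G c c)" for c
    by (rule seminorm_bound_extend[OF seminorm_ext[OF pn] s]) (use K bd nn in \<open>simp_all add: ext_emb[OF pn] Bv\<close>)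
  have lo: "sqrt (bform G c c) \<le> K * ext \<mu> c" for c
    by (rule seminorm_bound_extend[OF s seminorm_ext[OF pn]]) (use K bd nn in \<open>simp_all add: ext_emb[OF pn] Bv\<close>)
  have "infinite {k. gs G k \<noteq> 0}"
    using finite_rank_finite_dimensional[of G, OF sym psd seminorm_ext[OF pn] K up lo] inf by blast
  from gram_vectors[of G, OF sym psd this] obtain x :: "nat \<Rightarrow> l2"
    where x: "closure (range (comb x)) = UNIV" "\<And>c. norm (comb x c) = sqrt (bform G c c)" by blast
  have "represents K \<mu> x"
    using x(1) bd nn by (simp add: represents_def x(2) Bv)
  then show "\<exists>x :: nat \<Rightarrow> l2. represents K \<mu> x" by blast
qed

lemma closed_quadratic: "closed {\<nu>. quadratic \<nu>}"
  unfolding quadratic_def gram_def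
  by (intro closed_Collect_all closed_Collect_conj closed_Collect_le closed_Collect_eq continuous_intros
      continuous_on_product_coordinates) auto

lemma quad_equiv_iff_ratio:
  assumes nn: "\<And>v. 0 \<le> \<mu> v" and K: "K \<ge> 1"
  shows "quad_equiv K \<mu> \<longleftrightarrow> (\<exists>\<rho>. (\<forall>v. \<rho> v \<in> {1 / K..K}) \<and> quadratic (\<lambda>v. \<rho> v * \<mu> v))"
proof
  assume "quad_equiv K \<mu>"
  then obtain \<nu> where q: "quadratic \<nu>" and bd: "\<And>v. \<nu> v \<le> K * \<mu> v" "\<And>v. \<mu> v \<le> K * \<nu> v"
    by (auto simp: quad_equiv_def)
  \<comment> \<open>Where \<open>\<mu>\<close> vanishes, so does \<open>\<nu>\<close>, and the
    quotient is free; 1 belongs to the interval because \<open>K \<ge> 1\<close>.\<close>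
  define \<rho> where "\<rho> v = (if \<mu> v = 0 then 1 else \<nu> v / \<mu> v)" for v
  have "\<rho> v * \<mu> v = \<nu> v" for v
    using bd[of v] q by (auto simp: \<rho>_def quadratic_def intro: antisym)
  moreover have "\<rho> v \<in> {1 / K..K}" for v
  proof (cases "\<mu> v = 0")
    case False
    then have "\<mu> v > 0" using nn[of v] by simp
    then show ?thesis using bd[of v] K by (simp add: \<rho>_def field_simps)
  qed (use K in \<open>simp add: \<rho>_def\<close>)
  ultimately show "\<exists>\<rho>. (\<forall>v. \<rho> v \<in> {1 / K..K}) \<and> quadratic (\<lambda>v. \<rho> v * \<mu> v)"
    using q by (intro exI[of _ \<rho>]) simp
next
  assume "\<exists>\<rho>. (\<forall>v. \<rho> v \<in> {1 / K..K}) \<and> quadratic (\<lambda>v. \<rho> v * \<mu> v)"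
  then obtain \<rho> where \<rho>: "\<And>v. 1 / K \<le> \<rho> v" "\<And>v. \<rho> v \<le> K" and q: "quadratic (\<lambda>v. \<rho> v * \<mu> v)" by auto
  have "\<rho> v * \<mu> v \<le> K * \<mu> v" "\<mu> v \<le> K * (\<rho> v * \<mu> v)" for v
  proof -
    show "\<rho> v * \<mu> v \<le> K * \<mu> v" using \<rho>(2) nn by (rule mult_right_mono)
    have "1 \<le> K * \<rho> v" using \<rho>(1)[of v] K by (simp add: field_simps)
    then have "1 * \<mu> v \<le> K * \<rho> v * \<mu> v" using nn by (rule mult_right_mono)
    then show "\<mu> v \<le> K * (\<rho> v * \<mu> v)" by simp
  qed
  with q show "quad_equiv K \<mu>" unfolding quad_equiv_def by blast
qed

lemma closed_quad_equiv:
  assumes K: "K \<ge> 1"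
  shows "closed {\<mu>. (\<forall>v. 0 \<le> \<mu> v) \<and> quad_equiv K \<mu>}"
proof -
  define R where "R = (PiE UNIV (\<lambda>_. {1 / K..K}) :: (V \<Rightarrow> real) set)"
  have R: "compact R"
    unfolding R_def compactin_euclidean_iff[symmetric] euclidean_product_topology[symmetric] compactin_PiE
    by simp
  define C where "C = {p :: (V \<Rightarrow> real) \<times> (V \<Rightarrow> real). quadratic (\<lambda>v. fst p v * snd p v)}"
  have "continuous_on UNIV (\<lambda>p :: (V \<Rightarrow> real) \<times> (V \<Rightarrow> real). (\<lambda>v. fst p v * snd p v))"
  proof (rule continuous_on_coordinatewise_then_product)
    fix v
    have "continuous_on UNIV (\<lambda>p :: (V \<Rightarrow> real) \<times> (V \<Rightarrow> real). fst p v)"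
      by (rule continuous_on_compose2[of UNIV "\<lambda>f. f v" UNIV fst]) (auto intro: continuous_on_fst)
    moreover have "continuous_on UNIV (\<lambda>p :: (V \<Rightarrow> real) \<times> (V \<Rightarrow> real). snd p v)"
      by (rule continuous_on_compose2[of UNIV "\<lambda>f. f v" UNIV snd]) (auto intro: continuous_on_snd)
    ultimately show "continuous_on UNIV (\<lambda>p :: (V \<Rightarrow> real) \<times> (V \<Rightarrow> real). fst p v * snd p v)"
      by (rule continuous_on_mult)
  qed
  then have "closed C"
    unfolding C_def using closed_vimage[OF closed_quadratic] by (simp add: vimage_def)
  then have "closedin (top_of_set (R \<times> UNIV)) (C \<inter> (R \<times> UNIV))" by (subst Int_commute) (rule closedin_closed_Int)
  then have "closedin (prod_topology (top_of_set R) euclidean) (C \<inter> (R \<times> UNIV))"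
    using prod_topology_subtopology_eu[of R "UNIV :: (V \<Rightarrow> real) set"] by simp
  moreover have "compact_space (top_of_set R)"
    using R by (simp add: compact_space_subtopology)
  ultimately have "closedin euclidean (snd ` (C \<inter> (R \<times> UNIV)))"
    using closed_map_snd[of "top_of_set R" "euclidean :: (V \<Rightarrow> real) topology"] unfolding closed_map_def by blast
  then have "closed (snd ` (C \<inter> (R \<times> UNIV)))" by simp
  moreover have "closed {\<mu> :: V \<Rightarrow> real. \<forall>v. 0 \<le> \<mu> v}"
    by (intro closed_Collect_all closed_Collect_le continuous_intros continuous_on_product_coordinates)
  ultimately have "closed ({\<mu>. \<forall>v. 0 \<le> \<mu> v} \<inter> snd ` (C \<inter> (R \<times> UNIV)))" by (rule closed_Int[rotated])
  also have "{\<mu>. \<forall>v. 0 \<le> \<mu> v} \<inter> snd ` (C \<inter> (R \<times> UNIV)) = {\<mu>. (\<forall>v. 0 \<le> \<mu> v) \<and> quad_equiv K \<mu>}"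
  proof -
    have "\<mu> \<in> snd ` (C \<inter> (R \<times> UNIV)) \<longleftrightarrow> (\<exists>\<rho>. \<rho> \<in> R \<and> quadratic (\<lambda>v. \<rho> v * \<mu> v))" for \<mu>
    proof
      assume "\<mu> \<in> snd ` (C \<inter> (R \<times> UNIV))"
      then show "\<exists>\<rho>. \<rho> \<in> R \<and> quadratic (\<lambda>v. \<rho> v * \<mu> v)" by (auto simp: C_def)
    next
      assume "\<exists>\<rho>. \<rho> \<in> R \<and> quadratic (\<lambda>v. \<rho> v * \<mu> v)"
      then obtain \<rho> where "(\<rho>, \<mu>) \<in> C \<inter> (R \<times> UNIV)" by (auto simp: C_def)
      then show "\<mu> \<in> snd ` (C \<inter> (R \<times> UNIV))" by (rule image_eqI[rotated]) simp
    qed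
    moreover have "\<rho> \<in> R \<longleftrightarrow> (\<forall>v. \<rho> v \<in> {1 / K..K})" for \<rho>
      by (simp add: R_def PiE_iff)
    ultimately have "\<mu> \<in> snd ` (C \<inter> (R \<times> UNIV)) \<longleftrightarrow> quad_equiv K \<mu>" if "\<And>v. 0 \<le> \<mu> v" for \<mu>
      unfolding quad_equiv_iff_ratio[of \<mu>, OF that K] by blast
    then show ?thesis by blast
  qed
  finally show ?thesis .
qed

section \<open>The two classes of the Hilbert space\<close>

text \<open>Stated for filters because \<open>limit_seminorm\<close> produces a cluster point and
  not the limit of a sequence.\<close>

lemma closed_fun_limit:
  fixes F :: "('k \<Rightarrow> 'c::topological_space) set"
  assumes "closed F" "A \<noteq> bot" "\<forall>\<^sub>F n in A. f n \<in> F" "\<And>k. ((\<lambda>n. f n k) \<longlongrightarrow> g k) A"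
  shows "g \<in> F"
proof -
  have "limitin (product_topology (\<lambda>_. euclidean) UNIV) f g A"
    using assms(4) by (simp add: limitin_componentwise)
  then have "(f \<longlongrightarrow> g) A" by (simp add: euclidean_product_topology)
  with assms show ?thesis by (rule_tac Lim_in_closed_set)
qed

lemma closedin_powertop_iff:
  "closedin (subtopology (powertop_real UNIV) I) S \<longleftrightarrow> (\<exists>F. closed F \<and> S = F \<inter> I)"
  by (simp add: closedin_subtopology euclidean_product_topology)

lemma B_norms_subset: "B_norms \<subseteq> P_infty"
  by (auto simp: B_norms_def)

lemma isometric_trans: "linearly_isometric S T \<Longrightarrow> linearly_isometric T U \<Longrightarrow> linearly_isometric S U"
  unfolding linearly_isometric_iff using bounded_iso_trans[of 1 S T _ 1 U] by fastforce

lemma isometric_sym: "pnspace S \<Longrightarrow> linearly_isometric S T \<Longrightarrow> linearly_isometric T S"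
  unfolding linearly_isometric_iff using bounded_iso_inverse by blast

lemma isomorphic_X_trans:
  assumes \<mu>: "\<mu> \<in> pseudonorms"
    and "linearly_isomorphic (X_space \<mu>) (space_of_type TYPE('a::real_normed_vector))"
    and "linearly_isomorphic (space_of_type TYPE('a)) (space_of_type TYPE('b::real_normed_vector))"
  shows "linearly_isomorphic (X_space \<mu>) (space_of_type TYPE('b))"
proof -
  obtain K f where f: "K \<ge> 1" "bounded_iso K (X_space \<mu>) (space_of_type TYPE('a)) f"
    using assms isomorphic_X_space_iff[OF \<mu>] by blast
  obtain K' g where g: "K' \<ge> 1" "bounded_iso K' (space_of_type TYPE('a)) (space_of_type TYPE('b)) g"
    using assms isomorphic_type_iff by blast
  have "bounded_iso (K * K') (X_space \<mu>) (space_of_type TYPE('b)) (g \<circ> f)"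
    by (rule bounded_iso_trans[OF f(2) g(2)]) (use f g in auto)
  then show ?thesis unfolding linearly_isomorphic_iff by blast
qed

lemma isomorphic_type_sym:
  "linearly_isomorphic (space_of_type TYPE('a::real_normed_vector)) (space_of_type TYPE('b::real_normed_vector)) \<Longrightarrow>
    linearly_isomorphic (space_of_type TYPE('b)) (space_of_type TYPE('a))"
  unfolding linearly_isomorphic_iff using bounded_iso_inverse[OF pnspace_type] by blast

lemma isomorphic_via_X:
  assumes \<mu>: "\<mu> \<in> pseudonorms"
    and "linearly_isomorphic (X_space \<mu>) (space_of_type TYPE('a::real_normed_vector))"
    and "linearly_isomorphic (X_space \<mu>) (space_of_type TYPE('b::real_normed_vector))"
  shows "linearly_isomorphic (space_of_type TYPE('a)) (space_of_type TYPE('b))"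
proof -
  obtain K f where f: "K \<ge> 1" "bounded_iso K (X_space \<mu>) (space_of_type TYPE('a)) f"
    using assms isomorphic_X_space_iff[OF \<mu>] by blast
  obtain K' g where g: "K' \<ge> 1" "bounded_iso K' (X_space \<mu>) (space_of_type TYPE('b)) g"
    using assms isomorphic_X_space_iff[OF \<mu>] by blast
  have "\<exists>h. bounded_iso (K * K') (space_of_type TYPE('a)) (space_of_type TYPE('b)) h"
    using bounded_iso_trans[OF bounded_iso_inverse[OF pnspace_X_space[OF \<mu>] f(2)] g(2)] f g by force
  then show ?thesis unfolding linearly_isomorphic_iff by blast
qed

lemma quad_equiv_mono:
  assumes "quad_equiv K \<mu>" "K \<le> K'" "\<And>v. 0 \<le> \<mu> v"
  shows "quad_equiv K' \<mu>"
proof -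
  obtain \<nu> where q: "quadratic \<nu>" and bd: "\<And>v. \<nu> v \<le> K * \<mu> v" "\<And>v. \<mu> v \<le> K * \<nu> v"
    using assms(1) by (auto simp: quad_equiv_def)
  have "\<nu> v \<le> K' * \<mu> v \<and> \<mu> v \<le> K' * \<nu> v" for v
    using bd[of v] mult_right_mono[OF assms(2) assms(3)[of v]] mult_right_mono[OF assms(2), of "\<nu> v"] q
    by (auto simp: quadratic_def intro: order_trans)
  with q show ?thesis unfolding quad_equiv_def by blast
qed

lemma isometric_l2_iff:
  assumes "\<mu> \<in> P_infty"
  shows "linearly_isometric (X_space \<mu>) (space_of_type TYPE(l2)) \<longleftrightarrow> quad_equiv 1 \<mu>"
  using bounded_iso_iff_represents[of \<mu> 1, where 'b = l2] represents_l2_iff[OF assms, of 1] assms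
  by (simp add: linearly_isometric_iff P_infty_def)

lemma isomorphic_l2_iff:
  assumes "\<mu> \<in> P_infty"
  shows "linearly_isomorphic (X_space \<mu>) (space_of_type TYPE(l2)) \<longleftrightarrow> (\<exists>n::nat. quad_equiv (real n + 1) \<mu>)"
proof -
  have \<mu>: "\<mu> \<in> pseudonorms" using assms by (simp add: P_infty_def)
  have eq: "(\<exists>f. bounded_iso K (X_space \<mu>) (space_of_type TYPE(l2)) f) \<longleftrightarrow> quad_equiv K \<mu>" if "K \<ge> 1" for K
    using bounded_iso_iff_represents[OF \<mu>, of K, where 'b = l2] represents_l2_iff[OF assms, of K] that by simp
  have "linearly_isomorphic (X_space \<mu>) (space_of_type TYPE(l2)) \<longleftrightarrow> (\<exists>K\<ge>1. quad_equiv K \<mu>)"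
    using isomorphic_X_space_iff[OF \<mu>, where 'b = l2] eq by auto
  also have "\<dots> \<longleftrightarrow> (\<exists>n::nat. quad_equiv (real n + 1) \<mu>)"
  proof
    assume "\<exists>K\<ge>1. quad_equiv K \<mu>"
    then obtain K where K: "quad_equiv K \<mu>" by blast
    obtain n :: nat where "K \<le> real n" using real_arch_simple by blast
    then have "quad_equiv (real n + 1) \<mu>" by (intro quad_equiv_mono[OF K] pn_nonneg[OF \<mu>]) simp
    then show "\<exists>n::nat. quad_equiv (real n + 1) \<mu>" ..
  next
    assume "\<exists>n::nat. quad_equiv (real n + 1) \<mu>"
    then obtain n :: nat where "quad_equiv (real n + 1) \<mu>" ..
    then show "\<exists>K\<ge>1. quad_equiv K \<mu>" by (intro exI[of _ "real n + 1"]) simp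
  qed
  finally show ?thesis .
qed

lemma isometry_class_l2_closed:
  assumes I: "I \<subseteq> P_infty"
    and iso: "linearly_isometric (space_of_type TYPE('a::real_normed_vector)) (space_of_type TYPE(l2))"
  shows "closedin (subtopology (powertop_real UNIV) I)
    {\<mu> \<in> I. linearly_isometric (X_space \<mu>) (space_of_type TYPE('a))}"
proof -
  have "linearly_isometric (X_space \<mu>) (space_of_type TYPE('a)) \<longleftrightarrow> quad_equiv 1 \<mu>" if "\<mu> \<in> I" for \<mu>
    using isometric_trans[OF _ iso, of "X_space \<mu>"]
      isometric_trans[OF _ isometric_sym[OF pnspace_type iso], of "X_space \<mu>"] isometric_l2_iff[of \<mu>] that I
    by blast
  moreover have "0 \<le> \<mu> v" if "\<mu> \<in> I" for \<mu> v
    using that I pn_nonneg by (auto simp: P_infty_def)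
  ultimately have "{\<mu> \<in> I. linearly_isometric (X_space \<mu>) (space_of_type TYPE('a))}
      = {\<mu>. (\<forall>v. 0 \<le> \<mu> v) \<and> quad_equiv 1 \<mu>} \<inter> I" by blast
  then show ?thesis unfolding closedin_powertop_iff using closed_quad_equiv[of 1] by auto
qed

lemma isomorphism_class_l2_fsigma:
  assumes I: "I \<subseteq> P_infty"
    and iso: "linearly_isomorphic (space_of_type TYPE('a::real_normed_vector)) (space_of_type TYPE(l2))"
  shows "fsigma_in (subtopology (powertop_real UNIV) I)
    {\<mu> \<in> I. linearly_isomorphic (X_space \<mu>) (space_of_type TYPE('a))}"
proof -
  define F where "F n = {\<mu>. (\<forall>v. 0 \<le> \<mu> v) \<and> quad_equiv (real n + 1) \<mu>}" for n :: nat
  have "linearly_isomorphic (X_space \<mu>) (space_of_type TYPE('a)) \<longleftrightarrow> (\<exists>n::nat. quad_equiv (real n + 1) \<mu>)"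
    if "\<mu> \<in> I" for \<mu>
  proof -
    have P: "\<mu> \<in> P_infty" "\<mu> \<in> pseudonorms" using that I by (auto simp: P_infty_def)
    show ?thesis
      using isomorphic_X_trans[OF P(2) _ iso] isomorphic_X_trans[OF P(2) _ isomorphic_type_sym[OF iso]]
        isomorphic_l2_iff[OF P(1)] by blast
  qed
  moreover have "0 \<le> \<mu> v" if "\<mu> \<in> I" for \<mu> v
    using that I pn_nonneg by (auto simp: P_infty_def)
  ultimately have eq: "{\<mu> \<in> I. linearly_isomorphic (X_space \<mu>) (space_of_type TYPE('a))} = \<Union> (range (\<lambda>n. F n \<inter> I))"
    by (auto simp: F_def)
  have "closedin (subtopology (powertop_real UNIV) I) (F n \<inter> I)" for n
    unfolding closedin_powertop_iff using closed_quad_equiv[of "real n + 1"] by (auto simp: F_def)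
  then have "(countable union_of closedin (subtopology (powertop_real UNIV) I)) (\<Union> (range (\<lambda>n. F n \<inter> I)))"
    unfolding union_of_def by (intro exI[of _ "range (\<lambda>n. F n \<inter> I)"]) auto
  then show ?thesis unfolding eq fsigma_in_def .
qed

text \<open>Exactly the sequences for which the extension of \<open>mu_of x\<close> is a norm, as
  membership in \<open>B_norms\<close> demands.\<close>

definition indep_seq :: "(nat \<Rightarrow> 'a::real_vector) \<Rightarrow> bool" where
  "indep_seq x \<longleftrightarrow> (\<forall>c. comb x c = 0 \<longrightarrow> c = 0)"

lemma indep_seq_not_in_finite_span:
  fixes x :: "nat \<Rightarrow> 'a::real_vector"
  assumes x: "indep_seq x" and B: "finite B"
  shows "\<not> range x \<subseteq> span B"
proof
  assume sub: "range x \<subseteq> span B"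
  have inj: "inj x"
  proof (rule injI)
    fix i j assume "x i = x j"
    then have "comb x (bas i - bas j) = 0" by simp
    then have "bas i - bas j = 0" using x unfolding indep_seq_def by blast
    then show "i = j" by (metis eq_iff_diff_eq_0 inj_single[of 1] lookup_single_eq lookup_single_not_eq zero_neq_one)
  qed
  have "independent (range x)"
    unfolding dependent_explicit
  proof clarify
    fix t u v assume t: "finite t" "t \<subseteq> range x" "v \<in> t" "u v \<noteq> (0::real)" "(\<Sum>v\<in>t. u v *\<^sub>R v) = 0"
    obtain A where A: "t = x ` A" "finite A" using finite_subset_image[OF t(1,2)] by blast
    define c :: c00 where "c = (\<Sum>i\<in>A. u (x i) *\<^sub>R bas i)"
    have "comb x c = (\<Sum>i\<in>A. u (x i) *\<^sub>R x i)" by (simp add: c_def comb_sum comb_scaleR)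
    also have "\<dots> = (\<Sum>v\<in>t. u v *\<^sub>R v)"
      unfolding A(1) using inj by (subst sum.reindex) (auto intro: inj_on_subset)
    finally have "c = 0" using x t(5) unfolding indep_seq_def by simp
    obtain k where k: "k \<in> A" "v = x k" using A t(3) by blast
    have "lookup c k = (\<Sum>i\<in>A. if i = k then u (x i) else 0)"
      unfolding c_def lookup_sum by (intro sum.cong) (auto simp: lookup_single when_def)
    then have "lookup c k = u v" using A k by simp
    then show False using \<open>c = 0\<close> t(4) by simp
  qed
  then have "finite (range x)" using independent_span_bound[OF B _ sub] by blast
  then show False using inj by (simp add: finite_image_iff)
qed

lemma indep_seq_inf_dim:
  fixes x :: "nat \<Rightarrow> 'a::real_normed_vector"
  assumes "indep_seq x"
  shows "inf_dim TYPE('a)"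
  unfolding inf_dim_def using indep_seq_not_in_finite_span[OF assms] by blast

lemma inf_dim_iff: "infinite_dimensional (space_of_type TYPE('a::real_normed_vector)) \<longleftrightarrow> inf_dim TYPE('a)"
  by (simp add: infinite_dimensional_space_of_type inf_dim_def)

section \<open>Dense independent sequences and closed isometry classes\<close>

lemma dense_sequence:
  assumes "separable_space (euclidean :: 'a::real_normed_vector topology)"
  obtains d :: "nat \<Rightarrow> 'a::real_normed_vector" where "closure (range d) = UNIV"
proof -
  obtain C :: "'a set" where C: "countable C" "closure C = UNIV"
    using assms by (auto simp: separable_space_def)
  then have "C \<noteq> {}" by auto
  then have "range (from_nat_into C) = C" using C(1) by (rule range_from_nat_into)
  with C show thesis by (intro that[of "from_nat_into C"]) simp
qed

lemma comb_eq_sum_lessThan: "Poly_Mapping.keys c \<subseteq> {..<n} \<Longrightarrow> comb x c = (\<Sum>i<n. lookup c i *\<^sub>R x i)"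
  by (rule comb_superset) auto

text \<open>The largest index in the support of a relation would express a new vector through its
  predecessors.\<close>

lemma indep_seq_of_new:
  fixes y :: "nat \<Rightarrow> 'a::real_vector"
  assumes low: "\<And>c. Poly_Mapping.keys c \<subseteq> {..<m} \<Longrightarrow> comb y c = 0 \<Longrightarrow> c = 0"
    and new: "\<And>n. m \<le> n \<Longrightarrow> y n \<notin> span (y ` {..<n})"
  shows "indep_seq y"
  unfolding indep_seq_def
proof (intro allI impI)
  fix c assume c: "comb y c = 0"
  show "c = 0"
  proof (cases "Poly_Mapping.keys c \<subseteq> {..<m}")
    case True
    then show ?thesis using low c by blast
  next
    case False
    define N where "N = Max (Poly_Mapping.keys c)"
    have N: "N \<in> Poly_Mapping.keys c" "\<And>i. i \<in> Poly_Mapping.keys c \<Longrightarrow> i \<le> N"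
      unfolding N_def using False by (auto intro: Max_in)
    have "m \<le> N" using False N(2) by (force simp: subset_iff)
    have "0 = (\<Sum>i<Suc N. lookup c i *\<^sub>R y i)"
      using N(2) by (subst comb_eq_sum_lessThan[symmetric]) (auto simp: c less_Suc_eq_le)
    then have eq: "lookup c N *\<^sub>R y N = - (\<Sum>i<N. lookup c i *\<^sub>R y i)" by (simp add: eq_neg_iff_add_eq_0 add.commute)
    have "lookup c N \<noteq> 0" using N(1) by (simp add: in_keys_iff)
    then have "y N = (1 / lookup c N) *\<^sub>R (lookup c N *\<^sub>R y N)" by simp
    also have "\<dots> \<in> span (y ` {..<N})"
      unfolding eq by (intro span_scale span_neg span_sum span_base) auto
    finally show ?thesis using new[OF \<open>m \<le> N\<close>] by blast
  qed
qed

text \<open>Behind the prefix, step \<open>n\<close> appends \<open>d (n - m)\<close> unless it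
  already lies in the span, and otherwise any vector outside; so every \<open>d k\<close> ends up in
  the span. This puts a finite independent system at the start of a sequence whose pseudonorm lies
  in \<open>B_norms\<close>.\<close>

lemma dense_independent_extension:
  fixes u :: "nat \<Rightarrow> 'a::real_normed_vector"
  assumes inf: "inf_dim TYPE('a)" and d: "closure (range (d :: nat \<Rightarrow> 'a)) = UNIV"
    and u: "\<And>c. Poly_Mapping.keys c \<subseteq> {..<m} \<Longrightarrow> comb u c = 0 \<Longrightarrow> c = 0"
  shows "\<exists>y. (\<forall>i<m. y i = u i) \<and> indep_seq y \<and> closure (range (comb y)) = UNIV"
proof -
  define P where "P f n r \<longleftrightarrow> (if n < m then r = u n else r \<notin> span (f ` {..<n}) \<and>
    (d (n - m) \<notin> span (f ` {..<n}) \<longrightarrow> r = d (n - m)))" for f and n and r :: 'a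
  have "\<exists>y. \<forall>n. P y n (y n)"
  proof (rule dependent_wellorder_choice)
    show "P f n r = P g n r" if "\<And>k. k < n \<Longrightarrow> f k = g k" for r f g n
    proof -
      have "f ` {..<n} = g ` {..<n}" using that by (intro image_cong) auto
      then show ?thesis by (simp add: P_def)
    qed
    show "\<exists>r. P f n r" for n f
    proof -
      have "span (f ` {..<n}) \<noteq> UNIV" using inf by (auto simp: inf_dim_def)
      then obtain r where "r \<notin> span (f ` {..<n})" by blast
      then show ?thesis unfolding P_def by (cases "d (n - m) \<in> span (f ` {..<n})") auto
    qed
  qed
  then obtain y where y: "\<And>n. P y n (y n)" by blast
  have yu: "y i = u i" if "i < m" for i using y[of i] that by (simp add: P_def)
  have "comb y c = comb u c" if "Poly_Mapping.keys c \<subseteq> {..<m}" for c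
    using that yu by (simp add: comb_eq_sum_lessThan)
  then have "indep_seq y"
    using u y by (intro indep_seq_of_new[of m]) (auto simp: P_def)
  moreover have "d k \<in> range (comb y)" for k
  proof -
    have "d k \<in> span (y ` {..<m + k}) \<or> d k = y (m + k)"
      using y[of "m + k"] by (auto simp: P_def)
    moreover have "span (y ` {..<m + k}) \<subseteq> span (range y)" by (intro span_mono) auto
    ultimately show ?thesis unfolding range_comb by (auto intro: span_base)
  qed
  then have "closure (range d) \<subseteq> closure (range (comb y))" by (intro closure_mono) auto
  then have "closure (range (comb y)) = UNIV" using d by auto
  ultimately show ?thesis using yu by blast
qed

lemma almost_euclidean_independent:
  assumes "almost_euclidean m \<epsilon> u" "\<epsilon> < 1" "Poly_Mapping.keys c \<subseteq> {..<m}" "comb u c = 0"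
  shows "c = 0"
proof -
  have "(1 - \<epsilon>) * sqrt (\<Sum>i<m. (lookup c i)\<^sup>2) \<le> norm (\<Sum>i<m. lookup c i *\<^sub>R u i)"
    using assms(1) by (simp add: almost_euclidean_def)
  also have "\<dots> = 0" using assms(3,4) by (simp add: comb_eq_sum_lessThan)
  finally have "sqrt (\<Sum>i<m. (lookup c i)\<^sup>2) \<le> 0" using assms(2) by (simp add: mult_le_0_iff)
  then have "(\<Sum>i<m. (lookup c i)\<^sup>2) = 0" using sum_nonneg[of "{..<m}" "\<lambda>i. (lookup c i)\<^sup>2"] by simp
  then have "\<forall>i<m. lookup c i = 0" by (simp add: sum_nonneg_eq_0_iff)
  then have zero: "lookup c i = 0" if "i < m" for i using that by blast
  show ?thesis
  proof (rule poly_mapping_eqI)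
    show "lookup c k = lookup 0 k" for k
    proof (cases "k < m")
      case False
      then have "k \<notin> Poly_Mapping.keys c" using assms(3) by auto
      then show ?thesis by (simp add: in_keys_iff)
    qed (simp add: zero)
  qed
qed

definition mu_l2 :: "V \<Rightarrow> real" where "mu_l2 = mu_of unit_l2"

lemma inf_dim_l2: "inf_dim TYPE(l2)"
  by (rule indep_seq_inf_dim[of unit_l2]) (simp add: indep_seq_def unit_l2_independent)

lemma mu_l2_B_norms: "mu_l2 \<in> B_norms"
  unfolding mu_l2_def
  by (rule mu_of_B_norms[OF unit_l2_dense]) (simp_all add: inf_dim_iff inf_dim_l2 unit_l2_independent)

lemma norm_comb_unit_l2: "Poly_Mapping.keys c \<subseteq> {..<n} \<Longrightarrow> norm (comb unit_l2 c) = sqrt (\<Sum>i<n. (lookup c i)\<^sup>2)"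
  by (simp only: comb_eq_sum_lessThan norm_unit_combination)

lemma isometric_X_mu_l2: "linearly_isometric (X_space mu_l2) (space_of_type TYPE(l2))"
  unfolding mu_l2_def linearly_isometric_iff
  by (rule bounded_iso_of_represents[OF mu_of_pseudonorm represents_mu_of[OF unit_l2_dense]]) simp

text \<open>A rational vector has finite support, so its norm is eventually computed inside the
  almost Euclidean prefix, and the pseudonorms of the extended sequences converge pointwise to
  \<open>mu_l2\<close>.\<close>

lemma l2_of_closed_isometry_class:
  assumes I: "I \<subseteq> P_infty" "B_norms \<subseteq> I"
    and sep: "separable_space (euclidean :: 'a::banach topology)"
    and inf: "infinite_dimensional (space_of_type TYPE('a))"
    and cl: "closedin (subtopology (powertop_real UNIV) I)
      {\<mu> \<in> I. linearly_isometric (X_space \<mu>) (space_of_type TYPE('a))}"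
  shows "linearly_isometric (space_of_type TYPE('a)) (space_of_type TYPE(l2))"
proof -
  obtain F where F: "closed F" "{\<mu> \<in> I. linearly_isometric (X_space \<mu>) (space_of_type TYPE('a))} = F \<inter> I"
    using cl unfolding closedin_powertop_iff by blast
  obtain d :: "nat \<Rightarrow> 'a" where d: "closure (range d) = UNIV" using dense_sequence[OF sep] .
  have inf': "inf_dim TYPE('a)" using inf by (simp add: inf_dim_iff)
  \<comment> \<open>Below 1, so that the almost Euclidean prefixes are independent, and tending to
    0, so that the pseudonorms converge.\<close>
  define \<epsilon> where "\<epsilon> m = 1 / (real m + 2)" for m :: nat
  have \<epsilon>: "0 < \<epsilon> m" "\<epsilon> m < 1" for m by (simp_all add: \<epsilon>_def)
  have "\<exists>y :: nat \<Rightarrow> 'a. almost_euclidean (Suc m) (\<epsilon> m) y \<and> indep_seq y \<and> closure (range (comb y)) = UNIV" for m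
  proof -
    obtain u :: "nat \<Rightarrow> 'a" where u: "almost_euclidean (Suc m) (\<epsilon> m) u"
      using Dvoretzky[OF inf', of "Suc m" "\<epsilon> m"] \<epsilon>[of m] by auto
    obtain y where y: "\<forall>i<Suc m. y i = u i" "indep_seq y" "closure (range (comb y)) = UNIV"
      using dense_independent_extension[OF inf' d almost_euclidean_independent[OF u \<epsilon>(2)]] by blast
    have "almost_euclidean (Suc m) (\<epsilon> m) y" using u y(1) by (simp add: almost_euclidean_def)
    with y show ?thesis by blast
  qed
  then obtain y :: "nat \<Rightarrow> nat \<Rightarrow> 'a" where y: "\<And>m. almost_euclidean (Suc m) (\<epsilon> m) (y m)"
    "\<And>m. indep_seq (y m)" "\<And>m. closure (range (comb (y m))) = UNIV" by metis
  have "mu_of (y m) \<in> F" for m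
  proof -
    have "mu_of (y m) \<in> I" using mu_of_B_norms[OF y(3) inf] y(2) I by (auto simp: indep_seq_def)
    moreover have "linearly_isometric (X_space (mu_of (y m))) (space_of_type TYPE('a))"
      unfolding linearly_isometric_iff
      by (rule bounded_iso_of_represents[OF mu_of_pseudonorm represents_mu_of[OF y(3)]]) simp
    ultimately show ?thesis using F by blast
  qed
  moreover have "(\<lambda>m. mu_of (y m) v) \<longlonglongrightarrow> mu_l2 v" for v
  proof -
    obtain M where M: "Poly_Mapping.keys (emb v) \<subseteq> {..<M}" using keys_bounded by blast
    have close: "\<bar>mu_of (y m) v - mu_l2 v\<bar> \<le> \<epsilon> m * mu_l2 v" if "m \<ge> M" for m
    proof -
      have k: "Poly_Mapping.keys (emb v) \<subseteq> {..<Suc m}" using M that by auto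
      have "mu_l2 v = sqrt (\<Sum>i<Suc m. (lookup (emb v) i)\<^sup>2)"
        unfolding mu_l2_def mu_of_def by (rule norm_comb_unit_l2[OF k])
      moreover have "mu_of (y m) v = norm (\<Sum>i<Suc m. lookup (emb v) i *\<^sub>R y m i)"
        by (simp only: mu_of_def comb_eq_sum_lessThan[OF k])
      ultimately have "(1 - \<epsilon> m) * mu_l2 v \<le> mu_of (y m) v \<and> mu_of (y m) v \<le> (1 + \<epsilon> m) * mu_l2 v"
        using y(1)[of m] unfolding almost_euclidean_def by (simp only:)
      then show ?thesis by (simp add: algebra_simps abs_le_iff)
    qed
    have "\<epsilon> \<longlonglongrightarrow> 0" unfolding \<epsilon>_def by real_asymp
    then have "(\<lambda>m. \<epsilon> m * mu_l2 v) \<longlonglongrightarrow> 0" by (rule tendsto_mult_left_zero)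
    then have "(\<lambda>m. mu_of (y m) v - mu_l2 v) \<longlonglongrightarrow> 0"
      by (rule Lim_null_comparison[rotated]) (use close in \<open>auto simp: eventually_sequentially\<close>)
    then show ?thesis by (simp add: LIM_zero_iff)
  qed
  ultimately have "mu_l2 \<in> F" 
    using closed_fun_limit[OF F(1) sequentially_bot, of "\<lambda>m. mu_of (y m)" mu_l2] by simp
  then have "linearly_isometric (X_space mu_l2) (space_of_type TYPE('a))"
    using F(2) I mu_l2_B_norms by blast
  then show ?thesis
    using isometric_trans[OF isometric_sym[OF pnspace_X_space] isometric_X_mu_l2] mu_of_pseudonorm
    unfolding mu_l2_def by blast
qed

section \<open>Baire category in the space of sequences\<close>

lemma open_fun_contains_cylinder:
  fixes U :: "(nat \<Rightarrow> 'a::metric_space) set"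
  assumes "open U" "x \<in> U"
  shows "\<exists>k. \<exists>\<epsilon>>0. \<forall>y. (\<forall>i<k. dist (y i) (x i) < \<epsilon>) \<longrightarrow> y \<in> U"
proof -
  have "openin (product_topology (\<lambda>_. euclidean) UNIV) U"
    using assms(1) by (simp add: euclidean_product_topology)
  then obtain X where X: "x \<in> PiE UNIV X" "\<And>i. open (X i)" "finite {i. X i \<noteq> UNIV}" "PiE UNIV X \<subseteq> U"
    using product_topology_open_contains_basis[of "\<lambda>_. euclidean" UNIV U x] assms(2) by auto
  define J where "J = {i. X i \<noteq> UNIV}"
  have "\<exists>e>0. ball (x i) e \<subseteq> X i" for i
    using X(1,2) open_contains_ball[of "X i"] by (auto simp: PiE_iff)
  then obtain e where e: "\<And>i. e i > 0" "\<And>i. ball (x i) (e i) \<subseteq> X i" by metis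
  \<comment> \<open>The element 1 keeps the set nonempty when no coordinate is restricted.\<close>
  define \<epsilon> where "\<epsilon> = Min (insert 1 (e ` J))"
  obtain k where k: "\<And>i. i \<in> J \<Longrightarrow> i < k"
    using X(3) finite_nat_set_iff_bounded[of J] by (auto simp: J_def)
  have fin: "finite (insert 1 (e ` J))" using X(3) by (simp add: J_def)
  have "\<epsilon> > 0" unfolding \<epsilon>_def using fin e(1) by (subst Min_gr_iff) auto
  moreover have "y \<in> U" if y: "\<forall>i<k. dist (y i) (x i) < \<epsilon>" for y
  proof -
    have "y i \<in> X i" for i
    proof (cases "i \<in> J")
      case True
      then have "\<epsilon> \<le> e i" unfolding \<epsilon>_def using fin by (intro Min_le) auto
      then have "y i \<in> ball (x i) (e i)" using y k[OF True] by (auto simp: dist_commute)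
      then show ?thesis using e(2) by blast
    qed (auto simp: J_def)
    then show ?thesis using X(4) by (auto simp: PiE_iff)
  qed
  ultimately show ?thesis by blast
qed

lemma open_cylinder:
  fixes x :: "nat \<Rightarrow> 'a::metric_space"
  shows "open {y. \<forall>i<k. dist (y i) (x i) < \<epsilon>}"
proof -
  have "{y. \<forall>i<k. dist (y i) (x i) < \<epsilon>} = (\<Inter>i\<in>{..<k}. {y. dist (y i) (x i) < \<epsilon>})" by auto
  moreover have "open {y. dist (y i) (x i) < \<epsilon>}" for i
    by (intro open_Collect_less continuous_on_dist continuous_on_product_coordinates continuous_on_const)
  ultimately show ?thesis by auto
qed

text \<open>Linear independence in a quantitative form, which persists under small
  perturbations.\<close>

definition indep_upto :: "nat \<Rightarrow> (nat \<Rightarrow> 'a::real_normed_vector) \<Rightarrow> bool" where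
  "indep_upto n y \<longleftrightarrow> (\<exists>M\<ge>0. \<forall>a. (\<Sum>i<n. \<bar>a i\<bar>) \<le> M * norm (\<Sum>i<n. a i *\<^sub>R y i))"

text \<open>The distance of the new vector from the span bounds its coefficient, and subtracting its
  term leaves a combination of the old vectors.\<close>

lemma indep_upto_Suc:
  fixes y :: "nat \<Rightarrow> 'a::real_normed_vector"
  assumes "indep_upto n y" "y n \<notin> span (y ` {..<n})"
  shows "indep_upto (Suc n) y"
proof -
  obtain M where M: "M \<ge> 0" "\<And>a. (\<Sum>i<n. \<bar>a i\<bar>) \<le> M * norm (\<Sum>i<n. a i *\<^sub>R y i)"
    using assms(1) by (auto simp: indep_upto_def)
  have "closed (span (y ` {..<n}))" by (rule closed_span_finite) simp
  then obtain d where d: "d > 0" "\<And>t s. s \<in> span (y ` {..<n}) \<Longrightarrow> \<bar>t\<bar> * d \<le> norm (t *\<^sub>R y n + s)"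
    using subspace_dist[OF subspace_span _ assms(2)] by blast
  have "(\<Sum>i<Suc n. \<bar>a i\<bar>) \<le> (M * (1 + norm (y n) / d) + 1 / d) * norm (\<Sum>i<Suc n. a i *\<^sub>R y i)" for a
  proof -
    define s where "s = (\<Sum>i<n. a i *\<^sub>R y i)"
    define X where "X = norm (a n *\<^sub>R y n + s)"
    have "s \<in> span (y ` {..<n})" unfolding s_def by (intro span_sum span_scale span_base) auto
    then have t: "\<bar>a n\<bar> \<le> X / d" using d by (simp add: X_def field_simps)
    have "norm s \<le> X + \<bar>a n\<bar> * norm (y n)"
      using norm_triangle_ineq4[of "a n *\<^sub>R y n + s" "a n *\<^sub>R y n"] by (simp add: X_def)
    also have "\<dots> \<le> X + X / d * norm (y n)" using t by (intro add_left_mono mult_right_mono) auto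
    finally have "M * norm s \<le> M * (X + X / d * norm (y n))" using M(1) by (rule mult_left_mono)
    then have "(\<Sum>i<n. \<bar>a i\<bar>) \<le> M * (X + X / d * norm (y n))" using M(2)[of a] by (simp add: s_def)
    then have "(\<Sum>i<Suc n. \<bar>a i\<bar>) \<le> M * (X + X / d * norm (y n)) + X / d" using t by simp
    also have "\<dots> = (M * (1 + norm (y n) / d) + 1 / d) * X" by (simp add: algebra_simps)
    also have "X = norm (\<Sum>i<Suc n. a i *\<^sub>R y i)" by (simp add: X_def s_def add.commute)
    finally show ?thesis .
  qed
  then show ?thesis unfolding indep_upto_def using M(1) d(1)
    by (intro exI[of _ "M * (1 + norm (y n) / d) + 1 / d"]) auto
qed

lemma indep_upto_new:
  assumes "\<And>i. i < n \<Longrightarrow> y i \<notin> span (y ` {..<i})"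
  shows "indep_upto n (y :: nat \<Rightarrow> 'a::real_normed_vector)"
  using assms
proof (induction n)
  case 0
  show ?case by (auto simp: indep_upto_def)
next
  case (Suc n)
  then show ?case by (intro indep_upto_Suc) auto
qed

lemma indep_upto_zero:
  assumes "indep_upto n y" "Poly_Mapping.keys c \<subseteq> {..<n}" "comb y c = 0"
  shows "c = 0"
proof -
  obtain M where "(\<Sum>i<n. \<bar>lookup c i\<bar>) \<le> M * norm (\<Sum>i<n. lookup c i *\<^sub>R y i)"
    using assms(1) by (auto simp: indep_upto_def)
  then have "(\<Sum>i<n. \<bar>lookup c i\<bar>) \<le> 0" using assms(2,3) by (simp add: comb_eq_sum_lessThan)
  then have "(\<Sum>i<n. \<bar>lookup c i\<bar>) = 0" by (intro antisym sum_nonneg) auto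
  then have zero: "lookup c i = 0" if "i < n" for i using that by (simp add: sum_nonneg_eq_0_iff)
  show ?thesis
  proof (rule poly_mapping_eqI)
    show "lookup c k = lookup 0 k" for k
    proof (cases "k < n")
      case False
      then have "k \<notin> Poly_Mapping.keys c" using assms(2) by auto
      then show ?thesis by (simp add: in_keys_iff)
    qed (simp add: zero)
  qed
qed

lemma open_indep_upto: "open {y :: nat \<Rightarrow> 'a::real_normed_vector. indep_upto n y}"
proof (subst open_subopen, intro ballI)
  fix y :: "nat \<Rightarrow> 'a" assume "y \<in> {y. indep_upto n y}"
  then obtain M where M: "M \<ge> 0" "\<And>a. (\<Sum>i<n. \<bar>a i\<bar>) \<le> M * norm (\<Sum>i<n. a i *\<^sub>R y i)"
    by (auto simp: indep_upto_def)
  \<comment> \<open>A perturbation of this size changes a combination by at most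
    \<open>\<epsilon>\<close> times the sum of the absolute coefficients. As
    \<open>M * \<epsilon> \<le> 1 / 2\<close>, half of that sum is absorbed and the constant becomes
    \<open>2 * M\<close>.\<close>
  define \<epsilon> where "\<epsilon> = 1 / (2 * (M + 1))"
  have \<epsilon>: "\<epsilon> > 0" using M by (simp add: \<epsilon>_def)
  have "indep_upto n z" if z: "\<forall>i<n. dist (z i) (y i) < \<epsilon>" for z
  proof -
    have "(\<Sum>i<n. \<bar>a i\<bar>) \<le> 2 * M * norm (\<Sum>i<n. a i *\<^sub>R z i)" for a
    proof -
      let ?A = "\<Sum>i<n. \<bar>a i\<bar>"
      have "norm ((\<Sum>i<n. a i *\<^sub>R y i) - (\<Sum>i<n. a i *\<^sub>R z i)) = norm (\<Sum>i<n. a i *\<^sub>R (y i - z i))"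
        by (simp add: scaleR_diff_right sum_subtractf)
      also have "\<dots> \<le> (\<Sum>i<n. \<bar>a i\<bar> * \<epsilon>)"
      proof (rule sum_norm_le)
        fix i assume "i \<in> {..<n}"
        then have "norm (y i - z i) \<le> \<epsilon>" using z by (auto simp: dist_norm norm_minus_commute less_imp_le)
        then show "norm (a i *\<^sub>R (y i - z i)) \<le> \<bar>a i\<bar> * \<epsilon>" by (simp add: mult_left_mono)
      qed
      finally have "norm (\<Sum>i<n. a i *\<^sub>R y i) \<le> norm (\<Sum>i<n. a i *\<^sub>R z i) + ?A * \<epsilon>"
        using norm_triangle_ineq2[of "\<Sum>i<n. a i *\<^sub>R y i" "\<Sum>i<n. a i *\<^sub>R z i"] by (simp add: sum_distrib_right)
      then have "M * norm (\<Sum>i<n. a i *\<^sub>R y i) \<le> M * (norm (\<Sum>i<n. a i *\<^sub>R z i) + ?A * \<epsilon>)"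
        using M(1) by (rule mult_left_mono)
      moreover have "M * \<epsilon> \<le> 1 / 2" using M(1) by (simp add: \<epsilon>_def field_simps)
      then have "?A * (M * \<epsilon>) \<le> ?A * (1 / 2)" by (rule mult_left_mono) (simp add: sum_nonneg)
      ultimately have "?A \<le> M * norm (\<Sum>i<n. a i *\<^sub>R z i) + ?A * (1 / 2)"
        using M(2)[of a] by (simp add: algebra_simps)
      then show ?thesis by simp
    qed
    then show ?thesis unfolding indep_upto_def using M(1) by (intro exI[of _ "2 * M"]) auto
  qed
  then show "\<exists>T. open T \<and> y \<in> T \<and> T \<subseteq> {y. indep_upto n y}"
    using \<epsilon> by (intro exI[of _ "{z. \<forall>i<n. dist (z i) (y i) < \<epsilon>}"] conjI open_cylinder) auto
qed

text \<open>If \<open>x n\<close> falls into the span of the earlier choices, a small multiple of a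
  vector outside the span moves it out.\<close>

lemma independent_perturbation:
  fixes x :: "nat \<Rightarrow> 'a::real_normed_vector"
  assumes inf: "inf_dim TYPE('a)" and \<epsilon>: "\<epsilon> > 0"
  shows "\<exists>y. (\<forall>i. dist (y i) (x i) < \<epsilon>) \<and> (\<forall>i. y i \<notin> span (y ` {..<i}))"
proof -
  have "\<exists>y. \<forall>n. dist (y n) (x n) < \<epsilon> \<and> y n \<notin> span (y ` {..<n})"
  proof (rule dependent_wellorder_choice)
    show "(dist r (x n) < \<epsilon> \<and> r \<notin> span (f ` {..<n})) = (dist r (x n) < \<epsilon> \<and> r \<notin> span (g ` {..<n}))"
      if "\<And>k. k < n \<Longrightarrow> f k = g k" for r and f g :: "nat \<Rightarrow> 'a" and n
    proof -
      have "f ` {..<n} = g ` {..<n}" using that by (intro image_cong) auto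
      then show ?thesis by simp
    qed
    show "\<exists>r. dist r (x n) < \<epsilon> \<and> r \<notin> span (f ` {..<n})" for n and f :: "nat \<Rightarrow> 'a"
    proof (cases "x n \<in> span (f ` {..<n})")
      case True
      have "span (f ` {..<n}) \<noteq> UNIV" using inf by (auto simp: inf_dim_def)
      then obtain z where z: "z \<notin> span (f ` {..<n})" by blast
      have nz: "norm z > 0" using z span_zero by fastforce
      define t where "t = \<epsilon> / (2 * norm z)"
      have t: "t > 0" using \<epsilon> nz by (simp add: t_def)
      have "x n + t *\<^sub>R z \<notin> span (f ` {..<n})"
      proof
        assume "x n + t *\<^sub>R z \<in> span (f ` {..<n})"
        then have "(1 / t) *\<^sub>R ((x n + t *\<^sub>R z) - x n) \<in> span (f ` {..<n})"
          using True by (intro span_scale span_diff)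
        then show False using z t by simp
      qed
      moreover have "dist (x n + t *\<^sub>R z) (x n) < \<epsilon>" using \<epsilon> nz by (simp add: dist_norm t_def)
      ultimately show ?thesis by blast
    qed (use \<epsilon> in \<open>auto intro: exI[of _ "x n"]\<close>)
  qed
  then show ?thesis by blast
qed

lemma continuous_comb: "continuous_on UNIV (\<lambda>y :: nat \<Rightarrow> 'a::real_normed_vector. comb y c)"
  unfolding comb_def
  by (intro continuous_on_sum continuous_on_scaleR continuous_on_const continuous_on_product_coordinates)

text \<open>Independence follows from the open dense conditions \<open>indep_upto n\<close>, density
  of the span from the open dense sets \<open>W k m\<close>. If no \<open>C n\<close> contained a
  cylinder, their complements would be open and dense too, and a common point would contradict the
  covering.\<close>

lemma Baire_sequences:
  fixes C :: "nat \<Rightarrow> (nat \<Rightarrow> 'a::banach) set" and d :: "nat \<Rightarrow> 'a"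
  assumes inf: "inf_dim TYPE('a)" and d: "closure (range d) = UNIV"
    and C: "\<And>n. closed (C n)"
    and cover: "\<And>y. indep_seq y \<Longrightarrow> closure (range (comb y)) = UNIV \<Longrightarrow> \<exists>n. y \<in> C n"
  shows "\<exists>n k x. \<exists>\<epsilon>>0. \<forall>y. (\<forall>i<k. dist (y i) (x i) < \<epsilon>) \<longrightarrow> y \<in> C n"
proof (rule ccontr)
  assume contra: "\<not> ?thesis"
  define W where "W k m = {y. \<exists>c. norm (d k - comb y c) < 1 / real (Suc m)}" for k m
  define \<G> where "\<G> = range (\<lambda>n. - C n) \<union> range (\<lambda>n. {y. indep_upto n y}) \<union> range (\<lambda>(k, m). W k m)"
  have dense: "closure T = UNIV"
    if "\<And>x k \<epsilon>. \<epsilon> > 0 \<Longrightarrow> \<exists>y\<in>T. \<forall>i<k. dist (y i) (x i) < \<epsilon>" for T :: "(nat \<Rightarrow> 'a) set"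
  proof -
    have "x \<in> closure T" for x
    proof (rule ccontr)
      assume "x \<notin> closure T"
      then obtain k \<epsilon> where "\<epsilon> > 0" "\<And>y. (\<forall>i<k. dist (y i) (x i) < \<epsilon>) \<Longrightarrow> y \<in> - closure T"
        using open_fun_contains_cylinder[of "- closure T" x] by auto
      then show False using that[of \<epsilon> k x] closure_subset by blast
    qed
    then show ?thesis by blast
  qed
  have "Met_TC.mtopology closure_of \<Inter>\<G> = (UNIV :: (nat \<Rightarrow> 'a) set)"
  proof (rule Met_TC.metric_Baire_category)
    show "Met_TC.mcomplete TYPE(nat \<Rightarrow> 'a)" by (simp add: complete_UNIV)
    show "countable \<G>" by (simp add: \<G>_def)
    fix T assume "T \<in> \<G>"
    then consider n where "T = - C n" | n where "T = {y. indep_upto n y}" | k m where "T = W k m"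
      by (auto simp: \<G>_def)
    then have "open T \<and> closure T = UNIV"
    proof cases
      case 1
      have "closure (- C n) = UNIV"
        by (rule dense) (use contra in \<open>metis ComplI\<close>)
      then show ?thesis using 1 C by auto
    next
      case 2
      have "closure {y :: nat \<Rightarrow> 'a. indep_upto n y} = UNIV"
      proof (rule dense)
        fix x :: "nat \<Rightarrow> 'a" and k and \<epsilon> :: real assume "\<epsilon> > 0"
        then obtain y where "\<forall>i. dist (y i) (x i) < \<epsilon>" "\<forall>i. y i \<notin> span (y ` {..<i})"
          using independent_perturbation[OF inf] by blast
        then show "\<exists>y\<in>{y. indep_upto n y}. \<forall>i<k. dist (y i) (x i) < \<epsilon>"
          using indep_upto_new[of n y] by blast
      qed
      then show ?thesis using 2 open_indep_upto by blast
    next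
      case 3
      have "W k m = (\<Union>c. {y. norm (d k - comb y c) < 1 / real (Suc m)})" by (auto simp: W_def)
      moreover have "open {y. norm (d k - comb y c) < 1 / real (Suc m)}" for c
        by (intro open_Collect_less continuous_on_norm continuous_on_diff continuous_on_const continuous_comb)
      ultimately have "open (W k m)" by auto
      moreover have "closure (W k m) = UNIV"
      proof (rule dense)
        fix x :: "nat \<Rightarrow> 'a" and j and \<epsilon> :: real assume "\<epsilon> > 0"
        \<comment> \<open>A cylinder leaves coordinate \<open>j\<close> free, so \<open>d k\<close>
          itself can be put there.\<close>
        have "norm (d k - comb (x(j := d k)) (bas j)) < 1 / real (Suc m)" by simp
        then have "x(j := d k) \<in> W k m" unfolding W_def by blast
        then show "\<exists>y\<in>W k m. \<forall>i<j. dist (y i) (x i) < \<epsilon>"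
          using \<open>\<epsilon> > 0\<close> by (intro bexI[of _ "x(j := d k)"]) auto
      qed
      ultimately show ?thesis using 3 by blast
    qed
    then show "openin Met_TC.mtopology T \<and> Met_TC.mtopology closure_of T = UNIV" by simp
  qed
  then have "\<Inter>\<G> \<noteq> {}" by auto
  then obtain y where y: "\<And>T. T \<in> \<G> \<Longrightarrow> y \<in> T" by blast
  have "y \<notin> C n" for n using y[of "- C n"] by (auto simp: \<G>_def)
  moreover have "indep_seq y"
    unfolding indep_seq_def
  proof (intro allI impI)
    fix c assume "comb y c = 0"
    obtain n where "Poly_Mapping.keys c \<subseteq> {..<n}" using keys_bounded by blast
    moreover have "indep_upto n y" using y[of "{y. indep_upto n y}"] by (auto simp: \<G>_def)
    ultimately show "c = 0" using indep_upto_zero \<open>comb y c = 0\<close> by blast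
  qed
  moreover have "closure (range (comb y)) = UNIV"
  proof -
    have "d k \<in> closure (range (comb y))" for k
      unfolding closure_approachable
    proof (intro allI impI)
      fix e :: real assume "e > 0"
      then obtain m where m: "1 / real (Suc m) < e" using nat_approx_posE by (metis of_nat_Suc)
      have "y \<in> W k m" by (rule y) (auto simp: \<G>_def)
      then obtain c where "norm (d k - comb y c) < 1 / real (Suc m)" unfolding W_def by blast
      then show "\<exists>z\<in>range (comb y). dist z (d k) < e"
        using m by (intro bexI[of _ "comb y c"]) (auto simp: dist_norm norm_minus_commute)
    qed
    then have "closure (range d) \<subseteq> closure (range (comb y))" by (intro closure_minimal) auto
    then show ?thesis using d by auto
  qed
  ultimately show False using cover by blast
qed

section \<open>Adjoining finitely many vectors to a copy of \<open>l2\<close>\<close>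

lemma closure_subspace:
  fixes S :: "'a::real_normed_vector set"
  assumes S: "subspace S"
  shows "subspace (closure S)"
proof (rule subspaceI)
  show "0 \<in> closure S" using subspace_0[OF S] closure_subset by blast
  show "x + y \<in> closure S" if xy: "x \<in> closure S" "y \<in> closure S" for x y
  proof -
    obtain f g where f: "\<And>n. f n \<in> S" "f \<longlonglongrightarrow> x" and g: "\<And>n. g n \<in> S" "g \<longlonglongrightarrow> y"
      using xy unfolding closure_sequential by blast
    then show ?thesis
      unfolding closure_sequential
      by (intro exI[of _ "\<lambda>n. f n + g n"] conjI allI tendsto_add subspace_add[OF S])
  qed
  show "r *\<^sub>R x \<in> closure S" if x: "x \<in> closure S" for r x
  proof -
    obtain f where f: "\<And>n. f n \<in> S" "f \<longlonglongrightarrow> x" using x unfolding closure_sequential by blast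
    then show ?thesis
      unfolding closure_sequential
      by (intro exI[of _ "\<lambda>n. r *\<^sub>R f n"] conjI allI tendsto_scaleR tendsto_const subspace_scale[OF S])
  qed
qed

text \<open>The estimates of \<open>represents\<close> for \<open>mu_l2\<close> without density, for
  copies of \<open>l2\<close> that may be proper subspaces.\<close>

definition l2_equiv :: "real \<Rightarrow> (nat \<Rightarrow> 'a::real_normed_vector) \<Rightarrow> bool" where
  "l2_equiv K z \<longleftrightarrow> (\<forall>c. norm (comb z c) \<le> K * norm (comb unit_l2 c) \<and> norm (comb unit_l2 c) \<le> K * norm (comb z c))"

lemma norm_comb_unit_inj:
  assumes "inj s"
  shows "norm (comb (\<lambda>i. unit_l2 (s i)) c) = norm (comb unit_l2 c)"
proof -
  have "(norm (comb (\<lambda>i. unit_l2 (s i)) c))\<^sup>2 = (norm (comb unit_l2 c))\<^sup>2"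
    unfolding power2_norm_eq_inner comb_def inner_sum_left inner_sum_right
    using assms by (simp add: inj_eq)
  then show ?thesis by simp
qed

text \<open>The left shift of coordinates; written with \<open>comb\<close>, it is linear by
  construction.\<close>

definition drop1 :: "c00 \<Rightarrow> c00" where
  "drop1 = comb (\<lambda>i. case i of 0 \<Rightarrow> 0 | Suc j \<Rightarrow> bas j)"

lemma comb_case_nat: "comb (case_nat w z) c = lookup c 0 *\<^sub>R w + comb z (drop1 c)"
proof -
  have "linear (\<lambda>c. lookup c 0 *\<^sub>R w + comb z (drop1 c))"
    by (rule linearI) (simp_all add: drop1_def comb_add comb_scaleR lookup_add algebra_simps)
  then show ?thesis
    by (rule comb_unique[symmetric]) (auto simp: drop1_def lookup_single when_def split: nat.split)
qed

text \<open>If \<open>w\<close> lies outside the closed span, it is put in front and the unit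
  vectors are shifted to make room. The positive distance of \<open>w\<close> bounds its
  coefficient, so only the constant deteriorates.\<close>

lemma l2_equiv_extend:
  fixes z :: "nat \<Rightarrow> 'a::real_normed_vector"
  assumes z: "l2_equiv K z" and K: "K \<ge> 1"
  shows "\<exists>z' K'. K' \<ge> 1 \<and> l2_equiv K' z' \<and> w \<in> closure (range (comb z')) \<and>
    closure (range (comb z)) \<subseteq> closure (range (comb z'))"
proof (cases "w \<in> closure (range (comb z))")
  case False
  have sub: "subspace (closure (range (comb z)))" unfolding range_comb by (intro closure_subspace subspace_span)
  obtain d where d: "d > 0" "\<And>t s. s \<in> closure (range (comb z)) \<Longrightarrow> \<bar>t\<bar> * d \<le> norm (t *\<^sub>R w + s)"
    using subspace_dist[OF sub closed_closure False] by blast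
  define z' where "z' = case_nat w z"
  \<comment> \<open>The sum of the upper constant \<open>norm w + 2 * K\<close> and the lower
    constant \<open>1 / d + K * (1 + norm w / d)\<close>.\<close>
  define K' where "K' = norm w + 2 * K + 1 / d + K * (1 + norm w / d)"
  have unit: "comb unit_l2 c = lookup c 0 *\<^sub>R unit_l2 0 + comb (\<lambda>i. unit_l2 (Suc i)) (drop1 c)" for c
  proof -
    have "case_nat (unit_l2 0) (\<lambda>i. unit_l2 (Suc i)) = unit_l2" by (auto split: nat.split)
    then show ?thesis using comb_case_nat[of "unit_l2 0" "\<lambda>i. unit_l2 (Suc i)" c] by simp
  qed
  have nd: "norm (comb (\<lambda>i. unit_l2 (Suc i)) c) = norm (comb unit_l2 c)" for c
    by (rule norm_comb_unit_inj) simp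
  have "norm (comb z' c) \<le> K' * norm (comb unit_l2 c) \<and> norm (comb unit_l2 c) \<le> K' * norm (comb z' c)" for c
  proof -
    define t where "t = lookup c 0"
    define n where "n = norm (comb unit_l2 c)"
    define m where "m = norm (comb unit_l2 (drop1 c))"
    define s where "s = comb z (drop1 c)"
    define X where "X = norm (comb z' c)"
    have X: "X = norm (t *\<^sub>R w + s)" by (simp add: X_def z'_def comb_case_nat t_def s_def)
    have n0: "0 \<le> n" "0 \<le> m" "0 \<le> X" by (simp_all add: n_def m_def X_def)
    have t: "\<bar>t\<bar> \<le> n" using l2_nth_le_norm[of "comb unit_l2 c" 0] by (simp add: comb_unit_l2_nth t_def n_def)
    have "comb (\<lambda>i. unit_l2 (Suc i)) (drop1 c) = comb unit_l2 c - t *\<^sub>R unit_l2 0" by (simp add: unit t_def)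
    then have "m \<le> n + \<bar>t\<bar>"
      using norm_triangle_ineq4[of "comb unit_l2 c" "t *\<^sub>R unit_l2 0"] by (simp add: m_def n_def flip: nd)
    then have m: "m \<le> 2 * n" using t by simp
    have nm: "n \<le> \<bar>t\<bar> + m"
      using norm_triangle_ineq[of "t *\<^sub>R unit_l2 0" "comb (\<lambda>i. unit_l2 (Suc i)) (drop1 c)"]
      by (simp add: n_def m_def unit[of c] t_def nd)
    have zs: "norm s \<le> K * m" "m \<le> K * norm s" using z by (auto simp: l2_equiv_def s_def m_def)
    have "X \<le> \<bar>t\<bar> * norm w + norm s" unfolding X using norm_triangle_ineq[of "t *\<^sub>R w" s] by simp
    also have "\<dots> \<le> n * norm w + K * (2 * n)"
      using t order_trans[OF zs(1) mult_left_mono[OF m, of K]] K by (intro add_mono mult_right_mono) auto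
    also have "\<dots> = (norm w + 2 * K) * n" by (simp add: algebra_simps)
    also have "\<dots> \<le> K' * n" using n0 K d(1) by (intro mult_right_mono) (auto simp: K'_def)
    finally have up: "X \<le> K' * n" .
    have "s \<in> closure (range (comb z))" unfolding s_def by (rule subsetD[OF closure_subset]) simp
    then have tX: "\<bar>t\<bar> \<le> X / d" using d by (simp add: X field_simps)
    have "norm s \<le> X + \<bar>t\<bar> * norm w"
      using norm_triangle_ineq4[of "t *\<^sub>R w + s" "t *\<^sub>R w"] by (simp add: X)
    also have "\<dots> \<le> X + X / d * norm w" using tX by (intro add_left_mono mult_right_mono) auto
    finally have "K * norm s \<le> K * (X + X / d * norm w)" using K by (intro mult_left_mono) auto
    then have "n \<le> X / d + K * (X + X / d * norm w)" using nm zs(2) tX by linarith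
    also have "\<dots> = (1 / d + K * (1 + norm w / d)) * X" by (simp add: algebra_simps)
    also have "\<dots> \<le> K' * X" using n0 K by (intro mult_right_mono) (auto simp: K'_def)
    finally show ?thesis using up by (simp add: X_def n_def)
  qed
  then have "l2_equiv K' z'" by (simp add: l2_equiv_def)
  moreover have "1 \<le> K'"
  proof -
    have "0 \<le> K * (1 + norm w / d)" "0 \<le> 1 / d" using K d(1) by simp_all
    then show ?thesis unfolding K'_def using K norm_ge_zero[of w] by linarith
  qed
  moreover have "range (comb z) \<subseteq> range (comb z')"
    unfolding range_comb by (intro span_mono) (auto simp: z'_def intro: rev_image_eqI[of "Suc _"])
  then have "closure (range (comb z)) \<subseteq> closure (range (comb z'))" by (rule closure_mono)
  moreover have "w \<in> closure (range (comb z'))"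
  proof -
    have "w = comb z' (bas 0)" by (simp only: z'_def comb_bas nat.case)
    then have "w \<in> range (comb z')" by (rule range_eqI)
    then show ?thesis by (rule subsetD[OF closure_subset])
  qed
  ultimately show ?thesis by blast
qed (use z K in blast)

text \<open>The first \<open>k\<close> vectors are adjoined one at a time with
  \<open>l2_equiv_extend\<close>; afterwards the closed span contains every \<open>x i\<close> and
  hence the whole space.\<close>

lemma isomorphic_l2_of_finite_codim:
  fixes x :: "nat \<Rightarrow> 'a::banach"
  assumes K: "K \<ge> 1" and z: "l2_equiv K (\<lambda>i. x (k + i))" and dense: "closure (range (comb x)) = UNIV"
  shows "linearly_isomorphic (space_of_type TYPE('a)) (space_of_type TYPE(l2))"
proof -
  have "\<exists>z' K'. K' \<ge> 1 \<and> l2_equiv K' z' \<and> (\<forall>i<j. x i \<in> closure (range (comb z'))) \<and>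
    closure (range (comb (\<lambda>i. x (k + i)))) \<subseteq> closure (range (comb z'))" for j
  proof (induction j)
    case 0
    then show ?case using z K by blast
  next
    case (Suc j)
    then obtain z' K' where 1: "K' \<ge> 1" "l2_equiv K' z'" "\<forall>i<j. x i \<in> closure (range (comb z'))"
      "closure (range (comb (\<lambda>i. x (k + i)))) \<subseteq> closure (range (comb z'))" by blast
    from l2_equiv_extend[OF 1(2,1), of "x j"] obtain z'' K'' where 2: "K'' \<ge> 1" "l2_equiv K'' z''"
      "x j \<in> closure (range (comb z''))" "closure (range (comb z')) \<subseteq> closure (range (comb z''))" by blast
    have "\<forall>i<Suc j. x i \<in> closure (range (comb z''))" using 1(3) 2(3,4) by (auto simp: less_Suc_eq)
    moreover have "closure (range (comb (\<lambda>i. x (k + i)))) \<subseteq> closure (range (comb z''))"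
      using 1(4) 2(4) by (rule subset_trans)
    ultimately show ?case using 2(1,2) by blast
  qed
  then obtain z' K' where z': "K' \<ge> 1" "l2_equiv K' z'" "\<forall>i<k. x i \<in> closure (range (comb z'))"
    "closure (range (comb (\<lambda>i. x (k + i)))) \<subseteq> closure (range (comb z'))" by blast
  have "x i \<in> closure (range (comb z'))" for i
  proof (cases "i < k")
    case False
    then have "x i \<in> range (comb (\<lambda>i. x (k + i)))"
      using comb_bas[of "\<lambda>i. x (k + i)" "i - k"] by (metis le_add_diff_inverse not_less rangeI)
    then show ?thesis using z'(4) closure_subset by blast
  qed (use z' in blast)
  moreover have "subspace (closure (range (comb z')))" unfolding range_comb by (intro closure_subspace subspace_span)
  ultimately have "span (range x) \<subseteq> closure (range (comb z'))" by (intro span_minimal) auto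
  then have "closure (range (comb x)) \<subseteq> closure (range (comb z'))"
    unfolding range_comb[of x] by (intro closure_minimal) auto
  then have "closure (range (comb z')) = UNIV" using dense by auto
  then have "represents K' mu_l2 z'"
    using z'(2) by (simp add: represents_def l2_equiv_def mu_l2_def mu_of_def)
  then obtain f where "bounded_iso K' (X_space mu_l2) (space_of_type TYPE('a)) f"
    using bounded_iso_of_represents[of mu_l2 K' z'] z'(1) mu_of_pseudonorm[of unit_l2] by (auto simp: mu_l2_def)
  then have "linearly_isomorphic (X_space mu_l2) (space_of_type TYPE('a))"
    unfolding linearly_isomorphic_iff by blast
  moreover have "linearly_isomorphic (X_space mu_l2) (space_of_type TYPE(l2))"
    using isometric_X_mu_l2 unfolding linearly_isomorphic_iff linearly_isometric_iff by blast
  ultimately show ?thesis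
    using isomorphic_via_X[of mu_l2] mu_of_pseudonorm[of unit_l2] by (simp add: mu_l2_def)
qed

section \<open>Limits of almost Euclidean extensions\<close>

lemma sum_lessThan_add: "(\<Sum>i<k + n. f i) = (\<Sum>i<k. f i) + (\<Sum>j<n. f (k + j :: nat))"
  by (induction n) (simp_all add: add.assoc)

definition shift :: "nat \<Rightarrow> nat \<Rightarrow> nat \<Rightarrow> nat" where
  "shift k N i = (if i < k then i else i + N)"

text \<open>A relabelling of the basis: composing a seminorm with it discards the coordinates from
  \<open>k\<close> to \<open>k + N - 1\<close>.\<close>

definition spread :: "nat \<Rightarrow> nat \<Rightarrow> c00 \<Rightarrow> c00" where
  "spread k N = comb (\<lambda>i. bas (shift k N i))"

lemma inj_shift: "inj (shift k N)"
  by (rule injI) (auto simp: shift_def split: if_splits)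

lemma comb_spread: "comb y (spread k N c) = comb (\<lambda>i. y (shift k N i)) c"
  unfolding spread_def by (subst comb_image[OF linear_comb]) simp

lemma lookup_spread: "lookup (spread k N c) (shift k N j) = lookup c j"
proof -
  have "lookup (spread k N c) (shift k N j) = (\<Sum>i\<in>Poly_Mapping.keys c. if i = j then lookup c i else 0)"
    unfolding spread_def comb_def lookup_sum
    by (intro sum.cong) (auto simp: lookup_single when_def inj_eq[OF inj_shift])
  then show ?thesis by (auto simp: in_keys_iff)
qed

lemma keys_spread: "Poly_Mapping.keys (spread k N c) \<subseteq> shift k N ` Poly_Mapping.keys c"
proof
  fix l assume l: "l \<in> Poly_Mapping.keys (spread k N c)"
  show "l \<in> shift k N ` Poly_Mapping.keys c"
  proof (rule ccontr)
    assume "l \<notin> shift k N ` Poly_Mapping.keys c"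
    then have "lookup (spread k N c) l = 0"
      unfolding spread_def comb_def lookup_sum
      by (intro sum.neutral) (auto simp: lookup_single when_def)
    then show False using l by (simp add: in_keys_iff)
  qed
qed

text \<open>The prefix is continued with better and better Euclidean systems. Their position
  relative to the prefix is uncontrolled, so the seminorms need not converge, but they lie in a
  compact product and have a cluster point. A sequence relabelled by \<open>shift k N\<close> still
  starts with the prefix, which gives the last clause for every \<open>N\<close>.\<close>

lemma limit_seminorm:
  fixes x :: "nat \<Rightarrow> 'a::real_normed_vector"
  assumes inf: "inf_dim TYPE('a)"
  shows "\<exists>\<nu>. seminorm \<nu> \<and>
    (\<forall>c. Poly_Mapping.keys c \<subseteq> {..<k} \<longrightarrow> \<nu> c = norm (comb x c)) \<and>
    (\<forall>c. Poly_Mapping.keys c \<inter> {..<k} = {} \<longrightarrow> \<nu> c = norm (comb unit_l2 c)) \<and>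
    (\<forall>F N. closed F \<longrightarrow> (\<forall>y. (\<forall>i<k. y i = x i) \<longrightarrow> mu_of y \<in> F) \<longrightarrow> (\<lambda>v. \<nu> (spread k N (emb v))) \<in> F)"
proof -
  define \<epsilon> where "\<epsilon> m = 1 / (real m + 1)" for m :: nat
  have \<epsilon>: "0 < \<epsilon> m" "\<epsilon> m \<le> 1" for m by (simp_all add: \<epsilon>_def)
  have "\<exists>u :: nat \<Rightarrow> 'a. almost_euclidean (Suc m) (\<epsilon> m) u" for m
    using Dvoretzky[OF inf, of "Suc m" "\<epsilon> m"] \<epsilon>[of m] by simp
  then obtain u :: "nat \<Rightarrow> nat \<Rightarrow> 'a" where u: "\<And>m. almost_euclidean (Suc m) (\<epsilon> m) (u m)" by metis
  \<comment> \<open>The tail may be filled with zeros because the closed sets in question contain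
    the pseudonorms of all continuations, dependent ones included.\<close>
  define y where "y m i = (if i < k then x i else if i - k < Suc m then u m (i - k) else 0)" for m i
  have u2: "norm (u m j) \<le> 2" if "j < Suc m" for m j
  proof -
    define e :: "nat \<Rightarrow> real" where "e i = (if i = j then 1 else 0)" for i
    have "(\<Sum>i<Suc m. e i *\<^sub>R u m i) = (\<Sum>i<Suc m. if i = j then u m j else 0)"
      by (intro sum.cong) (auto simp: e_def)
    then have 1: "(\<Sum>i<Suc m. e i *\<^sub>R u m i) = u m j" using that by (simp del: sum.lessThan_Suc)
    have "(\<Sum>i<Suc m. (e i)\<^sup>2) = (\<Sum>i<Suc m. if i = j then 1 else 0)"
      by (intro sum.cong) (auto simp: e_def)
    then have 2: "(\<Sum>i<Suc m. (e i)\<^sup>2) = 1" using that by (simp del: sum.lessThan_Suc)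
    have "norm (u m j) \<le> (1 + \<epsilon> m) * 1"
      using u[of m] unfolding almost_euclidean_def by (metis 1 2 real_sqrt_one)
    then show ?thesis using \<epsilon>(2)[of m] by simp
  qed
  have y2: "norm (y m i) \<le> norm (x i) + 2" for m i
    using u2[of "i - k" m] by (auto simp: y_def add_increasing)
  define \<nu>s where "\<nu>s m c = norm (comb (y m) c)" for m c
  define bd where "bd c = (\<Sum>i\<in>Poly_Mapping.keys c. \<bar>lookup c i\<bar> * (norm (x i) + 2))" for c :: c00
  define U where "U = (PiE UNIV (\<lambda>c. {0..bd c}) :: (c00 \<Rightarrow> real) set)"
  have "compact U"
    unfolding U_def compactin_euclidean_iff[symmetric] euclidean_product_topology[symmetric] compactin_PiE
    by simp
  have "\<nu>s m c \<le> bd c" for m c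
    unfolding \<nu>s_def comb_def bd_def
    by (rule sum_norm_le) (use y2 in \<open>simp add: mult_left_mono\<close>)
  then have inU: "\<nu>s m \<in> U" for m by (auto simp: U_def \<nu>s_def)
  define F0 where "F0 = filtermap \<nu>s sequentially"
  have "F0 \<noteq> bot" by (simp add: F0_def filtermap_bot_iff)
  moreover have "eventually (\<lambda>g. g \<in> U) F0" by (simp add: F0_def eventually_filtermap inU)
  ultimately obtain \<nu> where "inf (nhds \<nu>) F0 \<noteq> bot"
    using \<open>compact U\<close> unfolding compact_filter by blast
  \<comment> \<open>Along this filter every evaluation converges to that of \<open>\<nu>\<close>,
    and whatever holds for every \<open>\<nu>s m\<close> holds eventually.\<close>
  define A where "A = inf (nhds \<nu>) F0"
  have A: "A \<noteq> bot" "A \<le> nhds \<nu>" "A \<le> F0"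
    using \<open>inf (nhds \<nu>) F0 \<noteq> bot\<close> by (simp_all add: A_def)
  have lim: "((\<lambda>g. g c) \<longlongrightarrow> \<nu> c) A" for c
  proof -
    have "((\<lambda>g. g c) \<longlongrightarrow> \<nu> c) (at \<nu>)"
      using continuous_on_product_coordinates[of c, unfolded continuous_on_def] by auto
    then have "((\<lambda>g. g c) \<longlongrightarrow> \<nu> c) (nhds \<nu>)"
      using tendsto_at_iff_tendsto_nhds[of "\<lambda>g. g c" \<nu>] by blast
    then show ?thesis using A(2) tendsto_mono by blast
  qed
  have ev: "eventually P A" if "\<And>m. P (\<nu>s m)" for P
    using A(3) that by (auto simp: le_filter_def F0_def eventually_filtermap)
  have semi: "seminorm (\<nu>s m)" for m unfolding \<nu>s_def[abs_def] by (rule seminorm_norm_comb)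
  have "seminorm \<nu>"
  proof
    fix c d :: c00 and r :: real
    show "\<nu> (c + d) \<le> \<nu> c + \<nu> d"
      by (rule tendsto_le[OF A(1) tendsto_add[OF lim lim] lim]) (rule ev, rule seminorm.triangle[OF semi])
    have "((\<lambda>g. g (r *\<^sub>R c) - \<bar>r\<bar> * g c) \<longlongrightarrow> 0) A"
      by (rule tendsto_eventually) (rule ev, simp add: seminorm.scale[OF semi])
    moreover have "((\<lambda>g. g (r *\<^sub>R c) - \<bar>r\<bar> * g c) \<longlongrightarrow> \<nu> (r *\<^sub>R c) - \<bar>r\<bar> * \<nu> c) A"
      by (intro tendsto_intros lim)
    ultimately show "\<nu> (r *\<^sub>R c) = \<bar>r\<bar> * \<nu> c" using tendsto_unique[OF A(1)] by fastforce
  qed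
  moreover have "\<nu> c = norm (comb x c)" if c: "Poly_Mapping.keys c \<subseteq> {..<k}" for c
  proof -
    have "\<nu>s m c = norm (comb x c)" for m
      unfolding \<nu>s_def comb_eq_sum_lessThan[OF c] by (simp add: y_def)
    then have "((\<lambda>g. g c) \<longlongrightarrow> norm (comb x c)) A" by (intro tendsto_eventually ev)
    then show ?thesis using tendsto_unique[OF A(1) lim] by blast
  qed
  moreover have "\<nu> c = norm (comb unit_l2 c)" if c: "Poly_Mapping.keys c \<inter> {..<k} = {}" for c
  proof -
    define r where "r = norm (comb unit_l2 c)"
    have c0: "lookup c i = 0" if "i < k" for i
    proof -
      have "i \<notin> Poly_Mapping.keys c" using c that by auto
      then show ?thesis by (simp add: in_keys_iff)
    qed
    obtain M where M: "Poly_Mapping.keys c \<subseteq> {..<M}" using keys_bounded by blast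
    have close: "\<bar>\<nu>s m c - r\<bar> \<le> \<epsilon> m * r" if "m \<ge> M" for m
    proof -
      have sub: "Poly_Mapping.keys c \<subseteq> {..<k + Suc m}" using M that by fastforce
      have "r = sqrt (\<Sum>j<Suc m. (lookup c (k + j))\<^sup>2)"
        unfolding r_def norm_comb_unit_l2[OF sub] sum_lessThan_add by (simp add: c0 del: sum.lessThan_Suc)
      moreover have "\<nu>s m c = norm (\<Sum>j<Suc m. lookup c (k + j) *\<^sub>R u m j)"
        unfolding \<nu>s_def comb_eq_sum_lessThan[OF sub] sum_lessThan_add
        by (simp add: c0 y_def del: sum.lessThan_Suc)
      ultimately have "(1 - \<epsilon> m) * r \<le> \<nu>s m c \<and> \<nu>s m c \<le> (1 + \<epsilon> m) * r"
        using u[of m] unfolding almost_euclidean_def by (simp only:)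
      then show ?thesis by (simp add: algebra_simps abs_le_iff)
    qed
    have "\<epsilon> \<longlonglongrightarrow> 0" unfolding \<epsilon>_def by real_asymp
    then have "(\<lambda>m. \<epsilon> m * r) \<longlonglongrightarrow> 0" by (rule tendsto_mult_left_zero)
    then have "(\<lambda>m. \<nu>s m c - r) \<longlonglongrightarrow> 0"
      by (rule Lim_null_comparison[rotated]) (use close in \<open>auto simp: eventually_sequentially\<close>)
    then have "(\<lambda>m. \<nu>s m c) \<longlonglongrightarrow> r" by (simp add: LIM_zero_iff)
    then have "((\<lambda>g. g c) \<longlongrightarrow> r) F0" by (simp add: F0_def filterlim_filtermap)
    then have "((\<lambda>g. g c) \<longlongrightarrow> r) A" using A(3) tendsto_mono by blast
    then show ?thesis using tendsto_unique[OF A(1) lim] by (simp add: r_def)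
  qed
  moreover have "(\<lambda>v. \<nu> (spread k N (emb v))) \<in> F"
    if F: "closed F" "\<forall>y. (\<forall>i<k. y i = x i) \<longrightarrow> mu_of y \<in> F" for F N
  proof (rule closed_fun_limit[OF F(1) A(1)])
    show "eventually (\<lambda>g. (\<lambda>v. g (spread k N (emb v))) \<in> F) A"
    proof (rule ev)
      fix m
      have "(\<lambda>v. \<nu>s m (spread k N (emb v))) = mu_of (\<lambda>i. y m (shift k N i))"
        by (simp add: fun_eq_iff mu_of_def \<nu>s_def comb_spread)
      then show "(\<lambda>v. \<nu>s m (spread k N (emb v))) \<in> F" using F(2) by (simp add: y_def shift_def)
    qed
    show "((\<lambda>g. g (spread k N (emb v))) \<longlongrightarrow> \<nu> (spread k N (emb v))) A" for v by (rule lim)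
  qed
  ultimately show ?thesis by blast
qed

text \<open>The kernel of \<open>\<nu>\<close> meets the vectors supported beyond \<open>k\<close> only in \<open>0\<close>, so its
  dimension is at most \<open>k\<close>, and it is avoided by discarding finitely many coordinates after \<open>k\<close>.\<close>
lemma kernel_avoiding_shift:
  fixes \<nu> :: "c00 \<Rightarrow> real"
  assumes \<nu>: "seminorm \<nu>"
    and low: "\<And>c. Poly_Mapping.keys c \<subseteq> {..<k} \<Longrightarrow> \<nu> c = 0 \<Longrightarrow> c = 0"
    and high: "\<And>c. Poly_Mapping.keys c \<inter> {..<k} = {} \<Longrightarrow> \<nu> c = 0 \<Longrightarrow> c = 0"
  shows "\<exists>N. \<forall>c. \<nu> (spread k N c) = 0 \<longrightarrow> c = 0"
proof -
  interpret seminorm \<nu> by (rule \<nu>)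
  have "\<exists>N. \<forall>c. \<nu> c = 0 \<longrightarrow> Poly_Mapping.keys c \<subseteq> {..<j} \<union> {k + N..} \<longrightarrow> c = 0" if "j \<le> k" for j
    using that
  proof (induction j)
    case 0
    have "c = 0" if "\<nu> c = 0" "Poly_Mapping.keys c \<subseteq> {..<0} \<union> {k + 0..}" for c
      using that by (intro high) auto
    then show ?case by blast
  next
    case (Suc j)
    then obtain N where N: "\<And>c. \<nu> c = 0 \<Longrightarrow> Poly_Mapping.keys c \<subseteq> {..<j} \<union> {k + N..} \<Longrightarrow> c = 0"
      using Suc_leD by blast
    show ?case
    proof (cases "\<exists>c. \<nu> c = 0 \<and> Poly_Mapping.keys c \<subseteq> {..<Suc j} \<union> {k + N..} \<and> c \<noteq> 0")
      case True
      then obtain c0 where c0: "\<nu> c0 = 0" "Poly_Mapping.keys c0 \<subseteq> {..<Suc j} \<union> {k + N..}" "c0 \<noteq> 0"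
        by blast
      have "j \<in> Poly_Mapping.keys c0"
      proof (rule ccontr)
        assume "j \<notin> Poly_Mapping.keys c0"
        then have "Poly_Mapping.keys c0 \<subseteq> {..<j} \<union> {k + N..}" using c0(2) by (auto simp: less_Suc_eq)
        then show False using N c0 by blast
      qed
      then have j0: "lookup c0 j \<noteq> 0" by (simp add: in_keys_iff)
      \<comment> \<open>Moving the gap past the support of \<open>c0\<close> removes the kernel:
        after cancelling coordinate \<open>j\<close>, a further kernel vector is a multiple of
        \<open>c0\<close> by the choice of \<open>N\<close>, hence supported below \<open>k\<close>,
        where \<open>low\<close> applies.\<close>
      obtain M where M: "Poly_Mapping.keys c0 \<subseteq> {..<M}" using keys_bounded by blast
      have "c = 0" if c: "\<nu> c = 0" "Poly_Mapping.keys c \<subseteq> {..<Suc j} \<union> {k + (N + M)..}" for c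
      proof (rule ccontr)
        assume "c \<noteq> 0"
        define t where "t = lookup c j / lookup c0 j"
        have "\<nu> (c - t *\<^sub>R c0) \<le> \<nu> c + \<nu> (- (t *\<^sub>R c0))" using triangle[of c "- (t *\<^sub>R c0)"] by simp
        then have "\<nu> (c - t *\<^sub>R c0) = 0"
          using c(1) c0(1) nonneg[of "c - t *\<^sub>R c0"] by (simp add: scale)
        moreover have "Poly_Mapping.keys (c - t *\<^sub>R c0) \<subseteq> {..<j} \<union> {k + N..}"
        proof
          fix i assume i: "i \<in> Poly_Mapping.keys (c - t *\<^sub>R c0)"
          then have "lookup c i - t * lookup c0 i \<noteq> 0" by (simp add: in_keys_iff lookup_minus)
          then have "i \<noteq> j" "i \<in> Poly_Mapping.keys c \<union> Poly_Mapping.keys c0"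
            using j0 by (auto simp: t_def in_keys_iff)
          then show "i \<in> {..<j} \<union> {k + N..}" using c(2) c0(2) by (auto simp: less_Suc_eq)
        qed
        ultimately have "c - t *\<^sub>R c0 = 0" using N by blast
        then have eq: "c = t *\<^sub>R c0" by simp
        then have "t \<noteq> 0" using \<open>c \<noteq> 0\<close> by auto
        then have "Poly_Mapping.keys c = Poly_Mapping.keys c0" by (auto simp: eq in_keys_iff)
        then have "Poly_Mapping.keys c \<subseteq> {..<k}" using c(2) M Suc.prems by force
        then show False using low c(1) \<open>c \<noteq> 0\<close> by blast
      qed
      then show ?thesis by blast
    qed blast
  qed
  from this[of k] obtain N where N: "\<And>c. \<nu> c = 0 \<Longrightarrow> Poly_Mapping.keys c \<subseteq> {..<k} \<union> {k + N..} \<Longrightarrow> c = 0"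
    by blast
  have "c = 0" if "\<nu> (spread k N c) = 0" for c
  proof -
    have "Poly_Mapping.keys (spread k N c) \<subseteq> {..<k} \<union> {k + N..}"
      using keys_spread[of k N c] by (auto simp: shift_def split: if_splits)
    then have "spread k N c = 0" using N that by blast
    then show ?thesis using lookup_spread[of k N c] by (intro poly_mapping_eqI) simp
  qed
  then show ?thesis by blast
qed

text \<open>Coordinates with respect to a finite spanning set would map the unit vectors to an independent
  sequence in a finite-dimensional space.\<close>
lemma infinite_dimensional_cpl_of_norm:
  assumes \<nu>: "seminorm \<nu>" and norm: "\<And>c. \<nu> c = 0 \<Longrightarrow> c = 0"
  shows "infinite_dimensional (cpl \<nu>)"
  unfolding infinite_dimensional_def
proof clarify
  fix B assume B: "finite B" "B \<subseteq> points (cpl \<nu>)" "nspan (cpl \<nu>) B = points (cpl \<nu>)"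
  obtain \<beta> and n :: nat where \<beta>: "B = \<beta> ` {..<n}"
    using finite_imp_nat_seg_image_inj_on[OF B(1)] by (auto simp: lessThan_def)
  have "\<forall>k. \<exists>a. k < n \<longrightarrow> ncauchy \<nu> a \<and> \<beta> k = lim_pt \<nu> a" using B(2) by (auto simp: \<beta> points_cpl[OF \<nu>])
  then obtain a where a: "\<And>k. k < n \<Longrightarrow> ncauchy \<nu> (a k) \<and> \<beta> k = lim_pt \<nu> (a k)" by metis
  define S where "S t m = comb (\<lambda>k. if k < n then a k m else 0) t" for t m
  have S_add: "S (s + t) = (\<lambda>m. S s m + S t m)" and S_scale: "S (r *\<^sub>R t) = (\<lambda>m. r *\<^sub>R S t m)" for s t r
    by (simp_all add: S_def[abs_def] comb_add comb_scaleR)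
  have span: "\<exists>t. Poly_Mapping.keys t \<subseteq> {..<n} \<and> ncauchy \<nu> (S t) \<and> p = lim_pt \<nu> (S t)"
    if "p \<in> nspan (cpl \<nu>) B" for p
    using that
  proof induction
    case (base p)
    then obtain k where k: "k < n" "p = \<beta> k" by (auto simp: \<beta>)
    then have "S (bas k) = a k" by (simp add: S_def[abs_def])
    then show ?case using a[OF k(1)] k by (intro exI[of _ "bas k"]) auto
  next
    case (add p q)
    then obtain s t where "Poly_Mapping.keys s \<subseteq> {..<n}" "ncauchy \<nu> (S s)" "p = lim_pt \<nu> (S s)"
      "Poly_Mapping.keys t \<subseteq> {..<n}" "ncauchy \<nu> (S t)" "q = lim_pt \<nu> (S t)" by blast
    then show ?case
      using Poly_Mapping.keys_add[of s t] ncauchy_add_scale(1)[OF \<nu>, of "S s" "S t"]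
      by (intro exI[of _ "s + t"]) (auto simp: S_add nadd_cpl[OF \<nu>])
  next
    case (scale p r)
    then obtain t where "Poly_Mapping.keys t \<subseteq> {..<n}" "ncauchy \<nu> (S t)" "p = lim_pt \<nu> (S t)" by blast
    moreover have "Poly_Mapping.keys (r *\<^sub>R t) \<subseteq> Poly_Mapping.keys t" by (auto simp: in_keys_iff)
    ultimately show ?case
      using ncauchy_add_scale(2)[OF \<nu>, of "S t" r]
      by (intro exI[of _ "r *\<^sub>R t"]) (auto simp: S_scale nscale_cpl[OF \<nu>])
  qed
  have "\<exists>t. Poly_Mapping.keys t \<subseteq> {..<n} \<and> (\<lambda>m. \<nu> (bas i - S t m)) \<longlonglongrightarrow> 0" for i
  proof -
    have "lim_pt \<nu> (\<lambda>_. bas i) \<in> nspan (cpl \<nu>) B" by (simp add: B(3) lim_pt_const_points[OF \<nu>])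
    from span[OF this] obtain t where t: "Poly_Mapping.keys t \<subseteq> {..<n}" "ncauchy \<nu> (S t)"
      "lim_pt \<nu> (\<lambda>_. bas i) = lim_pt \<nu> (S t)" by blast
    then show ?thesis using lim_pt_eq_iff[OF \<nu> ncauchy_const[OF \<nu>] t(2)] by blast
  qed
  then obtain T where T: "\<And>i. Poly_Mapping.keys (T i) \<subseteq> {..<n}" "\<And>i. (\<lambda>m. \<nu> (bas i - S (T i) m)) \<longlonglongrightarrow> 0"
    by metis
  have "indep_seq T"
    unfolding indep_seq_def
  proof (intro allI impI)
    fix c assume c: "comb T c = 0"
    \<comment> \<open>A relation among the coordinate vectors \<open>T i\<close> kills the spanned
      part, so only approximation errors remain, and these tend to 0.\<close>
    have "\<nu> c \<le> (\<Sum>i\<in>Poly_Mapping.keys c. \<bar>lookup c i\<bar> * \<nu> (bas i - S (T i) m))" for m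
    proof -
      have lin: "linear (\<lambda>t. S t m)" by (simp add: S_def linear_comb)
      have "(\<Sum>i\<in>Poly_Mapping.keys c. lookup c i *\<^sub>R S (T i) m) = S (comb T c) m"
        unfolding comb_def[of T c] by (simp add: linear_sum[OF lin] linear_scale[OF lin])
      also have "\<dots> = 0" unfolding c by (rule linear_0[OF lin])
      finally have "(\<Sum>i\<in>Poly_Mapping.keys c. lookup c i *\<^sub>R (bas i - S (T i) m)) = c"
        by (simp add: scaleR_diff_right sum_subtractf c00_expand)
      then have "\<nu> c = \<nu> (\<Sum>i\<in>Poly_Mapping.keys c. lookup c i *\<^sub>R (bas i - S (T i) m))" by simp
      also have "\<dots> \<le> (\<Sum>i\<in>Poly_Mapping.keys c. \<nu> (lookup c i *\<^sub>R (bas i - S (T i) m)))"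
        by (rule seminorm.sum_le[OF \<nu>])
      finally show ?thesis by (simp only: seminorm.scale[OF \<nu>])
    qed
    moreover have "(\<lambda>m. \<Sum>i\<in>Poly_Mapping.keys c. \<bar>lookup c i\<bar> * \<nu> (bas i - S (T i) m)) \<longlonglongrightarrow> 0"
      by (intro tendsto_null_sum tendsto_mult_right_zero T)
    ultimately have "\<nu> c \<le> 0" by (intro LIMSEQ_le_const) auto
    then show "c = 0" using seminorm.nonneg[OF \<nu>, of c] by (intro norm) simp
  qed
  moreover have "T i \<in> span (bas ` {..<n})" for i
  proof -
    have "T i = (\<Sum>j\<in>{..<n}. lookup (T i) j *\<^sub>R bas j)" using T(1) by (simp add: c00_expand)
    then show ?thesis by (metis (no_types, lifting) imageI span_base span_scale span_sum)
  qed
  ultimately show False using indep_seq_not_in_finite_span[of T "bas ` {..<n}"] by blast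
qed

lemma continuous_mu_of: "continuous_on UNIV (mu_of :: (nat \<Rightarrow> 'a::real_normed_vector) \<Rightarrow> V \<Rightarrow> real)"
  unfolding mu_of_def[abs_def]
  by (intro continuous_on_coordinatewise_then_product continuous_on_norm continuous_comb)

lemma l2_of_fsigma_isomorphism_class:
  assumes I: "I \<subseteq> P_infty" "B_norms \<subseteq> I"
    and sep: "separable_space (euclidean :: 'a::banach topology)"
    and inf: "infinite_dimensional (space_of_type TYPE('a))"
    and fs: "fsigma_in (subtopology (powertop_real UNIV) I)
      {\<mu> \<in> I. linearly_isomorphic (X_space \<mu>) (space_of_type TYPE('a))}"
  shows "linearly_isomorphic (space_of_type TYPE('a)) (space_of_type TYPE(l2))"
proof -
  define S where "S = {\<mu> \<in> I. linearly_isomorphic (X_space \<mu>) (space_of_type TYPE('a))}"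
  have inf': "inf_dim TYPE('a)" using inf by (simp add: inf_dim_iff)
  obtain d :: "nat \<Rightarrow> 'a" where d: "closure (range d) = UNIV" using dense_sequence[OF sep] .
  obtain D where D: "\<And>n::nat. closedin (subtopology (powertop_real UNIV) I) (D n)" "\<Union> (range D) = S"
    using fs unfolding fsigma_in_ascending S_def[symmetric] by blast
  then have "\<forall>n. \<exists>F. closed F \<and> D n = F \<inter> I" unfolding closedin_powertop_iff by blast
  then obtain F where F: "\<And>n. closed (F n)" "\<And>n. D n = F n \<inter> I" by metis
  define C where "C n = (mu_of -` F n :: (nat \<Rightarrow> 'a) set)" for n
  have "\<exists>n k x. \<exists>\<epsilon>>0. \<forall>y. (\<forall>i<k. dist (y i) (x i) < \<epsilon>) \<longrightarrow> y \<in> C n"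
  proof (rule Baire_sequences[OF inf' d])
    show "closed (C n)" for n unfolding C_def by (rule closed_vimage[OF F(1) continuous_mu_of])
    fix y :: "nat \<Rightarrow> 'a" assume y: "indep_seq y" "closure (range (comb y)) = UNIV"
    have "mu_of y \<in> I" using mu_of_B_norms[OF y(2) inf] y(1) I by (auto simp: indep_seq_def)
    moreover obtain f where "bounded_iso 1 (X_space (mu_of y)) (space_of_type TYPE('a)) f"
      using bounded_iso_of_represents[OF mu_of_pseudonorm represents_mu_of[OF y(2)]] by auto
    ultimately have "mu_of y \<in> S" by (auto simp: S_def linearly_isomorphic_iff)
    then show "\<exists>n. y \<in> C n" using D(2) F(2) by (auto simp: C_def)
  qed
  then obtain n k x0 \<epsilon> where \<epsilon>: "\<epsilon> > 0" "\<And>y. (\<forall>i<k. dist (y i) (x0 i) < \<epsilon>) \<Longrightarrow> mu_of (y :: nat \<Rightarrow> 'a) \<in> F n"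
    by (auto simp: C_def)
  \<comment> \<open>Moving the centre within the cylinder makes its vectors independent, so
    \<open>\<nu>\<close> has no kernel on the first \<open>k\<close> coordinates.\<close>
  obtain x where x: "\<forall>i. dist (x i) (x0 i) < \<epsilon>" "\<forall>i. x i \<notin> span (x ` {..<i})"
    using independent_perturbation[OF inf' \<epsilon>(1)] by blast
  have inF: "\<forall>y. (\<forall>i<k. y i = x i) \<longrightarrow> mu_of y \<in> F n" using x(1) by (auto intro!: \<epsilon>(2))
  obtain \<nu> where \<nu>: "seminorm \<nu>"
    and low: "\<forall>c. Poly_Mapping.keys c \<subseteq> {..<k} \<longrightarrow> \<nu> c = norm (comb x c)"
    and high: "\<forall>c. Poly_Mapping.keys c \<inter> {..<k} = {} \<longrightarrow> \<nu> c = norm (comb unit_l2 c)"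
    and lim: "\<forall>F N. closed F \<longrightarrow> (\<forall>y. (\<forall>i<k. y i = x i) \<longrightarrow> mu_of y \<in> F) \<longrightarrow> (\<lambda>v. \<nu> (spread k N (emb v))) \<in> F"
    using limit_seminorm[OF inf', of k x] by (elim exE conjE)
  have "indep_upto k x" by (rule indep_upto_new) (use x(2) in blast)
  then have low0: "c = 0" if "Poly_Mapping.keys c \<subseteq> {..<k}" "\<nu> c = 0" for c
    using that low indep_upto_zero[of k x c] by simp
  have high0: "c = 0" if "Poly_Mapping.keys c \<inter> {..<k} = {}" "\<nu> c = 0" for c
    using that high unit_l2_independent[of c] by simp
  obtain N where N: "\<And>c. \<nu> (spread k N c) = 0 \<Longrightarrow> c = 0"
    using kernel_avoiding_shift[OF \<nu> low0 high0] by blast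
  \<comment> \<open>With the gap \<open>N\<close>, \<open>\<omega>\<close> is a norm, so its
    restriction \<open>\<mu>\<close> to rational vectors lies in \<open>B_norms\<close> and thus in
    \<open>I\<close>; membership in \<open>F n\<close> survives the relabelling.\<close>
  define \<omega> where "\<omega> c = \<nu> (spread k N c)" for c
  have \<omega>: "seminorm \<omega>"
    unfolding \<omega>_def[abs_def]
    by standard (simp_all add: spread_def comb_add comb_scaleR seminorm.scale[OF \<nu>] seminorm.triangle[OF \<nu>])
  define \<mu> where "\<mu> v = \<omega> (emb v)" for v
  have \<mu>: "\<mu> \<in> pseudonorms" "ext \<mu> = \<omega>"
    using pseudonorm_of_seminorm[OF \<omega>] by (simp_all add: \<mu>_def[abs_def])
  have "infinite_dimensional (cpl \<omega>)"
    by (rule infinite_dimensional_cpl_of_norm[OF \<omega>]) (simp add: \<omega>_def N)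
  then have "\<mu> \<in> B_norms" using \<mu> N by (simp add: B_norms_def P_infty_def X_space_eq \<omega>_def)
  then have "\<mu> \<in> I" using I by blast
  moreover have "\<mu> \<in> F n" using lim[rule_format, OF F(1), of n N] inF by (simp add: \<mu>_def[abs_def] \<omega>_def)
  ultimately have "\<mu> \<in> S" using D(2) F(2) by blast
  then obtain K f where K: "K \<ge> 1" and f: "bounded_iso K (X_space \<mu>) (space_of_type TYPE('a)) f"
    using isomorphic_X_space_iff[OF \<mu>(1), where 'b = 'a] by (auto simp: S_def)
  obtain z :: "nat \<Rightarrow> 'a" where z: "represents K \<mu> z"
    using represents_of_bounded_iso[OF \<mu>(1) f] K by auto
  have "l2_equiv K (\<lambda>i. z (k + i))"
    unfolding l2_equiv_def
  proof
    fix c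
    \<comment> \<open>Moving \<open>c\<close> past the first \<open>k\<close> coordinates brings it
      to where \<open>\<omega>\<close> is the norm of \<open>l2\<close>.\<close>
    define c' where "c' = comb (\<lambda>i. bas (k + i)) c"
    have cz: "comb w c' = comb (\<lambda>i. w (k + i)) c" for w :: "nat \<Rightarrow> 'v::real_vector"
      unfolding c'_def by (subst comb_image[OF linear_comb]) simp
    have keys: "Poly_Mapping.keys (spread k N c') \<inter> {..<k} = {}"
    proof -
      have sp: "spread k N c' = comb (\<lambda>i. bas (k + i + N)) c"
        unfolding spread_def cz by (simp add: shift_def)
      have "lookup (spread k N c') l = 0" if "l < k" for l
        unfolding sp comb_def lookup_sum using that by (intro sum.neutral) (auto simp: lookup_single when_def)
      then show ?thesis by (auto simp: in_keys_iff)
    qed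
    have "\<omega> c' = norm (comb unit_l2 (spread k N c'))" using high keys by (simp add: \<omega>_def)
    also have "\<dots> = norm (comb unit_l2 c')"
      unfolding comb_spread by (rule norm_comb_unit_inj[OF inj_shift])
    also have "\<dots> = norm (comb unit_l2 c)" unfolding cz by (rule norm_comb_unit_inj) (simp add: inj_def)
    finally have "\<omega> c' = norm (comb unit_l2 c)" .
    then show "norm (comb (\<lambda>i. z (k + i)) c) \<le> K * norm (comb unit_l2 c) \<and>
        norm (comb unit_l2 c) \<le> K * norm (comb (\<lambda>i. z (k + i)) c)"
      using represents_ext[OF \<mu>(1) z, of c'] K by (simp add: \<mu>(2) cz)
  qed
  moreover have "closure (range (comb z)) = UNIV" using z by (simp add: represents_def)
  ultimately show ?thesis using K by (intro isomorphic_l2_of_finite_codim)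
qed

theorem theorem1:
  fixes I :: "(V \<Rightarrow> real) set"
  assumes "I = B_norms \<or> I = P_infty"
    and "separable_space (euclidean :: 'a::banach topology)"
    and "infinite_dimensional (space_of_type TYPE('a))"
  shows "(closedin (subtopology (powertop_real UNIV) I)
            {\<mu> \<in> I. linearly_isometric (X_space \<mu>) (space_of_type TYPE('a))}
          \<longleftrightarrow> linearly_isometric (space_of_type TYPE('a)) (space_of_type TYPE(l2)))
    \<and> (fsigma_in (subtopology (powertop_real UNIV) I)
            {\<mu> \<in> I. linearly_isomorphic (X_space \<mu>) (space_of_type TYPE('a))}
          \<longleftrightarrow> linearly_isomorphic (space_of_type TYPE('a)) (space_of_type TYPE(l2)))"
proof -
  \<comment> \<open>Both choices of \<open>I\<close> enter through these inclusions: the lower one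
    supplies the pseudonorms of dense independent sequences and their limits, the upper one infinite
    dimension.\<close>
  have I: "I \<subseteq> P_infty" "B_norms \<subseteq> I" using assms(1) B_norms_subset by auto
  show ?thesis
    using isometry_class_l2_closed[OF I(1), where 'a = 'a] l2_of_closed_isometry_class[OF I assms(2,3)]
      isomorphism_class_l2_fsigma[OF I(1), where 'a = 'a] l2_of_fsigma_isomorphism_class[OF I assms(2,3)]
    by blast
qed

end
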